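(* Let $\Omega\subset\mathbb{R}^2$ be an open connected set, let $A=(A_1,A_2):\Omega\to\mathbb{R}^2$ be a real vector-valued function with $\|A\|_{L^2(\Omega)}\le C_0$ for some constant $C_0<\infty$, and let $v\in W^{1,2}_{loc}(\Omega)$ be any solution of $$\Delta v+\nabla\cdot(Av)=0\quad\text{in }\Omega.$$ Suppose that for some $z_0\in\Omega$ one has $$|v(z)|=\mathcal{O}(|z-z_0|^N)\quad\text{as }|z-z_0|\to0\quad\text{for all }N>0,$$ that is, for every $N>0$ there exist $C_N>0$ and $r_N>0$ such that $|v(z)|\le C_N|z-z_0|^N$ for (almost every) $z$ with $|z-z_0|<r_N$. Then $v\equiv0$ in $\Omega$.
   Context: The equation is understood in the weak (distributional) sense: $\int_\Omega(\nabla v+Av)\cdot\nabla\varphi=0$ for all $\varphi\in C_c^\infty(\Omega)$. The function $v$ may be real- or complex-valued. *)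

theory Defs
  imports "HOL-Analysis.Analysis"
begin

definition pderiv_vec :: "2 \<Rightarrow> (real^2 \<Rightarrow> real) \<Rightarrow> real^2 \<Rightarrow> real" where
  "pderiv_vec i f x = frechet_derivative f (at x) (axis i 1)"

text \<open>The class $C^k$ on the whole plane: all iterated partial derivatives up to order \<open>k\<close>
  exist and are continuous. Total differentiability of a $C^1$ function is automatic; it is
  demanded explicitly so that \<^const>\<open>frechet_derivative\<close> is meaningful.\<close>

fun C_k :: "nat \<Rightarrow> (real^2 \<Rightarrow> real) \<Rightarrow> bool" where
  "C_k 0 f \<longleftrightarrow> continuous_on UNIV f"
| "C_k (Suc k) f \<longleftrightarrow> (\<forall>x. f differentiable (at x)) \<and> (\<forall>i. C_k k (pderiv_vec i f))"

text \<open>Elements of $C_c^\infty(\Omega)$ are represented by their extension by zero to the plane.\<close>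

definition test_functions :: "(real^2) set \<Rightarrow> (real^2 \<Rightarrow> real) set" where
  "test_functions \<Omega> =
     {\<phi>. (\<forall>k. C_k k \<phi>) \<and> compact (closure {x. \<phi> x \<noteq> 0}) \<and> closure {x. \<phi> x \<noteq> 0} \<subseteq> \<Omega>}"

text \<open>Functions on \<open>\<Omega>\<close> are total functions whose values outside \<open>\<Omega>\<close> are irrelevant.\<close>

definition L2_on :: "(real^2) set \<Rightarrow> (real^2 \<Rightarrow> 'b::euclidean_space) \<Rightarrow> bool" where
  "L2_on \<Omega> f \<longleftrightarrow> f \<in> borel_measurable (lebesgue_on \<Omega>)
     \<and> integrable (lebesgue_on \<Omega>) (\<lambda>x. (norm (f x))\<^sup>2)"

definition L2_norm_on :: "(real^2) set \<Rightarrow> (real^2 \<Rightarrow> 'b::euclidean_space) \<Rightarrow> real" where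
  "L2_norm_on \<Omega> f = sqrt (\<integral>x. (norm (f x))\<^sup>2 \<partial>lebesgue_on \<Omega>)"

definition L2_loc :: "(real^2) set \<Rightarrow> (real^2 \<Rightarrow> 'b::euclidean_space) \<Rightarrow> bool" where
  "L2_loc \<Omega> f \<longleftrightarrow> (\<forall>K. compact K \<and> K \<subseteq> \<Omega> \<longrightarrow> L2_on K f)"

definition L1_loc :: "(real^2) set \<Rightarrow> (real^2 \<Rightarrow> 'b::euclidean_space) \<Rightarrow> bool" where
  "L1_loc \<Omega> f \<longleftrightarrow> (\<forall>K. compact K \<and> K \<subseteq> \<Omega> \<longrightarrow> integrable (lebesgue_on K) f)"

definition has_weak_gradient ::
    "(real^2) set \<Rightarrow> (real^2 \<Rightarrow> complex) \<Rightarrow> (real^2 \<Rightarrow> complex^2) \<Rightarrow> bool" where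
  "has_weak_gradient \<Omega> v G \<longleftrightarrow> L1_loc \<Omega> v \<and> L1_loc \<Omega> G \<and>
     (\<forall>\<phi>\<in>test_functions \<Omega>. \<forall>i.
        (\<integral>x. pderiv_vec i \<phi> x *\<^sub>R v x \<partial>lebesgue_on \<Omega>) = - (\<integral>x. \<phi> x *\<^sub>R (G x $ i) \<partial>lebesgue_on \<Omega>))"

definition W12_loc :: "(real^2) set \<Rightarrow> (real^2 \<Rightarrow> complex) \<Rightarrow> bool" where
  "W12_loc \<Omega> v \<longleftrightarrow> L2_loc \<Omega> v \<and> (\<exists>G. has_weak_gradient \<Omega> v G \<and> L2_loc \<Omega> G)"

text \<open>Weak solutions of $\Delta v + \nabla\cdot(Av) = 0$. The weak gradient \<open>G\<close> is unique up to null
  sets, so it is immaterial which representative is used. Real-valued test functions suffice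
  for complex \<open>v\<close>, since the identity is linear in \<open>\<phi>\<close>.\<close>

definition weak_solution ::
    "(real^2) set \<Rightarrow> (real^2 \<Rightarrow> real^2) \<Rightarrow> (real^2 \<Rightarrow> complex) \<Rightarrow> bool" where
  "weak_solution \<Omega> A v \<longleftrightarrow> (\<exists>G. has_weak_gradient \<Omega> v G \<and>
     (\<forall>\<phi>\<in>test_functions \<Omega>.
        (\<integral>x. (\<Sum>i\<in>UNIV. pderiv_vec i \<phi> x *\<^sub>R (G x $ i + (A x $ i) *\<^sub>R v x)) \<partial>lebesgue_on \<Omega>) = 0))"

definition vanishes_to_infinite_order ::
    "(real^2) set \<Rightarrow> (real^2 \<Rightarrow> complex) \<Rightarrow> real^2 \<Rightarrow> bool" where
  "vanishes_to_infinite_order \<Omega> v z0 \<longleftrightarrow> (\<forall>N::real. N > 0 \<longrightarrow>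
     (\<exists>C>0. \<exists>r>0. AE z in lebesgue_on \<Omega>.
        norm (z - z0) < r \<longrightarrow> norm (v z) \<le> C * norm (z - z0) powr N))"

end

theory Submission
  imports Defs
begin

text \<open>Since \<open>A\<close> is real, the real and imaginary parts of \<open>v\<close> solve the equation separately; let \<open>f\<close> be
  one of them and put \<open>a = z\<^sub>0\<close>. Test the equation with a cutoff of \<open>ln |z - x|\<close> minus its Taylor
  polynomial of degree \<open>< N\<close> in \<open>x\<close> at \<open>a\<close>, a kernel whose gradient in \<open>z\<close> has modulus
  \<open>|x - a|\<^sup>N / (|z - a|\<^sup>N |z - x|)\<close>; its pole at \<open>a\<close> is harmless because \<open>f\<close> vanishes there to
  infinite order. With \<open>w = |f| / |z - a|\<^sup>N\<close> and the Riesz potential \<open>I\<close> with kernel \<open>1 / |z - x|\<close>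
  this gives \<open>w \<le> C I(|A| w) + O(R\<^sup>-\<^sup>N)\<close> on a ball of radius \<open>R\<close>. The map \<open>w \<mapsto> I(|A| w)\<close> is
  bounded on weak \<open>L\<^sup>4\<close> with norm at most a constant times the \<open>L\<^sup>2\<close> norm of \<open>A\<close>, so on
  balls where the latter is small the first term is absorbed, and \<open>N \<rightarrow> \<infinity>\<close> shows that \<open>f\<close> vanishes in the ball. That \<open>w\<close> lies
  in weak \<open>L\<^sup>4\<close> to begin with follows from the same bound on \<open>I\<close> applied to the gradient of \<open>f\<close>. The
  admissible radius depends only on \<open>A\<close>, which propagates the zero set through the connected
  domain.\<close>

section \<open>Riesz potentials and weak integrability\<close>

text \<open>The obstacle is that \<open>A\<close> is only in L^2, the scaling-critical class in the
  plane: multiplication by \<open>A\<close> followed by \<open>I\<close> leads back to the same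
  space and gains nothing, so smallness can come only from shrinking the ball. At the endpoint even
  boundedness fails, as \<open>I\<close> does not map L^2 into bounded functions. Hence the
  pointwise inequality is closed not in the supremum norm but at an exponent strictly between 2 and
  infinity; exponent 4 reduces everything to squares. The other issue is uniformity in
  \<open>N\<close>. Subtracting the Taylor polynomial truncates a geometric series whose remainder
  is known exactly, so the factor in front of \<open>I(|A| w)\<close> is the same for all
  \<open>N\<close>, and the radius is fixed before \<open>N\<close> tends to infinity. Since all
  derivatives fall on the test function, only the size of \<open>f\<close> near \<open>a\<close>
  matters there, not that of its gradient. Evaluation at \<open>x\<close> is done by mollifying:
  \<open>ln |z - x|\<close> is replaced by the smooth function
  \<open>ln (|z - x|^2 + e^2) / 2\<close>, so that the test function has its only pole at
  \<open>a\<close>; as \<open>e\<close> tends to 0, point values are recovered almost everywhere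
  along a subsequence.\<close>

definition riesz :: "(real^2 \<Rightarrow> ennreal) \<Rightarrow> real^2 \<Rightarrow> ennreal" where
  "riesz u x = (\<integral>\<^sup>+y. u y * ennreal (1 / norm (x - y)) \<partial>lborel)"

lemma measurable_riesz [measurable]:
  assumes [measurable]: "u \<in> borel_measurable borel"
  shows "riesz u \<in> borel_measurable borel"
  unfolding riesz_def by measurable

lemma riesz_mono_AE:
  assumes "AE x in lborel. u x \<le> w x"
  shows "riesz u x \<le> riesz w x"
  unfolding riesz_def using assms
  by (intro nn_integral_mono_AE) (auto intro: mult_right_mono elim!: eventually_mono)

lemma riesz_add:
  assumes [measurable]: "u \<in> borel_measurable borel" "w \<in> borel_measurable borel"
  shows "riesz (\<lambda>y. u y + w y) x = riesz u x + riesz w x"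
  unfolding riesz_def by (simp add: distrib_right nn_integral_add)

lemma riesz_cmult:
  assumes [measurable]: "u \<in> borel_measurable borel"
  shows "riesz (\<lambda>y. c * u y) x = c * riesz u x"
  unfolding riesz_def by (simp add: mult.assoc nn_integral_cmult)

text \<open>Tonelli and the symmetry of the kernel. It moves a potential onto the indicator of a
  level set, which turns estimates for potentials of indicators into weak estimates for general
  potentials.\<close>

lemma riesz_symmetric:
  assumes [measurable]: "u \<in> borel_measurable borel" "w \<in> borel_measurable borel"
  shows "(\<integral>\<^sup>+x. w x * riesz u x \<partial>lborel) = (\<integral>\<^sup>+x. u x * riesz w x \<partial>lborel)"
proof -
  have "(\<integral>\<^sup>+x. w x * riesz u x \<partial>lborel)
      = (\<integral>\<^sup>+x. \<integral>\<^sup>+y. w x * u y * ennreal (1 / norm (x - y)) \<partial>lborel \<partial>lborel)"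
    unfolding riesz_def by (subst nn_integral_cmult [symmetric]) (auto simp: mult.assoc)
  also have "\<dots> = (\<integral>\<^sup>+y. \<integral>\<^sup>+x. w x * u y * ennreal (1 / norm (x - y)) \<partial>lborel \<partial>lborel)"
    by (rule lborel_pair.Fubini') simp
  also have "\<dots> = (\<integral>\<^sup>+x. u x * riesz w x \<partial>lborel)"
    unfolding riesz_def
    by (subst nn_integral_cmult [symmetric]) (auto simp: ac_simps norm_minus_commute)
  finally show ?thesis .
qed

section \<open>Layer cake formulas\<close>

lemma nn_integral_lborel_below:
  "(\<integral>\<^sup>+t. indicator {t::real. 0 < t \<and> ennreal t < a} t \<partial>lborel) = a"
proof (cases a)
  case (real r)
  have "{t::real. 0 < t \<and> ennreal t < a} = {0<..<r}"
    using real by (auto simp: ennreal_less_iff)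
  then show ?thesis using real by (simp add: emeasure_lborel_Ioo)
next
  case top
  then have "{t::real. 0 < t \<and> ennreal t < a} = {0<..}" by auto
  moreover have "emeasure lborel {0::real<..} = top"
  proof (rule top.extremum_uniqueI)
    show "top \<le> emeasure lborel {0::real<..}"
    proof (rule ccontr)
      assume "\<not> top \<le> emeasure lborel {0::real<..}"
      then have "emeasure lborel {0::real<..} < top" by simp
      then obtain r where r: "emeasure lborel {0::real<..} = ennreal r" "r \<ge> 0"
        by (cases "emeasure lborel {0::real<..}") auto
      have "emeasure lborel {0<..<r+1} \<le> emeasure lborel {0::real<..}"
        by (intro emeasure_mono) auto
      then show False using r by (simp add: emeasure_lborel_Ioo)
    qed
  qed
  ultimately show ?thesis using top by simp
qed

lemma top_if_ge_nat:
  assumes "\<And>n::nat. ennreal (real n) \<le> X"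
  shows "X = top"
proof (cases X)
  case (real r)
  obtain n where "r < real n" using reals_Archimedean2 by blast
  with assms[of n] real show ?thesis by simp
qed

text \<open>The derivative of \<open>t^2\<close> is \<open>2 * t\<close>. Infinite \<open>a\<close>
  is included because potentials may be infinite.\<close>

lemma nn_integral_lborel_below_sq:
  "(\<integral>\<^sup>+t. ennreal (2 * t) * indicator {t::real. 0 < t \<and> ennreal t < a} t \<partial>lborel) = a\<^sup>2"
proof -
  have fin: "(\<integral>\<^sup>+t. ennreal (2 * t) * indicator {0..r} t \<partial>lborel) = ennreal (r\<^sup>2)" if "r \<ge> 0" for r :: real
    using that
    by (subst nn_integral_FTC_Icc[where F="\<lambda>t. t\<^sup>2"]) (auto intro!: derivative_eq_intros simp: has_real_derivative_iff_has_vector_derivative[symmetric])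
  have ae: "AE t in lborel. t \<noteq> r" for r :: real by (rule AE_lborel_singleton)
  show ?thesis
  proof (cases a)
    case (real r)
    have "(\<integral>\<^sup>+t. ennreal (2 * t) * indicator {t::real. 0 < t \<and> ennreal t < a} t \<partial>lborel)
        = (\<integral>\<^sup>+t. ennreal (2 * t) * indicator {0..r} t \<partial>lborel)"
      using ae[of r] ae[of 0] real
      by (intro nn_integral_cong_AE) (auto simp: indicator_def ennreal_less_iff elim!: eventually_elim2)
    then show ?thesis using real fin by (simp add: ennreal_power)
  next
    case top
    have "ennreal (real n) \<le> (\<integral>\<^sup>+t. ennreal (2 * t) * indicator {t::real. 0 < t \<and> ennreal t < a} t \<partial>lborel)" for n
    proof -
      have "ennreal (real n) \<le> ennreal ((real n)\<^sup>2)"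
        by (intro ennreal_leI) (simp add: power2_eq_square le_square flip: of_nat_mult)
      also have "\<dots> = (\<integral>\<^sup>+t. ennreal (2 * t) * indicator {0..real n} t \<partial>lborel)" using fin by simp
      also have "\<dots> \<le> (\<integral>\<^sup>+t. ennreal (2 * t) * indicator {t::real. 0 < t \<and> ennreal t < a} t \<partial>lborel)"
        using ae[of 0] top by (intro nn_integral_mono_AE) (auto simp: indicator_def)
      finally show ?thesis .
    qed
    then have "(\<integral>\<^sup>+t. ennreal (2 * t) * indicator {t::real. 0 < t \<and> ennreal t < a} t \<partial>lborel) = top"
      by (rule top_if_ge_nat)
    then show ?thesis using top by (simp add: power2_eq_square)
  qed
qed

text \<open>Tonelli applied to the preceding representation of \<open>(g x)^2\<close>. The weight
  \<open>u\<close> is kept general: it is an indicator in one application and the square of a weak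
  L^4 function in another.\<close>

lemma layer_cake_sq:
  assumes [measurable]: "u \<in> borel_measurable lborel" "g \<in> borel_measurable lborel"
  shows "(\<integral>\<^sup>+x. u x * (g x)\<^sup>2 \<partial>(lborel::(real^2) measure)) =
    (\<integral>\<^sup>+t. ennreal (2 * t) * indicator {0<..} t * (\<integral>\<^sup>+x. u x * indicator {x. ennreal t < g x} x \<partial>lborel) \<partial>lborel)"
proof -
  have "(\<integral>\<^sup>+x. u x * (g x)\<^sup>2 \<partial>lborel) =
     (\<integral>\<^sup>+x. \<integral>\<^sup>+t. u x * (ennreal (2 * t) * indicator {0<..} t * indicator {x. ennreal t < g x} x) \<partial>lborel \<partial>lborel)"
    apply (intro nn_integral_cong)
    apply (subst nn_integral_cmult)
     apply measurable
    apply (subst nn_integral_lborel_below_sq [symmetric])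
    apply (auto intro!: arg_cong[where f="\<lambda>x. _ * x"] nn_integral_cong simp: indicator_def)
    done
  also have "\<dots> = (\<integral>\<^sup>+t. \<integral>\<^sup>+x. u x * (ennreal (2 * t) * indicator {0<..} t * indicator {x. ennreal t < g x} x) \<partial>lborel \<partial>lborel)"
    by (rule lborel_pair.Fubini') measurable
  also have "\<dots> = (\<integral>\<^sup>+t. ennreal (2 * t) * indicator {0<..} t * (\<integral>\<^sup>+x. u x * indicator {x. ennreal t < g x} x \<partial>lborel) \<partial>lborel)"
    by (intro nn_integral_cong, subst nn_integral_cmult [symmetric]) (auto simp: ac_simps)
  finally show ?thesis .
qed

text \<open>For \<open>t > 0\<close> the superlevel set of the kernel is the ball of radius
  \<open>1 / t\<close> around \<open>x\<close>, without its centre since \<open>1 / 0 = 0\<close>. A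
  potential thus becomes an integral over masses of balls.\<close>

lemma layer_cake_riesz:
  assumes [measurable]: "u \<in> borel_measurable borel"
  shows "riesz u x =
    (\<integral>\<^sup>+t. indicator {0<..} t * (\<integral>\<^sup>+y. u y * indicator {y. ennreal t < ennreal (1 / norm (x - y))} y \<partial>lborel) \<partial>lborel)"
proof -
  have "riesz u x =
     (\<integral>\<^sup>+y. \<integral>\<^sup>+t. u y * (indicator {0<..} t * indicator {y. ennreal t < ennreal (1 / norm (x - y))} y) \<partial>lborel \<partial>lborel)"
    unfolding riesz_def
    apply (intro nn_integral_cong)
    apply (subst nn_integral_cmult)
     apply measurable
    subgoal for y
      apply (subst nn_integral_lborel_below [symmetric, of "ennreal (1 / norm (x - y))"])
      apply (rule arg_cong[where f="\<lambda>z. u y * z"], rule nn_integral_cong)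
      apply (auto simp: indicator_def)
      done
    done
  also have "\<dots> = (\<integral>\<^sup>+t. \<integral>\<^sup>+y. u y * (indicator {0<..} t * indicator {y. ennreal t < ennreal (1 / norm (x - y))} y) \<partial>lborel \<partial>lborel)"
    by (rule lborel_pair.Fubini') measurable
  also have "\<dots> = (\<integral>\<^sup>+t. indicator {0<..} t * (\<integral>\<^sup>+y. u y * indicator {y. ennreal t < ennreal (1 / norm (x - y))} y \<partial>lborel) \<partial>lborel)"
    by (intro nn_integral_cong, subst nn_integral_cmult [symmetric]) (auto simp: ac_simps)
  finally show ?thesis .
qed

text \<open>The value of \<open>e * T + pi / T\<close> at \<open>T = 1 / sqrt e\<close>, divided by
  \<open>sqrt e\<close>; this sum bounds the potential of an indicator. Optimising \<open>T\<close>
  would give \<open>2 * sqrt pi\<close>.\<close>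

definition riesz_const :: real where "riesz_const = 1 + pi"

lemma riesz_const_pos: "riesz_const > 0" by (simp add: riesz_const_def add_pos_pos)

lemma emeasure_plane_ball: "r \<ge> 0 \<Longrightarrow> emeasure lborel (ball (x::real^2) r) = ennreal (pi * r\<^sup>2)"
  by (simp add: emeasure_ball eval_unit_ball_vol power2_eq_square)

lemma nn_integral_tail_sq:
  assumes "T > 0"
  shows "(\<integral>\<^sup>+t. ennreal (pi / t\<^sup>2) * indicator {T..} t \<partial>lborel) = ennreal (pi / T)"
proof -
  have "(\<integral>\<^sup>+t. ennreal (pi / t\<^sup>2) * indicator {T..} t \<partial>lborel) = ennreal (0 - (- pi / T))"
  proof (rule nn_integral_FTC_atLeast)
    fix t assume "T \<le> t"
    with assms show "((\<lambda>t. - pi / t) has_real_derivative pi / t\<^sup>2) (at t)"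
      by (auto intro!: derivative_eq_intros simp: power2_eq_square)
  next
    show "((\<lambda>t. - pi / t) \<longlongrightarrow> 0) at_top"
      by real_asymp
  qed auto
  then show ?thesis by simp
qed

text \<open>At height \<open>t\<close> the mass in the layer cake formula is at most the measure of
  \<open>E\<close> and at most the area of a ball of radius \<open>1 / t\<close>. The first bound is
  integrated up to a height \<open>T\<close>, the second beyond it, where \<open>1 / t^2\<close> is
  integrable.\<close>

lemma riesz_indicator_le:
  assumes E [measurable]: "E \<in> sets borel" and e: "emeasure lborel E = ennreal e" "e > 0"
  shows "riesz (indicator E) x \<le> ennreal (riesz_const * sqrt e)"
proof -
  \<comment> \<open>With this height both contributions \<open>e * T\<close> and
    \<open>pi / T\<close> are multiples of \<open>sqrt e\<close>.\<close>
  define T where "T = 1 / sqrt e"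
  have T: "T > 0" using e by (simp add: T_def)
  define m where "m t = (\<integral>\<^sup>+y. indicator E y * indicator {y. ennreal t < ennreal (1 / norm (x - y))} y \<partial>lborel)" for t
  have m1: "m t \<le> ennreal e" for t
  proof -
    have "m t \<le> (\<integral>\<^sup>+y. indicator E y \<partial>lborel)"
      unfolding m_def by (intro nn_integral_mono) (auto simp: indicator_def)
    then show ?thesis using e by simp
  qed
  have m2: "m t \<le> ennreal (pi / t\<^sup>2)" if "t > 0" for t
  proof -
    have "m t \<le> (\<integral>\<^sup>+y. indicator (ball x (1 / t)) y \<partial>lborel)"
      unfolding m_def
    proof (intro nn_integral_mono)
      fix y
      have "norm (x - y) < 1 / t" if "t < 1 / norm (x - y)"
        using that \<open>t > 0\<close> by (cases "x = y") (auto simp: field_simps)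
      then show "indicator E y * indicator {y. ennreal t < ennreal (1 / norm (x - y))} y \<le> (indicator (ball x (1 / t)) y :: ennreal)"
        using \<open>t > 0\<close> by (auto simp: indicator_def ennreal_less_iff dist_norm)
    qed
    also have "\<dots> = ennreal (pi * (1 / t)\<^sup>2)"
      using that by (simp add: emeasure_plane_ball)
    finally show ?thesis by (simp add: power_divide)
  qed
  have "riesz (indicator E) x = (\<integral>\<^sup>+t. indicator {0<..} t * m t \<partial>lborel)"
    unfolding m_def by (rule layer_cake_riesz) simp
  also have "\<dots> \<le> (\<integral>\<^sup>+t. ennreal e * indicator {0..T} t + ennreal (pi / t\<^sup>2) * indicator {T..} t \<partial>lborel)"
    using m1 m2 T by (intro nn_integral_mono) (auto simp: indicator_def intro: add_increasing2)
  also have "\<dots> = ennreal e * ennreal T + ennreal (pi / T)"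
    using T by (subst nn_integral_add) (auto simp: nn_integral_cmult nn_integral_tail_sq)
  also have "\<dots> = ennreal (e * T + pi / T)"
    using T e by (simp add: ennreal_mult ennreal_plus)
  also have "e * T + pi / T = riesz_const * sqrt e"
    using e real_sqrt_mult_self[of e] by (simp add: T_def riesz_const_def field_simps)
  finally show ?thesis .
qed

text \<open>The duality arguments cancel a power of the measure of a level set, which must be finite
  for that; intersecting with balls provides finiteness.\<close>

lemma emeasure_le_if_bounded_parts:
  assumes [measurable]: "E \<in> sets borel"
    and "\<And>n::nat. emeasure lborel (E \<inter> ball (0::real^2) (real n)) \<le> c"
  shows "emeasure lborel E \<le> c"
proof -
  have "(\<Union>n. E \<inter> ball 0 (real n)) = E"
    by (auto simp: real_arch_simple reals_Archimedean2)
  moreover have "(SUP n. emeasure lborel (E \<inter> ball 0 (real n))) = emeasure lborel (\<Union>n. E \<inter> ball 0 (real n))"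
    by (intro SUP_emeasure_incseq) (auto simp: incseq_def)
  ultimately have "emeasure lborel E = (SUP n. emeasure lborel (E \<inter> ball 0 (real n)))" by simp
  then show ?thesis using assms(2) by (simp add: SUP_le_iff)
qed

lemma emeasure_bounded_part_finite:
  assumes [measurable]: "E \<in> sets borel"
  shows "\<exists>e\<ge>0. emeasure lborel (E \<inter> ball (0::real^2) (real n)) = ennreal e"
proof -
  have "emeasure lborel (E \<inter> ball (0::real^2) (real n)) \<le> emeasure lborel (ball (0::real^2) (real n))"
    by (intro emeasure_mono) auto
  also have "\<dots> < top" by (simp add: emeasure_plane_ball)
  finally show ?thesis
    by (cases "emeasure lborel (E \<inter> ball (0::real^2) (real n))") auto
qed

lemma emeasure_level_mult_le:
  assumes [measurable]: "u \<in> borel_measurable borel" "F \<in> sets borel"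
    and "\<And>x. x \<in> F \<Longrightarrow> ennreal t < u x"
  shows "ennreal t * emeasure lborel F \<le> (\<integral>\<^sup>+x. indicator F x * u x \<partial>lborel)"
proof -
  have "ennreal t * emeasure lborel F = (\<integral>\<^sup>+x. ennreal t * indicator F x \<partial>lborel)"
    by (simp add: nn_integral_cmult)
  also have "\<dots> \<le> (\<integral>\<^sup>+x. indicator F x * u x \<partial>lborel)"
    using assms(3) by (intro nn_integral_mono) (auto simp: indicator_def less_imp_le)
  finally show ?thesis .
qed

text \<open>Duality: the potential of \<open>E\<close> integrated over a part \<open>F\<close> of
  the level set equals the potential of \<open>F\<close> integrated over \<open>E\<close>, which is
  at most \<open>riesz_const * sqrt f * e\<close> with \<open>f\<close> the measure of
  \<open>F\<close>. Since it is at least \<open>t * f\<close>, a factor \<open>sqrt f\<close>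
  cancels. The outcome is a weak L^2 bound.\<close>

lemma riesz_indicator_level:
  assumes E [measurable]: "E \<in> sets borel" and e: "emeasure lborel E = ennreal e" "e > 0" and t: "t > 0"
  shows "emeasure lborel {x. ennreal t < riesz (indicator E) x} \<le> ennreal ((riesz_const * e / t)\<^sup>2)"
proof (rule emeasure_le_if_bounded_parts)
  show m: "{x. ennreal t < riesz (indicator E) x} \<in> sets borel" by measurable
  fix n
  define F where "F = {x. ennreal t < riesz (indicator E) x} \<inter> ball 0 (real n)"
  have F [measurable]: "F \<in> sets borel" unfolding F_def by measurable
  obtain f where f: "f \<ge> 0" "emeasure lborel F = ennreal f"
    using emeasure_bounded_part_finite[OF m, of n] by (auto simp: F_def)
  have "f \<le> (riesz_const * e / t)\<^sup>2"
  proof (cases "f = 0")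
    case False
    with f have fp: "f > 0" by simp
    have "ennreal t * emeasure lborel F \<le> (\<integral>\<^sup>+x. indicator F x * riesz (indicator E) x \<partial>lborel)"
      by (rule emeasure_level_mult_le) (simp_all add: F_def)
    then have "ennreal t * ennreal f \<le> (\<integral>\<^sup>+x. indicator F x * riesz (indicator E) x \<partial>lborel)"
      by (simp only: f)
    also have "\<dots> = (\<integral>\<^sup>+x. indicator E x * riesz (indicator F) x \<partial>lborel)"
      by (rule riesz_symmetric) auto
    also have "\<dots> \<le> (\<integral>\<^sup>+x. ennreal (riesz_const * sqrt f) * indicator E x \<partial>lborel)"
      using riesz_indicator_le[OF F f(2) fp]
      by (intro nn_integral_mono) (auto simp: indicator_def)
    also have "\<dots> = ennreal (riesz_const * sqrt f) * ennreal e" using e by (simp add: nn_integral_cmult)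
    finally have "t * f \<le> riesz_const * sqrt f * e"
      using t fp e riesz_const_pos by (simp add: ennreal_mult[symmetric])
    then have "t * sqrt f * sqrt f \<le> riesz_const * e * sqrt f" using f by (simp add: mult_ac)
    then have "t * sqrt f \<le> riesz_const * e" by (rule mult_right_le_imp_le) (use fp in simp)
    then have "sqrt f \<le> riesz_const * e / t" using t by (simp add: field_simps)
    then have "(sqrt f)\<^sup>2 \<le> (riesz_const * e / t)\<^sup>2" using f by (intro power_mono) auto
    then show ?thesis using f by simp
  qed simp
  then show "emeasure lborel ({x. ennreal t < riesz (indicator E) x} \<inter> ball 0 (real n)) \<le> ennreal ((riesz_const * e / t)\<^sup>2)"
    using f by (fold F_def) (simp add: ennreal_leI)
qed

text \<open>The fourth power of the weak \<open>L\<^sup>4\<close> quasi-norm of \<open>w\<close> is at most \<open>q\<close>.\<close>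

definition weak4 :: "(real^2 \<Rightarrow> ennreal) \<Rightarrow> real \<Rightarrow> bool" where
  "weak4 w q \<longleftrightarrow> w \<in> borel_measurable borel \<and> 0 \<le> q \<and>
     (\<forall>t>0. emeasure lborel {x. ennreal t < w x} \<le> ennreal (q / t^4))"

lemma nn_integral_tail_cubic:
  assumes "T > 0" "q \<ge> 0"
  shows "(\<integral>\<^sup>+t. ennreal (2 * q / t^3) * indicator {T..} t \<partial>lborel) = ennreal (q / T\<^sup>2)"
proof -
  have "(\<integral>\<^sup>+t. ennreal (2 * q / t^3) * indicator {T..} t \<partial>lborel) = ennreal (0 - (- q / T\<^sup>2))"
  proof (rule nn_integral_FTC_atLeast)
    fix t assume "T \<le> t"
    with assms show "((\<lambda>t. - q / t\<^sup>2) has_real_derivative 2 * q / t^3) (at t)"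
      by (auto intro!: derivative_eq_intros simp: power2_eq_square power3_eq_cube mult_ac)
  next
    show "((\<lambda>t. - q / t\<^sup>2) \<longlongrightarrow> 0) at_top"
      by real_asymp
  next
    fix t assume "T \<le> t" with assms show "0 \<le> 2 * q / t^3" by auto
  qed auto
  then show ?thesis by simp
qed

text \<open>Inside \<open>F\<close> the level sets have measure at most the minimum of
  \<open>f\<close> and \<open>q / t^4\<close>, and \<open>2 * t\<close> times this minimum is
  integrable over the half-line. Splitting where the two bounds agree yields the constant 2.\<close>

lemma weak4_square_integral:
  assumes w: "weak4 w q" and F [measurable]: "F \<in> sets borel"
    and f: "emeasure lborel F \<le> ennreal f" "f \<ge> 0"
  shows "(\<integral>\<^sup>+x. indicator F x * (w x)\<^sup>2 \<partial>lborel) \<le> ennreal (2 * sqrt q * sqrt f)"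
proof -
  have [measurable]: "w \<in> borel_measurable borel" and q: "q \<ge> 0"
    and lev: "\<And>t. t > 0 \<Longrightarrow> emeasure lborel {x. ennreal t < w x} \<le> ennreal (q / t^4)"
    using w by (auto simp: weak4_def)
  \<comment> \<open>The splitting height requires positive parameters, so larger positive ones come
    first; vanishing \<open>q\<close> or \<open>f\<close> follow in the limit.\<close>
  have *: "(\<integral>\<^sup>+x. indicator F x * (w x)\<^sup>2 \<partial>lborel) \<le> ennreal (2 * sqrt q' * sqrt f')"
    if q': "q' > 0" "q \<le> q'" and f': "f' > 0" "f \<le> f'" for q' f'
  proof -
    \<comment> \<open>\<open>T^4 = q' / f'\<close>, the height at which the bounds \<open>f'\<close>
      and \<open>q' / t^4\<close> coincide.\<close>
    define T where "T = sqrt (sqrt q' / sqrt f')"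
    have T: "T > 0" "T\<^sup>2 = sqrt q' / sqrt f'" using q' f' by (auto simp: T_def)
    define m where "m t = (\<integral>\<^sup>+x. indicator F x * indicator {x. ennreal t < w x} x \<partial>lborel)" for t
    have m1: "m t \<le> ennreal f'" for t
    proof -
      have "m t \<le> (\<integral>\<^sup>+y. indicator F y \<partial>lborel)"
        unfolding m_def by (intro nn_integral_mono) (auto simp: indicator_def)
      also have "\<dots> \<le> ennreal f" using f by simp
      also have "\<dots> \<le> ennreal f'" using f' by (simp add: ennreal_leI)
      finally show ?thesis .
    qed
    have m2: "m t \<le> ennreal (q' / t^4)" if t: "t > 0" for t
    proof -
      have "m t \<le> (\<integral>\<^sup>+y. indicator {x. ennreal t < w x} y \<partial>lborel)"
        unfolding m_def by (intro nn_integral_mono) (auto simp: indicator_def)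
      also have "\<dots> \<le> ennreal (q / t^4)" using lev[OF t] by simp
      also have "\<dots> \<le> ennreal (q' / t^4)" using q' t by (intro ennreal_leI divide_right_mono) auto
      finally show ?thesis .
    qed
    have "(\<integral>\<^sup>+x. indicator F x * (w x)\<^sup>2 \<partial>lborel) = (\<integral>\<^sup>+t. ennreal (2 * t) * indicator {0<..} t * m t \<partial>lborel)"
      unfolding m_def by (rule layer_cake_sq) auto
    also have "\<dots> \<le> (\<integral>\<^sup>+t. ennreal f' * (ennreal (2 * t) * indicator {0..T} t) + ennreal (2 * q' / t^3) * indicator {T..} t \<partial>lborel)"
    proof (rule nn_integral_mono)
      fix t :: real
      have "ennreal (2 * t) * m t \<le> ennreal (2 * q' / t^3)" if "t > 0"
      proof -
        have "ennreal (2 * t) * m t \<le> ennreal (2 * t) * ennreal (q' / t^4)" using m2[OF that] by (rule mult_left_mono) simp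
        also have "\<dots> = ennreal (2 * q' / t^3)" using that q'
          by (simp add: ennreal_mult[symmetric] eval_nat_numeral)
        finally show ?thesis .
      qed
      moreover have "ennreal (2 * t) * m t \<le> ennreal f' * ennreal (2 * t)"
        using m1[of t] by (metis mult.commute mult_left_mono zero_le)
      ultimately show "ennreal (2 * t) * indicator {0<..} t * m t \<le> ennreal f' * (ennreal (2 * t) * indicator {0..T} t) + ennreal (2 * q' / t^3) * indicator {T..} t"
        using T by (auto simp: indicator_def intro: add_increasing2)
    qed
    also have "\<dots> = ennreal f' * ennreal (T\<^sup>2) + ennreal (q' / T\<^sup>2)"
    proof -
      have "(\<integral>\<^sup>+t. ennreal (2 * t) * indicator {0..T} t \<partial>lborel) = ennreal (T\<^sup>2)"
        using T
        by (subst nn_integral_FTC_Icc[where F="\<lambda>t. t\<^sup>2"]) (auto intro!: derivative_eq_intros simp: has_real_derivative_iff_has_vector_derivative[symmetric])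
      then show ?thesis using T q'
        by (subst nn_integral_add) (auto simp: nn_integral_cmult nn_integral_tail_cubic)
    qed
    also have "\<dots> = ennreal (f' * T\<^sup>2 + q' / T\<^sup>2)"
      using f' q' by (simp add: ennreal_mult ennreal_plus)
    also have "f' * T\<^sup>2 + q' / T\<^sup>2 = 2 * sqrt q' * sqrt f'"
    proof -
      have "f' * (sqrt q' / sqrt f') = sqrt q' * sqrt f'"
        using f' real_sqrt_mult_self[of f'] by (simp add: field_simps)
      moreover have "q' / (sqrt q' / sqrt f') = sqrt q' * sqrt f'"
        using q' f' real_sqrt_mult_self[of q'] by (simp add: field_simps)
      ultimately show ?thesis by (simp add: T(2))
    qed
    finally show ?thesis .
  qed
  define c where "c n = 2 * sqrt (q + 1 / real (Suc n)) * sqrt (f + 1 / real (Suc n))" for n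
  have "(\<lambda>n. ennreal (c n)) \<longlonglongrightarrow> ennreal (2 * sqrt (q + 0) * sqrt (f + 0))"
    unfolding c_def by (intro tendsto_ennrealI tendsto_intros LIMSEQ_Suc[OF lim_1_over_n])
  moreover have "(\<integral>\<^sup>+x. indicator F x * (w x)\<^sup>2 \<partial>lborel) \<le> ennreal (c n)" for n
    unfolding c_def using q f by (intro *) (auto intro: add_nonneg_pos)
  ultimately show ?thesis
    by (intro LIMSEQ_le_const[where X="\<lambda>n. ennreal (c n)"]) auto
qed

text \<open>Layer cake with weight \<open>w^2\<close>. The level sets of the potential have measure
  at most \<open>(riesz_const * e / t)^2\<close>, so \<open>w^2\<close> has mass of order
  \<open>1 / t\<close> on them and \<open>2 * t\<close> times this mass stays bounded. Above the
  height \<open>riesz_const * sqrt e\<close> the level sets are empty, which makes the integral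
  finite.\<close>

lemma nn_integral_weak4_riesz_sq:
  assumes w: "weak4 w q" and E [measurable]: "E \<in> sets borel"
    and e: "emeasure lborel E = ennreal e" "e > 0"
  shows "(\<integral>\<^sup>+x. (w x)\<^sup>2 * (riesz (indicator E) x)\<^sup>2 \<partial>lborel) \<le> ennreal (4 * riesz_const\<^sup>2 * sqrt q * e * sqrt e)"
proof -
  have [measurable]: "w \<in> borel_measurable borel" and q: "q \<ge> 0"
    using w by (auto simp: weak4_def)
  define T where "T = riesz_const * sqrt e"
  have T: "T > 0" using e riesz_const_pos by (simp add: T_def)
  define m where "m t = (\<integral>\<^sup>+x. (w x)\<^sup>2 * indicator {x. ennreal t < riesz (indicator E) x} x \<partial>lborel)" for t
  have m1: "m t = 0" if "t \<ge> T" for t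
  proof -
    have "\<not> ennreal t < riesz (indicator E) x" for x
      using riesz_indicator_le[OF E e, of x] that unfolding T_def
      by (metis ennreal_leI leD order_trans)
    then show ?thesis by (simp add: m_def)
  qed
  have m2: "m t \<le> ennreal (2 * sqrt q * (riesz_const * e / t))" if t: "t > 0" for t
  proof -
    have "m t = (\<integral>\<^sup>+x. indicator {x. ennreal t < riesz (indicator E) x} x * (w x)\<^sup>2 \<partial>lborel)"
      unfolding m_def by (simp add: mult.commute)
    also have "\<dots> \<le> ennreal (2 * sqrt q * sqrt ((riesz_const * e / t)\<^sup>2))"
      by (rule weak4_square_integral[OF w _ riesz_indicator_level[OF E e t]]) (use t e riesz_const_pos in auto)
    finally show ?thesis using t e riesz_const_pos by simp
  qed
  have "(\<integral>\<^sup>+x. (w x)\<^sup>2 * (riesz (indicator E) x)\<^sup>2 \<partial>lborel) = (\<integral>\<^sup>+t. ennreal (2 * t) * indicator {0<..} t * m t \<partial>lborel)"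
    unfolding m_def by (rule layer_cake_sq) auto
  also have "\<dots> \<le> (\<integral>\<^sup>+t. ennreal (4 * sqrt q * riesz_const * e) * indicator {0..T} t \<partial>lborel)"
  proof (rule nn_integral_mono)
    fix t :: real
    have "ennreal (2 * t) * m t \<le> ennreal (4 * sqrt q * riesz_const * e)" if t: "t > 0"
    proof -
      have "ennreal (2 * t) * m t \<le> ennreal (2 * t) * ennreal (2 * sqrt q * (riesz_const * e / t))"
        using m2[OF t] by (rule mult_left_mono) simp
      also have "\<dots> = ennreal (4 * sqrt q * riesz_const * e)"
        using t q e riesz_const_pos by (subst ennreal_mult[symmetric]) (auto simp: field_simps)
      finally show ?thesis .
    qed
    then show "ennreal (2 * t) * indicator {0<..} t * m t \<le> ennreal (4 * sqrt q * riesz_const * e) * indicator {0..T} t"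
      using m1[of t] by (auto simp: indicator_def)
  qed
  also have "\<dots> = ennreal (4 * sqrt q * riesz_const * e) * ennreal T"
    using T by (simp add: nn_integral_cmult)
  also have "\<dots> = ennreal (4 * riesz_const\<^sup>2 * sqrt q * e * sqrt e)"
    using T q e riesz_const_pos by (subst ennreal_mult[symmetric]) (auto simp: T_def power2_eq_square mult_ac)
  finally show ?thesis .
qed

text \<open>By duality \<open>t |E| \<le> \<integral> b w I(1\<^sub>E)\<close> for every part \<open>E\<close> of the level set \<open>I(b w) > t\<close>, and the
  Cauchy-Schwarz inequality reduces the claim to the previous lemma. Working in weak \<open>L\<^sup>4\<close> avoids
  the Hardy-Littlewood-Sobolev inequality.\<close>

proposition weak4_riesz_mult:
  assumes w: "weak4 w q" and b [measurable]: "b \<in> borel_measurable borel"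
    and K: "(\<integral>\<^sup>+x. (b x)\<^sup>2 \<partial>lborel) \<le> ennreal K" "K \<ge> 0"
  shows "weak4 (riesz (\<lambda>x. b x * w x)) (16 * riesz_const^4 * K\<^sup>2 * q)"
proof -
  have [measurable]: "w \<in> borel_measurable borel" and q: "q \<ge> 0"
    using w by (auto simp: weak4_def)
  have "emeasure lborel {x. ennreal t < riesz (\<lambda>x. b x * w x) x} \<le> ennreal (16 * riesz_const^4 * K\<^sup>2 * q / t^4)" if t: "t > 0" for t
  proof (rule emeasure_le_if_bounded_parts)
    show m: "{x. ennreal t < riesz (\<lambda>x. b x * w x) x} \<in> sets borel" by measurable
    fix n
    define E where "E = {x. ennreal t < riesz (\<lambda>x. b x * w x) x} \<inter> ball 0 (real n)"
    have E [measurable]: "E \<in> sets borel" unfolding E_def by measurable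
    obtain e where e: "e \<ge> 0" "emeasure lborel E = ennreal e"
      using emeasure_bounded_part_finite[OF m, of n] by (auto simp: E_def)
    have "e \<le> 16 * riesz_const^4 * K\<^sup>2 * q / t^4"
    proof (cases "e = 0")
      case False
      with e have ep: "e > 0" by simp
      define D where "D = 4 * riesz_const\<^sup>2 * sqrt q * e * sqrt e"
      have D: "D \<ge> 0" using q ep by (simp add: D_def)
      have "ennreal t * emeasure lborel E \<le> (\<integral>\<^sup>+x. indicator E x * riesz (\<lambda>x. b x * w x) x \<partial>lborel)"
        by (rule emeasure_level_mult_le) (simp_all add: E_def)
      then have "ennreal t * ennreal e \<le> (\<integral>\<^sup>+x. indicator E x * riesz (\<lambda>x. b x * w x) x \<partial>lborel)"
        by (simp only: e)
      also have "\<dots> = (\<integral>\<^sup>+x. b x * (w x * riesz (indicator E) x) \<partial>lborel)"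
        by (subst riesz_symmetric) (auto simp: mult.assoc)
      finally have 1: "ennreal (t * e) \<le> (\<integral>\<^sup>+x. b x * (w x * riesz (indicator E) x) \<partial>lborel)"
        using t ep by (simp add: ennreal_mult)
      have "ennreal ((t * e)\<^sup>2) = (ennreal (t * e))\<^sup>2"
        using t ep by (simp add: ennreal_power)
      also have "\<dots> \<le> (\<integral>\<^sup>+x. b x * (w x * riesz (indicator E) x) \<partial>lborel)\<^sup>2"
        using 1 by (rule power_mono) simp
      also have "\<dots> \<le> (\<integral>\<^sup>+x. (b x)\<^sup>2 \<partial>lborel) * (\<integral>\<^sup>+x. (w x * riesz (indicator E) x)\<^sup>2 \<partial>lborel)"
        by (rule Cauchy_Schwarz_nn_integral) auto
      also have "\<dots> \<le> ennreal K * ennreal D"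
        unfolding power_mult_distrib D_def
        using nn_integral_weak4_riesz_sq[OF w E e(2) ep] K by (intro mult_mono) auto
      finally have 2: "(t * e)\<^sup>2 \<le> K * D"
        using K D by (simp add: ennreal_mult[symmetric])
      \<comment> \<open>\<open>D\<close> is of order \<open>e^(3/2)\<close>. After squaring,
        \<open>e^4\<close> stands against \<open>e^3\<close>, and one power of \<open>e\<close> is
        left to be bounded.\<close>
      then have "((t * e)\<^sup>2)\<^sup>2 \<le> (K * D)\<^sup>2" by (rule power_mono) simp
      also have "(K * D)\<^sup>2 = 16 * riesz_const^4 * K\<^sup>2 * q * e^3"
      proof -
        have "(K * D)\<^sup>2 = K\<^sup>2 * 16 * riesz_const^4 * (sqrt q)\<^sup>2 * e\<^sup>2 * (sqrt e)\<^sup>2"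
          unfolding D_def by (simp add: power_mult_distrib flip: power_mult)
        also have "\<dots> = 16 * riesz_const^4 * K\<^sup>2 * q * e^3"
          using q ep by (simp add: power2_eq_square power3_eq_cube)
        finally show ?thesis .
      qed
      finally have "t^4 * e * e^3 \<le> 16 * riesz_const^4 * K\<^sup>2 * q * e^3"
        by (simp add: power_mult_distrib eval_nat_numeral mult_ac)
      then have "t^4 * e \<le> 16 * riesz_const^4 * K\<^sup>2 * q" using ep by simp
      then show ?thesis using t by (simp add: field_simps)
    qed (use q in simp)
    then show "emeasure lborel ({x. ennreal t < riesz (\<lambda>x. b x * w x) x} \<inter> ball 0 (real n)) \<le> ennreal (16 * riesz_const^4 * K\<^sup>2 * q / t^4)"
      using e by (fold E_def) (simp add: ennreal_leI)
  qed
  then show ?thesis using q unfolding weak4_def by auto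
qed

section \<open>Calculus of weak L^4 bounds\<close>

lemma weak4_mono:
  assumes w: "weak4 w q" and u [measurable]: "u \<in> borel_measurable borel"
    and le: "AE x in lborel. u x \<le> w x" and "q \<le> q'"
  shows "weak4 u q'"
proof -
  have [measurable]: "w \<in> borel_measurable borel" and q: "q \<ge> 0"
    using w by (auto simp: weak4_def)
  have "emeasure lborel {x. ennreal t < u x} \<le> ennreal (q' / t^4)" if t: "t > 0" for t
  proof -
    have "emeasure lborel {x. ennreal t < u x} \<le> emeasure lborel {x. ennreal t < w x}"
      using le by (intro emeasure_mono_AE) (auto elim!: eventually_mono)
    also have "\<dots> \<le> ennreal (q / t^4)" using w t by (auto simp: weak4_def)
    also have "\<dots> \<le> ennreal (q' / t^4)" using t assms(4) by (intro ennreal_leI divide_right_mono) auto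
    finally show ?thesis .
  qed
  then show ?thesis using q assms unfolding weak4_def by auto
qed

text \<open>If a sum exceeds \<open>t\<close>, one of the summands exceeds \<open>t / 2\<close>;
  this costs the factor \<open>2^4\<close>, which recurs in the smallness condition on
  \<open>A\<close>.\<close>

lemma weak4_add:
  assumes u: "weak4 u p" and w: "weak4 w q"
  shows "weak4 (\<lambda>x. u x + w x) (16 * (p + q))"
proof -
  have [measurable]: "w \<in> borel_measurable borel" "u \<in> borel_measurable borel" and pq: "p \<ge> 0" "q \<ge> 0"
    using w u by (auto simp: weak4_def)
  have "emeasure lborel {x. ennreal t < u x + w x} \<le> ennreal (16 * (p + q) / t^4)" if t: "t > 0" for t
  proof -
    have "{x. ennreal t < u x + w x} \<subseteq> {x. ennreal (t/2) < u x} \<union> {x. ennreal (t/2) < w x}"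
    proof (rule subsetI, rule ccontr)
      fix x assume x: "x \<in> {x. ennreal t < u x + w x}" "x \<notin> {x. ennreal (t/2) < u x} \<union> {x. ennreal (t/2) < w x}"
      then have "u x + w x \<le> ennreal (t/2) + ennreal (t/2)" by (intro add_mono) auto
      also have "\<dots> = ennreal t" using t by (subst ennreal_plus[symmetric]) auto
      finally show False using x by auto
    qed
    then have "emeasure lborel {x. ennreal t < u x + w x} \<le> emeasure lborel ({x. ennreal (t/2) < u x} \<union> {x. ennreal (t/2) < w x})"
      by (intro emeasure_mono) auto
    also have "\<dots> \<le> emeasure lborel {x. ennreal (t/2) < u x} + emeasure lborel {x. ennreal (t/2) < w x}"
      by (intro emeasure_subadditive) auto
    also have "\<dots> \<le> ennreal (p / (t/2)^4) + ennreal (q / (t/2)^4)"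
      using t u w by (intro add_mono) (auto simp: weak4_def)
    also have "\<dots> = ennreal (16 * (p + q) / t^4)"
      using t pq by (subst ennreal_plus[symmetric]) (auto simp: power_divide field_simps)
    finally show ?thesis .
  qed
  then show ?thesis using pq unfolding weak4_def by auto
qed

lemma weak4_cmult:
  assumes w: "weak4 w q" and c: "c > 0"
  shows "weak4 (\<lambda>x. ennreal c * w x) (c^4 * q)"
proof -
  have [measurable]: "w \<in> borel_measurable borel" and q: "q \<ge> 0"
    using w by (auto simp: weak4_def)
  have "emeasure lborel {x. ennreal t < ennreal c * w x} \<le> ennreal (c^4 * q / t^4)" if t: "t > 0" for t
  proof -
    have "ennreal t < ennreal c * w x \<longleftrightarrow> ennreal (t / c) < w x" for x
    proof (cases "w x")
      case (real r)
      then show ?thesis using t c by (simp add: ennreal_less_iff ennreal_mult[symmetric] field_simps)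
    next
      case top
      then show ?thesis using c by (simp add: ennreal_mult_top)
    qed
    then have "emeasure lborel {x. ennreal t < ennreal c * w x} = emeasure lborel {x. ennreal (t / c) < w x}" by simp
    also have "\<dots> \<le> ennreal (q / (t / c)^4)" using t c w by (auto simp: weak4_def)
    also have "q / (t / c)^4 = c^4 * q / t^4" using c by (simp add: power_divide)
    finally show ?thesis .
  qed
  then show ?thesis using q unfolding weak4_def by auto
qed

lemma weak4_indicator:
  assumes [measurable]: "E \<in> sets borel" and e: "emeasure lborel E \<le> ennreal e" "e \<ge> 0"
  shows "weak4 (indicator E) e"
proof -
  have "emeasure lborel {x. ennreal t < indicator E x} \<le> ennreal (e / t^4)" if t: "t > 0" for t
  proof (cases "t < 1")
    case True
    then have "t^4 \<le> 1" using t by (simp add: power_le_one)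
    then have "e \<le> e / t^4" using t e by (simp add: field_simps mult_left_le)
    moreover have "{x. ennreal t < indicator E x} \<subseteq> E" by (auto simp: indicator_def split: if_splits)
    then have "emeasure lborel {x. ennreal t < indicator E x} \<le> emeasure lborel E"
      by (intro emeasure_mono) auto
    ultimately show ?thesis using e by (meson ennreal_leI order_trans)
  next
    case False
    then have "{x. ennreal t < indicator E x} = {}"
      by (auto simp: indicator_def ennreal_less_one_iff)
    then show ?thesis by (simp only: emeasure_empty) simp
  qed
  then show ?thesis using e unfolding weak4_def by auto
qed

text \<open>The map \<open>p \<mapsto> p / 2 + d\<close> contracts towards its fixed point
  \<open>2 * d\<close>. Some finite \<open>q\<close> is needed to start the iteration, since
  otherwise \<open>step\<close> says nothing, but its size does not enter the result.\<close>

lemma weak4_absorb: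
  assumes w: "weak4 w q"
    and step: "\<And>p. weak4 w p \<Longrightarrow> weak4 w (p / 2 + d)" and d: "d \<ge> 0"
  shows "weak4 w (2 * d)"
proof -
  have q: "q \<ge> 0" using w by (auto simp: weak4_def)
  have it: "weak4 w (q / 2^n + 2 * d)" for n
  proof (induction n)
    case 0
    have "w \<in> borel_measurable borel" using w by (simp add: weak4_def)
    then show ?case using d by (intro weak4_mono[OF w]) auto
  next
    case (Suc n)
    then show ?case using step[OF Suc] by (simp add: field_simps)
  qed
  have "emeasure lborel {x. ennreal t < w x} \<le> ennreal (2 * d / t^4)" if t: "t > 0" for t
  proof -
    have "(\<lambda>n. q / 2^n) \<longlonglongrightarrow> 0" by real_asymp
    then have "(\<lambda>n. ennreal ((q / 2^n + 2 * d) / t^4)) \<longlonglongrightarrow> ennreal ((0 + 2 * d) / t^4)"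
      using t by (intro tendsto_ennrealI tendsto_intros) auto
    then show ?thesis using it t
      by (intro LIMSEQ_le_const[where X="\<lambda>n. ennreal ((q / 2^n + 2 * d) / t^4)"]) (auto simp: weak4_def)
  qed
  then show ?thesis using w d unfolding weak4_def by auto
qed

section \<open>An approximate identity\<close>

lemma lborel_integrable_translate:
  fixes f :: "'a::euclidean_space \<Rightarrow> real"
  assumes "integrable lborel f"
  shows "integrable lborel (\<lambda>x. f (h + x))"
proof -
  have "integrable (distr lborel borel ((+) h)) f" using assms by (simp add: lborel_distr_plus)
  then show ?thesis by (rule integrable_distr[rotated]) simp
qed

lemma lborel_integral_translate:
  fixes f :: "'a::euclidean_space \<Rightarrow> real"
  assumes [measurable]: "f \<in> borel_measurable borel"
  shows "(\<integral>x. f (h + x) \<partial>lborel) = (\<integral>x. f x \<partial>lborel)"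
proof -
  have "(\<integral>x. f x \<partial>lborel) = (\<integral>x. f x \<partial>distr lborel borel ((+) h))" by (simp add: lborel_distr_plus)
  also have "\<dots> = (\<integral>x. f (h + x) \<partial>lborel)" by (rule integral_distr) auto
  finally show ?thesis by simp
qed

text \<open>Writing the distance as twice the difference between the measure of \<open>U\<close> and
  an overlap integral confines attention to points of \<open>U\<close>, where openness gives
  pointwise convergence. The boundary of \<open>U\<close>, possibly of positive measure, does not
  enter.\<close>

lemma L1_translation_open:
  fixes U :: "'a::euclidean_space set"
  assumes U: "open U" and fin: "emeasure lborel U < \<infinity>" and h: "h \<longlonglongrightarrow> 0"
  shows "(\<lambda>n. \<integral>x. \<bar>indicator U (h n + x) - indicator U x\<bar> \<partial>lborel) \<longlonglongrightarrow> (0::real)"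
proof -
  have [measurable]: "U \<in> sets borel" using U by simp
  have i: "integrable lborel (indicator U :: 'a \<Rightarrow> real)"
    using fin by (intro integrable_real_indicator) auto
  have ih: "integrable lborel (\<lambda>x. indicator U (h n + x) :: real)" for n
    by (rule lborel_integrable_translate[OF i])
  have ip: "integrable lborel (\<lambda>x. indicator U x * indicator U (h n + x) :: real)" for n
    by (rule Bochner_Integration.integrable_bound[OF i]) (auto simp: indicator_def)
  have eq: "(\<integral>x. \<bar>indicator U (h n + x) - indicator U x\<bar> \<partial>lborel)
     = 2 * (measure lborel U - (\<integral>x. indicator U x * indicator U (h n + x) \<partial>lborel))" for n
  proof -
    have "(\<integral>x. \<bar>indicator U (h n + x) - indicator U x\<bar> \<partial>lborel)
      = (\<integral>x. (indicator U (h n + x) + indicator U x) - 2 * (indicator U x * indicator U (h n + x) :: real) \<partial>lborel)"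
      by (intro Bochner_Integration.integral_cong) (auto simp: indicator_def)
    also have "\<dots> = (\<integral>x. indicator U (h n + x) \<partial>lborel) + (\<integral>x. indicator U x \<partial>lborel)
        - 2 * (\<integral>x. indicator U x * indicator U (h n + x) \<partial>lborel)"
      using i ih ip by simp
    also have "(\<integral>x. indicator U (h n + x) \<partial>lborel) = (\<integral>x. indicator U x \<partial>lborel :: real)"
      by (rule lborel_integral_translate) simp
    finally show ?thesis by simp
  qed
  have "(\<lambda>n. \<integral>x. indicator U x * indicator U (h n + x) \<partial>lborel) \<longlonglongrightarrow> (\<integral>x. indicator U x \<partial>lborel :: real)"
  proof (rule integral_dominated_convergence)
    show "AE x in lborel. (\<lambda>n. indicator U x * indicator U (h n + x)) \<longlonglongrightarrow> (indicator U x :: real)"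
    proof (rule AE_I2)
      fix x :: 'a
      show "(\<lambda>n. indicator U x * indicator U (h n + x)) \<longlonglongrightarrow> (indicator U x :: real)"
      proof (cases "x \<in> U")
        case True
        have "(\<lambda>n. h n + x) \<longlonglongrightarrow> 0 + x" using h by (intro tendsto_intros)
        then have "eventually (\<lambda>n. h n + x \<in> U) sequentially"
          using U True by (auto intro: topological_tendstoD)
        then have "eventually (\<lambda>n. indicator U x * indicator U (h n + x) = (indicator U x :: real)) sequentially"
          by eventually_elim (simp add: indicator_def)
        then show ?thesis by (rule tendsto_eventually)
      qed simp
    qed
  qed (use i in \<open>auto simp: indicator_def\<close>)
  then have "(\<lambda>n. 2 * (measure lborel U - (\<integral>x. indicator U x * indicator U (h n + x) \<partial>lborel))) \<longlonglongrightarrow> 2 * (measure lborel U - (\<integral>x. indicator U x \<partial>lborel))"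
    by (intro tendsto_intros)
  then show ?thesis unfolding eq by simp
qed

lemma L1_approx_translation:
  fixes f g :: "'a::euclidean_space \<Rightarrow> real"
  assumes f: "integrable lborel f" and g: "integrable lborel g"
  shows "(\<integral>x. \<bar>f (h + x) - f x\<bar> \<partial>lborel) \<le> 2 * (\<integral>x. \<bar>f x - g x\<bar> \<partial>lborel) + (\<integral>x. \<bar>g (h + x) - g x\<bar> \<partial>lborel)"
proof -
  have fh: "integrable lborel (\<lambda>x. f (h + x))" and gh: "integrable lborel (\<lambda>x. g (h + x))"
    using f g by (auto intro: lborel_integrable_translate)
  have [measurable]: "f \<in> borel_measurable borel" "g \<in> borel_measurable borel" using f g by auto
  have "(\<integral>x. \<bar>f (h + x) - f x\<bar> \<partial>lborel)
     \<le> (\<integral>x. \<bar>f (h + x) - g (h + x)\<bar> + \<bar>f x - g x\<bar> + \<bar>g (h + x) - g x\<bar> \<partial>lborel)"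
    using f g fh gh by (intro integral_mono) auto
  also have "\<dots> = (\<integral>x. \<bar>f (h + x) - g (h + x)\<bar> \<partial>lborel) + (\<integral>x. \<bar>f x - g x\<bar> \<partial>lborel) + (\<integral>x. \<bar>g (h + x) - g x\<bar> \<partial>lborel)"
    using f g fh gh by simp
  also have "(\<integral>x. \<bar>f (h + x) - g (h + x)\<bar> \<partial>lborel) = (\<integral>x. \<bar>f x - g x\<bar> \<partial>lborel)"
    by (rule lborel_integral_translate) simp
  finally show ?thesis by simp
qed

text \<open>The functions with this property form a class closed under L^1 limits. It contains
  indicators of open sets of finite measure, hence by outer regularity those of Borel sets of finite
  measure, hence all integrable functions.\<close>

proposition L1_translation_continuous:
  fixes f :: "'a::euclidean_space \<Rightarrow> real"
  assumes f: "integrable lborel f" and h: "h \<longlonglongrightarrow> 0"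
  shows "(\<lambda>n. \<integral>x. \<bar>f (h n + x) - f x\<bar> \<partial>lborel) \<longlonglongrightarrow> 0"
proof -
  \<comment> \<open>Closedness under L^1 approximation; it serves both the passage from open to
    Borel sets and the limit step of the induction.\<close>
  have approx: "(\<lambda>n. \<integral>x. \<bar>f (h n + x) - f x\<bar> \<partial>lborel) \<longlonglongrightarrow> 0"
    if f: "integrable lborel f"
      and ap: "\<And>e::real. e > 0 \<Longrightarrow> \<exists>g. integrable lborel g \<and> (\<integral>x. \<bar>f x - g x\<bar> \<partial>lborel) \<le> e
           \<and> (\<lambda>n. \<integral>x. \<bar>g (h n + x) - g x\<bar> \<partial>lborel) \<longlonglongrightarrow> 0"
    for f :: "'a \<Rightarrow> real"
  proof (rule LIMSEQ_I)
    fix e :: real assume e: "e > 0"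
    obtain g where g: "integrable lborel g" "(\<integral>x. \<bar>f x - g x\<bar> \<partial>lborel) \<le> e / 4"
      "(\<lambda>n. \<integral>x. \<bar>g (h n + x) - g x\<bar> \<partial>lborel) \<longlonglongrightarrow> 0" using ap[of "e/4"] e by auto
    obtain N where N: "\<And>n. n \<ge> N \<Longrightarrow> \<bar>\<integral>x. \<bar>g (h n + x) - g x\<bar> \<partial>lborel\<bar> < e / 2"
      using LIMSEQ_D[OF g(3), of "e/2"] e by auto
    have "norm ((\<integral>x. \<bar>f (h n + x) - f x\<bar> \<partial>lborel) - 0) < e" if "n \<ge> N" for n
    proof -
      have "(\<integral>x. \<bar>f (h n + x) - f x\<bar> \<partial>lborel) \<ge> 0" by (intro integral_nonneg_AE) auto
      then show ?thesis using L1_approx_translation[OF f g(1), of "h n"] g(2) N[OF that] by auto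
    qed
    then show "\<exists>no. \<forall>n\<ge>no. norm ((\<integral>x. \<bar>f (h n + x) - f x\<bar> \<partial>lborel) - 0) < e" by blast
  qed
  show ?thesis using f
  proof (induction f rule: integrable_induct)
    case (base A c)
    then have [measurable]: "A \<in> sets borel" by simp
    have ind: "(\<lambda>n. \<integral>x. \<bar>indicator A (h n + x) - indicator A x\<bar> \<partial>lborel) \<longlonglongrightarrow> (0::real)"
    proof (rule approx)
      show "integrable lborel (indicator A :: 'a \<Rightarrow> real)" using base by (intro integrable_real_indicator) auto
      fix e :: real assume e: "e > 0"
      obtain U where U: "open U" "A \<subseteq> U" "emeasure lborel (U - A) \<le> e"
        using outer_regular_lborel_le[of A e] e by auto
      have [measurable]: "U \<in> sets borel" using U by simp
      have "emeasure lborel U = emeasure lborel (A \<union> (U - A))" using U by (simp add: Un_absorb1)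
      also have "\<dots> \<le> emeasure lborel A + emeasure lborel (U - A)"
        by (rule emeasure_subadditive) auto
      also have "\<dots> < \<infinity>" using base U by (auto simp: less_top[symmetric] top_unique)
      finally have Uf: "emeasure lborel U < \<infinity>" .
      have "(\<integral>x. \<bar>indicator A x - indicator U x\<bar> \<partial>lborel) = (\<integral>x. indicator (U - A) x \<partial>lborel :: real)"
        using U by (intro Bochner_Integration.integral_cong) (auto simp: indicator_def)
      also have "\<dots> = measure lborel (U - A)" by simp
      also have "\<dots> \<le> e" using U e unfolding measure_def by (intro enn2real_leI) auto
      finally show "\<exists>g. integrable lborel g \<and> (\<integral>x. \<bar>indicator A x - g x\<bar> \<partial>lborel) \<le> e
           \<and> (\<lambda>n. \<integral>x. \<bar>g (h n + x) - g x\<bar> \<partial>lborel) \<longlonglongrightarrow> 0"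
        using L1_translation_open[OF U(1) Uf h] Uf
        by (intro exI[of _ "indicator U"]) auto
    qed
    have "(\<integral>x. \<bar>indicator A (h n + x) *\<^sub>R c - indicator A x *\<^sub>R c\<bar> \<partial>lborel) = \<bar>c\<bar> * (\<integral>x. \<bar>indicator A (h n + x) - indicator A x\<bar> \<partial>lborel)" for n
    proof -
      have "\<bar>indicator A (h n + x) *\<^sub>R c - indicator A x *\<^sub>R c\<bar> = \<bar>c\<bar> * \<bar>indicator A (h n + x) - indicator A x\<bar>" for x
        by (auto simp: indicator_def)
      then show ?thesis by simp
    qed
    then show ?case using tendsto_mult[OF tendsto_const[of "\<bar>c\<bar>"] ind] by simp
  next
    case (add f g)
    have fh: "integrable lborel (\<lambda>x. f (h n + x))" and gh: "integrable lborel (\<lambda>x. g (h n + x))" for n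
      using add by (auto intro: lborel_integrable_translate)
    have le: "(\<integral>x. \<bar>f (h n + x) + g (h n + x) - (f x + g x)\<bar> \<partial>lborel)
       \<le> (\<integral>x. \<bar>f (h n + x) - f x\<bar> \<partial>lborel) + (\<integral>x. \<bar>g (h n + x) - g x\<bar> \<partial>lborel)" for n
    proof -
      have "(\<integral>x. \<bar>f (h n + x) + g (h n + x) - (f x + g x)\<bar> \<partial>lborel)
         \<le> (\<integral>x. \<bar>f (h n + x) - f x\<bar> + \<bar>g (h n + x) - g x\<bar> \<partial>lborel)"
        using add fh gh by (intro integral_mono) auto
      then show ?thesis using add fh gh by simp
    qed
    show ?case
      by (rule real_tendsto_sandwich[OF _ _ tendsto_const tendsto_add[OF add(3) add(4), simplified]])
         (use le in \<open>auto intro!: always_eventually integral_nonneg_AE\<close>)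
  next
    case (lim f s)
    show ?case
    proof (rule approx[OF lim(4)])
      fix e :: real assume e: "e > 0"
      have [measurable]: "f \<in> borel_measurable borel" "\<And>i. s i \<in> borel_measurable borel" using lim by auto
      have "(\<lambda>i. \<integral>x. \<bar>f x - s i x\<bar> \<partial>lborel) \<longlonglongrightarrow> (\<integral>x. 0 \<partial>(lborel::'a measure))"
      proof (rule integral_dominated_convergence[where w="\<lambda>x. 3 * \<bar>f x\<bar>"])
        show "AE x in lborel. (\<lambda>i. \<bar>f x - s i x\<bar>) \<longlonglongrightarrow> 0"
        proof (rule AE_I2)
          fix x
          show "(\<lambda>i. \<bar>f x - s i x\<bar>) \<longlonglongrightarrow> 0"
            using tendsto_rabs[OF tendsto_diff[OF tendsto_const[of "f x"] lim(2)[of x]]] by simp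
        qed
        show "AE x in lborel. norm \<bar>f x - s i x\<bar> \<le> 3 * \<bar>f x\<bar>" for i
          using lim(3)[of _ i] by (intro AE_I2) (smt (verit) real_norm_def space_borel space_lborel UNIV_I)
      qed (use lim in auto)
      then have "(\<lambda>i. \<integral>x. \<bar>f x - s i x\<bar> \<partial>lborel) \<longlonglongrightarrow> 0" by simp
      from LIMSEQ_D[OF this e] obtain i where "\<bar>\<integral>x. \<bar>f x - s i x\<bar> \<partial>lborel\<bar> < e" by auto
      then show "\<exists>g. integrable lborel g \<and> (\<integral>x. \<bar>f x - g x\<bar> \<partial>lborel) \<le> e
           \<and> (\<lambda>n. \<integral>x. \<bar>g (h n + x) - g x\<bar> \<partial>lborel) \<longlonglongrightarrow> 0"
        using lim by (intro exI[of _ "s i"]) auto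
    qed
  qed
qed

text \<open>The Laplacian of \<open>ln (|z|\<^sup>2 + e\<^sup>2) / 2\<close>. Its mass is independent of \<open>e\<close>; the value
  is never needed.\<close>

definition bump :: "real \<Rightarrow> real^2 \<Rightarrow> real" where
  "bump e z = 2 * e\<^sup>2 / ((norm z)\<^sup>2 + e\<^sup>2)\<^sup>2"

definition bump_mass :: real where "bump_mass = (\<integral>z. bump 1 z \<partial>lborel)"

lemma bump_nonneg: "0 \<le> bump e z" by (simp add: bump_def)

lemma bump1_pos: "0 < bump 1 z"
proof -
  have "(norm z)\<^sup>2 + 1 > 0" by (intro add_nonneg_pos) auto
  then show ?thesis by (simp add: bump_def)
qed

lemma bump1_le: "bump 1 z \<le> 2"
  by (simp add: bump_def divide_simps add_nonneg_pos one_le_power)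

lemma measurable_bump [measurable]: "bump e \<in> borel_measurable borel"
  unfolding bump_def by measurable

lemma bump_scale: "e > 0 \<Longrightarrow> e\<^sup>2 * bump e (e *\<^sub>R z) = bump 1 z"
proof -
  assume e: "e > 0"
  have "(norm (e *\<^sub>R z))\<^sup>2 + e\<^sup>2 = e\<^sup>2 * ((norm z)\<^sup>2 + 1)" 
    by (simp add: power_mult_distrib distrib_left)
  moreover have "(norm z)\<^sup>2 + 1 > 0" by (intro add_nonneg_pos) auto
  ultimately show ?thesis using e by (simp add: bump_def power_mult_distrib power2_eq_square)
qed

text \<open>\<open>bump 1\<close> is twice the square of \<open>1 / (|z|^2 + 1)\<close>, whose level
  set at height \<open>t\<close> lies in a ball of area \<open>pi / t\<close> for
  \<open>t < 1\<close> and is empty for \<open>t \<ge> 1\<close>. The layer cake integrand is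
  therefore at most \<open>2 * pi\<close> on the unit interval.\<close>

lemma integrable_bump1: "integrable lborel (bump 1)"
proof (rule integrableI_bounded)
  define g where "g z = ennreal (1 / ((norm (z::real^2))\<^sup>2 + 1))" for z
  have [measurable]: "g \<in> borel_measurable borel" unfolding g_def by measurable
  have m: "(\<integral>\<^sup>+x. 1 * indicator {x. ennreal t < g x} x \<partial>lborel) \<le> ennreal (pi / t) * indicator {0..1} t" if t: "t > 0" for t
  proof (cases "t < 1")
    case True
    have sub: "{x. ennreal t < g x} \<subseteq> ball 0 (sqrt (1 / t))"
    proof
      fix x assume "x \<in> {x. ennreal t < g x}"
      then have "t < 1 / ((norm x)\<^sup>2 + 1)" using t by (simp add: g_def ennreal_less_iff)
      moreover have "(norm x)\<^sup>2 + 1 > 0" by (intro add_nonneg_pos) auto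
      ultimately have "t * ((norm x)\<^sup>2 + 1) < 1" by (simp add: field_simps)
      then have "t * (norm x)\<^sup>2 < 1" using t by (simp add: distrib_left)
      then have "(norm x)\<^sup>2 < 1 / t" using t by (simp add: field_simps)
      then have "norm x < sqrt (1 / t)" by (rule real_less_rsqrt)
      then show "x \<in> ball 0 (sqrt (1 / t))" by simp
    qed
    have "emeasure lborel {x. ennreal t < g x} \<le> emeasure lborel (ball (0::real^2) (sqrt (1 / t)))"
      using sub by (intro emeasure_mono) auto
    also have "\<dots> = ennreal (pi / t)" using t by (subst emeasure_plane_ball) auto
    finally show ?thesis using True t by simp
  next
    case False
    have "{x. ennreal t < g x} = {}"
    proof -
      have "1 / ((norm x)\<^sup>2 + 1) \<le> t" for x :: "real^2"
      proof -
        have "1 / ((norm x)\<^sup>2 + 1) \<le> 1" by (simp add: divide_le_eq add_nonneg_pos)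
        then show ?thesis using False by simp
      qed
      then show ?thesis using t by (auto simp: g_def ennreal_less_iff not_less)
    qed
    then show ?thesis by simp
  qed
  have "(\<integral>\<^sup>+z. 1 * (g z)\<^sup>2 \<partial>lborel) = (\<integral>\<^sup>+t. ennreal (2 * t) * indicator {0<..} t * (\<integral>\<^sup>+x. 1 * indicator {x. ennreal t < g x} x \<partial>lborel) \<partial>lborel)"
    by (rule layer_cake_sq) auto
  also have "\<dots> \<le> (\<integral>\<^sup>+t. ennreal (2 * pi) * indicator {0..1::real} t \<partial>lborel)"
  proof (rule nn_integral_mono)
    fix t :: real
    show "ennreal (2 * t) * indicator {0<..} t * (\<integral>\<^sup>+x. 1 * indicator {x. ennreal t < g x} x \<partial>lborel) \<le> ennreal (2 * pi) * indicator {0..1} t"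
    proof (cases "t > 0")
      case True
      have "ennreal (2 * t) * (\<integral>\<^sup>+x. 1 * indicator {x. ennreal t < g x} x \<partial>lborel) \<le> ennreal (2 * t) * (ennreal (pi / t) * indicator {0..1} t)"
        by (rule mult_left_mono[OF m[OF True]]) simp
      also have "\<dots> = ennreal (2 * pi) * indicator {0..1} t"
        using True by (simp add: ennreal_mult[symmetric] mult.assoc[symmetric])
      finally show ?thesis using True by simp
    qed simp
  qed
  also have "\<dots> < \<infinity>" by (simp add: nn_integral_cmult ennreal_mult_less_top)
  finally have fin: "(\<integral>\<^sup>+z. (g z)\<^sup>2 \<partial>lborel) < \<infinity>" by simp
  have "(\<integral>\<^sup>+z. ennreal (norm (bump 1 z)) \<partial>lborel) = (\<integral>\<^sup>+z. 2 * (g z)\<^sup>2 \<partial>lborel)"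
  proof (rule nn_integral_cong)
    fix z :: "real^2"
    have "2 * (g z)\<^sup>2 = ennreal 2 * ennreal ((1 / ((norm z)\<^sup>2 + 1))\<^sup>2)"
      unfolding g_def by (simp add: ennreal_power)
    also have "\<dots> = ennreal (2 * (1 / ((norm z)\<^sup>2 + 1))\<^sup>2)" by (subst ennreal_mult) auto
    finally show "ennreal (norm (bump 1 z)) = 2 * (g z)\<^sup>2"
      by (simp add: bump_def power_divide)
  qed
  also have "\<dots> < \<infinity>" using fin by (simp add: nn_integral_cmult ennreal_mult_less_top)
  finally show "(\<integral>\<^sup>+z. ennreal (norm (bump 1 z)) \<partial>lborel) < \<infinity>" .
qed simp

lemma bump_mass_pos: "bump_mass > 0"
proof -
  have "bump_mass \<ge> 0" unfolding bump_mass_def by (intro integral_nonneg_AE) (simp add: bump_nonneg)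
  moreover have "bump_mass \<noteq> 0"
  proof
    assume "bump_mass = 0"
    then have "AE z in lborel. bump 1 z = 0"
      unfolding bump_mass_def
      by (subst (asm) integral_nonneg_eq_0_iff_AE) (auto simp: integrable_bump1 bump_nonneg)
    then have "AE z in (lborel :: (real^2) measure). False" using bump1_pos by (auto elim!: eventually_mono simp: less_le)
    then show False by (simp add: eventually_False ae_filter_eq_bot_iff)
  qed
  ultimately show ?thesis by simp
qed

lemma bump_convolution:
  fixes f :: "real^2 \<Rightarrow> real"
  assumes [measurable]: "f \<in> borel_measurable borel" and e: "e > 0"
  shows "(\<integral>z. f z * bump e (z - x) \<partial>lborel) = (\<integral>y. f (x + e *\<^sub>R y) * bump 1 y \<partial>lborel)"
proof -
  have "(\<integral>z. f z * bump e (z - x) \<partial>lborel)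
      = (\<integral>z. f z * bump e (z - x) \<partial>density (distr lborel borel (\<lambda>y. x + e *\<^sub>R y)) (\<lambda>_. ennreal (e\<^sup>2)))"
    using e by (subst lborel_affine[of e x]) auto
  also have "\<dots> = (\<integral>z. e\<^sup>2 * (f z * bump e (z - x)) \<partial>distr lborel borel (\<lambda>y. x + e *\<^sub>R y))"
    using e by (subst integral_density) auto
  also have "\<dots> = (\<integral>y. e\<^sup>2 * (f (x + e *\<^sub>R y) * bump e (x + e *\<^sub>R y - x)) \<partial>lborel)"
    by (subst integral_distr) auto
  also have "\<dots> = (\<integral>y. f (x + e *\<^sub>R y) * bump 1 y \<partial>lborel)"
    using bump_scale[OF e] by (intro Bochner_Integration.integral_cong) (auto simp: mult_ac)
  finally show ?thesis .
qed

lemma lborel_integrable_affine: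
  fixes f :: "real^2 \<Rightarrow> real"
  assumes f: "integrable lborel f" and e: "e > 0"
  shows "integrable lborel (\<lambda>y. f (x + e *\<^sub>R y))"
proof -
  have [measurable]: "f \<in> borel_measurable borel" using f by auto
  have "integrable (density (distr lborel borel (\<lambda>y. x + e *\<^sub>R y)) (\<lambda>_. ennreal (e\<^sup>2))) f"
    using f e by (subst (asm) lborel_affine[of e x]) auto
  then have "integrable lborel (\<lambda>y. e\<^sup>2 * f (x + e *\<^sub>R y))"
    by (subst (asm) integrable_density) (auto simp: integrable_distr_eq)
  then show ?thesis using e by simp
qed

text \<open>Continuity of translations gives convergence in L^1, and a subsequence converges almost
  everywhere. A subsequence is enough for passing to the limit in inequalities that hold for every
  \<open>e\<close>.\<close>

proposition bump_approximate_identity: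
  fixes f :: "real^2 \<Rightarrow> real"
  assumes f: "integrable lborel f" and e: "\<And>n. e n > 0" "e \<longlonglongrightarrow> 0"
  shows "\<exists>r::nat\<Rightarrow>nat. strict_mono r \<and>
    (AE x in lborel. (\<lambda>n. \<integral>z. f z * bump (e (r n)) (z - x) \<partial>lborel) \<longlonglongrightarrow> bump_mass * f x)"
proof -
  have [measurable]: "f \<in> borel_measurable borel" using f by auto
  define D where "D n x = (\<integral>y. (f (x + e n *\<^sub>R y) - f x) * bump 1 y \<partial>lborel)" for n x
  have [measurable]: "D n \<in> borel_measurable borel" for n unfolding D_def by measurable
  have i: "integrable lborel (\<lambda>y. f (x + e n *\<^sub>R y) * bump 1 y)" for x n
  proof (rule Bochner_Integration.integrable_bound)
    show "integrable lborel (\<lambda>y. 2 * f (x + e n *\<^sub>R y))"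
      using lborel_integrable_affine[OF f e(1)] by simp
    show "AE y in lborel. norm (f (x + e n *\<^sub>R y) * bump 1 y) \<le> norm (2 * f (x + e n *\<^sub>R y))"
      using bump1_le by (auto simp: abs_mult bump_nonneg mult.commute[of _ "bump 1 _"] intro!: mult_right_mono)
  qed simp
  have i': "integrable lborel (\<lambda>y. (f (x + e n *\<^sub>R y) - f x) * bump 1 y)" for x n
    using i integrable_bump1 by (simp add: left_diff_distrib)
  have D: "(\<integral>z. f z * bump (e n) (z - x) \<partial>lborel) = D n x + bump_mass * f x" for n x
  proof -
    have "D n x = (\<integral>y. f (x + e n *\<^sub>R y) * bump 1 y - f x * bump 1 y \<partial>lborel)"
      unfolding D_def by (simp add: left_diff_distrib)
    also have "\<dots> = (\<integral>y. f (x + e n *\<^sub>R y) * bump 1 y \<partial>lborel) - f x * bump_mass"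
      using i[of x n] integrable_bump1 by (simp add: bump_mass_def)
    finally show ?thesis using bump_convolution[of f "e n" x] e by simp
  qed
  \<comment> \<open>The L^1 modulus of continuity of \<open>f\<close>. It is at most
    \<open>2 * M\<close>, tends to 0 with \<open>h\<close>, and controls \<open>D n\<close> once the
    two integrals are exchanged.\<close>
  define \<omega> where "\<omega> h = (\<integral>\<^sup>+x. ennreal \<bar>f (h + x) - f x\<bar> \<partial>lborel)" for h :: "real^2"
  have om: "\<omega> h = ennreal (\<integral>x. \<bar>f (h + x) - f x\<bar> \<partial>lborel)" for h
    unfolding \<omega>_def using f lborel_integrable_translate[OF f]
    by (intro nn_integral_eq_integral) auto
  have [measurable]: "\<omega> \<in> borel_measurable borel" unfolding \<omega>_def by measurable
  define M where "M = (\<integral>x. \<bar>f x\<bar> \<partial>lborel)"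
  have om_le: "\<omega> h \<le> ennreal (2 * M)" for h
  proof -
    have "(\<integral>x. \<bar>f (h + x) - f x\<bar> \<partial>lborel) \<le> (\<integral>x. \<bar>f (h + x)\<bar> + \<bar>f x\<bar> \<partial>lborel)"
      using f lborel_integrable_translate[OF f] by (intro integral_mono) auto
    also have "\<dots> = (\<integral>x. \<bar>f (h + x)\<bar> \<partial>lborel) + M"
      using f lborel_integrable_translate[OF f] by (simp add: M_def)
    also have "(\<integral>x. \<bar>f (h + x)\<bar> \<partial>lborel) = M"
      unfolding M_def by (rule lborel_integral_translate) simp
    finally show ?thesis unfolding om by (simp add: ennreal_leI)
  qed
  have bd: "(\<integral>\<^sup>+x. ennreal (norm (D n x)) \<partial>lborel) \<le> (\<integral>\<^sup>+y. \<omega> (e n *\<^sub>R y) * ennreal (bump 1 y) \<partial>lborel)" for n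
  proof -
    have "(\<integral>\<^sup>+x. ennreal (norm (D n x)) \<partial>lborel) \<le> (\<integral>\<^sup>+x. \<integral>\<^sup>+y. ennreal (norm ((f (x + e n *\<^sub>R y) - f x) * bump 1 y)) \<partial>lborel \<partial>lborel)"
      unfolding D_def by (intro nn_integral_mono integral_norm_bound_ennreal) (rule i')
    also have "\<dots> = (\<integral>\<^sup>+y. \<integral>\<^sup>+x. ennreal (norm ((f (x + e n *\<^sub>R y) - f x) * bump 1 y)) \<partial>lborel \<partial>lborel)"
      by (rule lborel_pair.Fubini'[symmetric]) measurable
    also have "\<dots> = (\<integral>\<^sup>+y. \<omega> (e n *\<^sub>R y) * ennreal (bump 1 y) \<partial>lborel)"
      unfolding \<omega>_def
      by (subst nn_integral_multc [symmetric])
         (auto intro!: nn_integral_cong simp: abs_mult ennreal_mult bump_nonneg add.commute)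
    finally show ?thesis .
  qed
  have lim: "(\<lambda>n. \<integral>\<^sup>+y. \<omega> (e n *\<^sub>R y) * ennreal (bump 1 y) \<partial>lborel) \<longlonglongrightarrow> (\<integral>\<^sup>+y. 0 \<partial>(lborel::(real^2) measure))"
  proof (rule nn_integral_dominated_convergence[where w="\<lambda>y. ennreal (2 * M) * ennreal (bump 1 y)"])
    show "AE y in lborel. \<omega> (e n *\<^sub>R y) * ennreal (bump 1 y) \<le> ennreal (2 * M) * ennreal (bump 1 y)" for n
      using om_le by (intro AE_I2 mult_right_mono) auto
    have "(\<integral>\<^sup>+y. ennreal (bump 1 y) \<partial>lborel) < \<infinity>"
      using integrable_bump1 by (simp add: integrable_iff_bounded bump_nonneg)
    then show "(\<integral>\<^sup>+y. ennreal (2 * M) * ennreal (bump 1 y) \<partial>lborel) < \<infinity>"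
      by (simp add: nn_integral_cmult ennreal_mult_less_top)
    show "AE y in lborel. (\<lambda>n. \<omega> (e n *\<^sub>R y) * ennreal (bump 1 y)) \<longlonglongrightarrow> 0"
    proof (rule AE_I2)
      fix y :: "real^2"
      have "(\<lambda>n. e n *\<^sub>R y) \<longlonglongrightarrow> 0 *\<^sub>R y" using e(2) by (intro tendsto_intros)
      then have "(\<lambda>n. \<integral>x. \<bar>f (e n *\<^sub>R y + x) - f x\<bar> \<partial>lborel) \<longlonglongrightarrow> 0"
        by (intro L1_translation_continuous[OF f]) simp
      then have "(\<lambda>n. ennreal ((\<integral>x. \<bar>f (e n *\<^sub>R y + x) - f x\<bar> \<partial>lborel) * bump 1 y)) \<longlonglongrightarrow> ennreal (0 * bump 1 y)"
        by (intro tendsto_ennrealI tendsto_intros)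
      then show "(\<lambda>n. \<omega> (e n *\<^sub>R y) * ennreal (bump 1 y)) \<longlonglongrightarrow> 0"
        unfolding om by (simp add: ennreal_mult' bump_nonneg)
    qed
  qed auto
  have nnlim: "(\<lambda>n. \<integral>\<^sup>+x. ennreal (norm (D n x)) \<partial>lborel) \<longlonglongrightarrow> 0"
    by (rule tendsto_sandwich[OF _ _ tendsto_const lim[simplified]]) (use bd in auto)
  have fin: "(\<integral>\<^sup>+x. ennreal (norm (D n x)) \<partial>lborel) < \<infinity>" for n
  proof -
    have "(\<integral>\<^sup>+y. \<omega> (e n *\<^sub>R y) * ennreal (bump 1 y) \<partial>lborel) \<le> (\<integral>\<^sup>+y. ennreal (2 * M) * ennreal (bump 1 y) \<partial>lborel)"
      using om_le by (intro nn_integral_mono mult_right_mono) auto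
    also have "\<dots> < \<infinity>"
      using integrable_bump1 by (simp add: integrable_iff_bounded bump_nonneg nn_integral_cmult ennreal_mult_less_top)
    finally show ?thesis using bd[of n] by (meson le_less_trans)
  qed
  have Di: "integrable lborel (D n)" for n
    using fin by (intro integrableI_bounded) auto
  have "(\<lambda>n. \<integral>x. norm (D n x) \<partial>lborel) \<longlonglongrightarrow> 0"
  proof -
    have "ennreal (\<integral>x. norm (D n x) \<partial>lborel) = (\<integral>\<^sup>+x. ennreal (norm (D n x)) \<partial>lborel)" for n
      using Di by (intro nn_integral_eq_integral[symmetric]) auto
    then have "(\<lambda>n. ennreal (\<integral>x. norm (D n x) \<partial>lborel)) \<longlonglongrightarrow> ennreal 0" using nnlim by simp
    then show ?thesis by (rule tendsto_ennrealD) auto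
  qed
  from tendsto_L1_AE_subseq[OF Di this] obtain r :: "nat \<Rightarrow> nat" where
    r: "strict_mono r" "AE x in lborel. (\<lambda>n. D (r n) x) \<longlonglongrightarrow> 0" by auto
  from r(2) have "AE x in lborel. (\<lambda>n. \<integral>z. f z * bump (e (r n)) (z - x) \<partial>lborel) \<longlonglongrightarrow> bump_mass * f x"
  proof eventually_elim
    case (elim x)
    then show ?case unfolding D using tendsto_add[OF elim tendsto_const[of "bump_mass * f x"]] by simp
  qed
  with r(1) show ?thesis by auto
qed

section \<open>Functions of class $C^k$ on open sets\<close>

text \<open>\<open>C_k\<close> relative to a set, meant for open sets. It is made for kernels with a
  pole, where partial derivatives as total functions carry meaningless values at the pole.\<close>

fun C_k_on :: "nat \<Rightarrow> (real^2) set \<Rightarrow> (real^2 \<Rightarrow> real) \<Rightarrow> bool" where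
  "C_k_on 0 S f \<longleftrightarrow> continuous_on S f"
| "C_k_on (Suc k) S f \<longleftrightarrow> (\<forall>x\<in>S. f differentiable (at x)) \<and> (\<forall>i. C_k_on k S (pderiv_vec i f))"

lemma C_k_on_UNIV: "C_k_on k UNIV f \<longleftrightarrow> C_k k f"
  by (induction k arbitrary: f) auto

lemma pderiv_vec_eqI: "(f has_derivative D) (at z) \<Longrightarrow> pderiv_vec i f z = D (axis i 1)"
  unfolding pderiv_vec_def by (metis frechet_derivative_at)

lemma has_derivative_pderiv_vec:
  assumes "f differentiable (at z)"
  shows "(f has_derivative (\<lambda>d. \<Sum>i\<in>UNIV. d $ i * pderiv_vec i f z)) (at z)"
proof -
  have D: "(f has_derivative frechet_derivative f (at z)) (at z)"
    using assms by (simp add: frechet_derivative_works)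
  then have l: "linear (frechet_derivative f (at z))" by (rule has_derivative_linear)
  have "frechet_derivative f (at z) = (\<lambda>d. \<Sum>i\<in>UNIV. d $ i * pderiv_vec i f z)"
  proof
    fix d :: "real^2"
    have "frechet_derivative f (at z) d = frechet_derivative f (at z) (\<Sum>i\<in>UNIV. d $ i *\<^sub>R axis i 1)"
      using basis_expansion[of d] by (simp add: scalar_mult_eq_scaleR)
    also have "\<dots> = (\<Sum>i\<in>UNIV. d $ i * pderiv_vec i f z)"
      by (simp add: linear_sum[OF l] linear_scale[OF l] pderiv_vec_def)
    finally show "frechet_derivative f (at z) d = (\<Sum>i\<in>UNIV. d $ i * pderiv_vec i f z)" .
  qed
  with D show ?thesis by simp
qed

lemma pderiv_vec_cong:
  assumes "open S" "z \<in> S" "\<And>x. x \<in> S \<Longrightarrow> f x = g x"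
  shows "pderiv_vec i f z = pderiv_vec i g z"
proof -
  have "(f has_derivative D) (at z) \<longleftrightarrow> (g has_derivative D) (at z)" for D
    using assms has_derivative_transform_within_open[of f D z UNIV S g]
      has_derivative_transform_within_open[of g D z UNIV S f] by auto
  then show ?thesis unfolding pderiv_vec_def frechet_derivative_def by simp
qed

lemma differentiable_at_cong:
  assumes "open S" "z \<in> S" "\<And>x. x \<in> S \<Longrightarrow> f x = g x" "f differentiable (at z)"
  shows "g differentiable (at z)"
  using assms unfolding differentiable_def
  by (metis has_derivative_transform_within_open)

lemma C_k_on_cong:
  assumes "open S" "\<And>x. x \<in> S \<Longrightarrow> f x = g x" "C_k_on k S f"
  shows "C_k_on k S g"
  using assms(2,3)
proof (induction k arbitrary: f g)
  case 0
  then show ?case using continuous_on_cong by (metis C_k_on.simps(1))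
next
  case (Suc k)
  have "C_k_on k S (pderiv_vec i g)" for i
  proof (rule Suc.IH[of "pderiv_vec i f"])
    show "pderiv_vec i f x = pderiv_vec i g x" if "x \<in> S" for x
      by (rule pderiv_vec_cong[OF assms(1) that Suc.prems(1)])
  qed (use Suc.prems in auto)
  then show ?case using Suc.prems differentiable_at_cong[OF assms(1), of _ f g] by auto
qed

text \<open>Accepts the partial derivatives as explicit functions \<open>g i\<close>. They agree
  with \<open>pderiv_vec\<close> on the open set, and congruence transfers their regularity.\<close>

lemma C_k_on_SucI:
  assumes "open S" "\<And>z. z \<in> S \<Longrightarrow> (f has_derivative (\<lambda>d. \<Sum>i\<in>UNIV. d $ i * g i z)) (at z)"
    and "\<And>i. C_k_on k S (g i)"
  shows "C_k_on (Suc k) S f"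
proof -
  have "g i z = pderiv_vec i f z" if "z \<in> S" for i z
    using pderiv_vec_eqI[OF assms(2)[OF that], of i]
    by (simp add: axis_def if_distrib[of "\<lambda>x. x * _"] cong: if_cong)
  then have "C_k_on k S (pderiv_vec i f)" for i
    using C_k_on_cong[OF assms(1) _ assms(3)[of i]] by blast
  then show ?thesis using assms(2) by (auto simp: differentiable_def)
qed

lemma C_k_on_SucD:
  assumes "C_k_on (Suc k) S f"
  shows "C_k_on k S f"
  using assms
proof (induction k arbitrary: f)
  case 0
  then show ?case
    by (auto intro!: continuous_at_imp_continuous_on differentiable_imp_continuous_within)
next
  case (Suc k)
  then show ?case by (auto simp del: C_k_on.simps(1))
qed

lemma C_k_on_subset: "C_k_on k S f \<Longrightarrow> T \<subseteq> S \<Longrightarrow> C_k_on k T f"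
  by (induction k arbitrary: f) (auto intro: continuous_on_subset)

text \<open>Smoothness is local. This shows that a function smooth off a point and zero near it is
  smooth on the plane.\<close>

lemma C_k_on_Un: "open S \<Longrightarrow> open T \<Longrightarrow> C_k_on k S f \<Longrightarrow> C_k_on k T f \<Longrightarrow> C_k_on k (S \<union> T) f"
  by (induction k arbitrary: f) (auto intro: continuous_on_open_Un)

lemma C_k_on_const: "open S \<Longrightarrow> C_k_on k S (\<lambda>z. c)"
proof (induction k arbitrary: c)
  case (Suc k)
  show ?case
    by (rule C_k_on_SucI[where g="\<lambda>i z. 0", OF Suc.prems]) (auto intro!: derivative_eq_intros Suc)
qed simp

lemma C_k_on_coord: "open S \<Longrightarrow> C_k_on k S (\<lambda>z. z $ j)"
proof (cases k)
  case 0 then show ?thesis by (auto intro!: continuous_intros)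
next
  case (Suc k')
  assume S: "open S"
  show ?thesis unfolding Suc
  proof (rule C_k_on_SucI[where g="\<lambda>i z. if i = j then 1 else 0", OF S])
    show "((\<lambda>z. z $ j) has_derivative (\<lambda>d. \<Sum>i\<in>UNIV. d $ i * (if i = j then 1 else 0))) (at z)" for z :: "real^2"
      by (simp add: if_distrib cong: if_cong) (auto intro!: bounded_linear_imp_has_derivative bounded_linear_vec_nth)
  qed (auto intro: C_k_on_const[OF S])
qed

lemma C_k_on_add:
  assumes S: "open S"
  shows "C_k_on k S f \<Longrightarrow> C_k_on k S g \<Longrightarrow> C_k_on k S (\<lambda>z. f z + g z)"
proof (induction k arbitrary: f g)
  case 0 then show ?case by (auto intro: continuous_on_add)
next
  case (Suc k)
  show ?case
  proof (rule C_k_on_SucI[where g="\<lambda>i z. pderiv_vec i f z + pderiv_vec i g z", OF S])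
    fix z assume "z \<in> S"
    then have d: "f differentiable (at z)" "g differentiable (at z)" using Suc.prems by auto
    show "((\<lambda>z. f z + g z) has_derivative (\<lambda>d. \<Sum>i\<in>UNIV. d $ i * (pderiv_vec i f z + pderiv_vec i g z))) (at z)"
      using has_derivative_add[OF has_derivative_pderiv_vec[OF d(1)] has_derivative_pderiv_vec[OF d(2)]]
      by (simp add: distrib_left sum.distrib)
  qed (use Suc in auto)
qed

lemma C_k_on_mult:
  assumes S: "open S"
  shows "C_k_on k S f \<Longrightarrow> C_k_on k S g \<Longrightarrow> C_k_on k S (\<lambda>z. f z * g z)"
proof (induction k arbitrary: f g)
  case 0 then show ?case by (auto intro: continuous_on_mult)
next
  case (Suc k)
  show ?case
  proof (rule C_k_on_SucI[where g="\<lambda>i z. f z * pderiv_vec i g z + pderiv_vec i f z * g z", OF S])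
    fix z assume "z \<in> S"
    then have d: "f differentiable (at z)" "g differentiable (at z)" using Suc.prems by auto
    show "((\<lambda>z. f z * g z) has_derivative (\<lambda>d. \<Sum>i\<in>UNIV. d $ i * (f z * pderiv_vec i g z + pderiv_vec i f z * g z))) (at z)"
      using has_derivative_mult[OF has_derivative_pderiv_vec[OF d(1)] has_derivative_pderiv_vec[OF d(2)]]
      by (simp add: distrib_left sum.distrib sum_distrib_left sum_distrib_right mult_ac)
  next
    fix i
    show "C_k_on k S (\<lambda>z. f z * pderiv_vec i g z + pderiv_vec i f z * g z)"
      using Suc.prems by (intro C_k_on_add[OF S] Suc.IH) (auto intro: C_k_on_SucD simp del: C_k_on.simps(1))
  qed
qed

lemma C_k_on_cmult: "open S \<Longrightarrow> C_k_on k S f \<Longrightarrow> C_k_on k S (\<lambda>z. c * f z)"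
  by (intro C_k_on_mult C_k_on_const)

lemma C_k_on_minus: "open S \<Longrightarrow> C_k_on k S f \<Longrightarrow> C_k_on k S (\<lambda>z. - f z)"
  using C_k_on_cmult[of S k f "-1"] by simp

lemma C_k_on_diff: "open S \<Longrightarrow> C_k_on k S f \<Longrightarrow> C_k_on k S g \<Longrightarrow> C_k_on k S (\<lambda>z. f z - g z)"
  using C_k_on_add[of S k f "\<lambda>z. - g z"] C_k_on_minus[of S k g] by simp

lemma C_k_on_sum:
  "open S \<Longrightarrow> (\<And>j. j \<in> J \<Longrightarrow> C_k_on k S (f j)) \<Longrightarrow> C_k_on k S (\<lambda>z. \<Sum>j\<in>J. f j z)"
  by (induction J rule: infinite_finite_induct) (auto intro: C_k_on_const C_k_on_add)

section \<open>Smooth functions of one real variable\<close>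

fun C_k_line :: "nat \<Rightarrow> real set \<Rightarrow> (real \<Rightarrow> real) \<Rightarrow> bool" where
  "C_k_line 0 T h \<longleftrightarrow> continuous_on T h"
| "C_k_line (Suc k) T h \<longleftrightarrow> (\<exists>h'. (\<forall>t\<in>T. (h has_real_derivative h' t) (at t)) \<and> C_k_line k T h')"

lemma C_k_line_SucI:
  "(\<And>t. t \<in> T \<Longrightarrow> (h has_real_derivative h' t) (at t)) \<Longrightarrow> C_k_line k T h' \<Longrightarrow> C_k_line (Suc k) T h"
  by auto

lemma C_k_line_add: "C_k_line k T f \<Longrightarrow> C_k_line k T g \<Longrightarrow> C_k_line k T (\<lambda>z. f z + g z)"
proof (induction k arbitrary: f g)
  case 0 then show ?case by (auto intro: continuous_on_add)
next
  case (Suc k)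
  then obtain f' g' where "\<forall>t\<in>T. (f has_real_derivative f' t) (at t)" "C_k_line k T f'"
    "\<forall>t\<in>T. (g has_real_derivative g' t) (at t)" "C_k_line k T g'" by auto
  then show ?case using Suc.IH[of f' g']
    by (auto intro!: exI[of _ "\<lambda>z. f' z + g' z"] derivative_intros)
qed

lemma C_k_line_cmult: "C_k_line k T f \<Longrightarrow> C_k_line k T (\<lambda>z. c * f z)"
proof (induction k arbitrary: f)
  case 0 then show ?case by (auto intro: continuous_intros)
next
  case (Suc k)
  then obtain f' where f': "\<forall>t\<in>T. (f has_real_derivative f' t) (at t)" "C_k_line k T f'" by auto
  then have "\<forall>t\<in>T. ((\<lambda>z. c * f z) has_real_derivative c * f' t) (at t)"
    by (auto intro!: derivative_eq_intros)
  then show ?case using Suc.IH[OF f'(2)] by auto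
qed

text \<open>Induction with \<open>h\<close> generalised: the chain rule replaces \<open>h\<close> by
  its derivative, while \<open>f\<close> stays the same.\<close>

lemma C_k_on_compose:
  assumes S: "open S"
  shows "C_k_line k T h \<Longrightarrow> C_k_on k S f \<Longrightarrow> f ` S \<subseteq> T \<Longrightarrow> C_k_on k S (\<lambda>z. h (f z))"
proof (induction k arbitrary: h)
  case 0
  then show ?case by (auto intro: continuous_on_compose2)
next
  case (Suc k)
  from Suc.prems(1) obtain h' where h': "\<And>t. t \<in> T \<Longrightarrow> (h has_real_derivative h' t) (at t)" "C_k_line k T h'"
    unfolding C_k_line.simps by blast
  have f: "C_k_on k S f" using Suc.prems by (auto intro: C_k_on_SucD simp del: C_k_on.simps(1))
  show ?case
  proof (rule C_k_on_SucI[where g="\<lambda>i z. h' (f z) * pderiv_vec i f z", OF S])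
    fix z assume z: "z \<in> S"
    then have d: "f differentiable (at z)" and "f z \<in> T" using Suc.prems by auto
    from h'(1)[OF this(2)] have "(h has_derivative (\<lambda>d. d * h' (f z))) (at (f z))"
      by (simp add: has_field_derivative_def mult.commute[of _ "h' _"])
    from has_derivative_compose[OF has_derivative_pderiv_vec[OF d] this]
    show "((\<lambda>z. h (f z)) has_derivative (\<lambda>d. \<Sum>i\<in>UNIV. d $ i * (h' (f z) * pderiv_vec i f z))) (at z)"
      by (simp add: sum_distrib_left sum_distrib_right mult_ac)
  next
    fix i
    show "C_k_on k S (\<lambda>z. h' (f z) * pderiv_vec i f z)"
      using Suc.prems by (intro C_k_on_mult[OF S] Suc.IH[OF h'(2) f]) auto
  qed
qed

text \<open>The classical smooth function \<open>exp (- 1 / t)\<close>, flat at 0, together with its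
  quotients by powers of \<open>t\<close>. The family is closed under differentiation up to linear
  combinations, so smoothness follows by induction.\<close>

definition flat :: "nat \<Rightarrow> real \<Rightarrow> real" where
  "flat m t = (if t > 0 then exp (- 1 / t) / t ^ m else 0)"

lemma flat_nonneg: "0 \<le> flat m t" by (simp add: flat_def)

lemma flat_le_inverse_power: "t > 0 \<Longrightarrow> flat m t \<le> 1 / t ^ m"
  by (simp add: flat_def divide_right_mono)

text \<open>The single term of order \<open>m + j\<close> of the exponential series at
  \<open>1 / t\<close> is at most \<open>exp (1 / t)\<close>. The case \<open>j = 0\<close> yields
  uniform bounds, the case \<open>j = 2\<close> the derivative at 0.\<close>

lemma flat_bound: "flat m t \<le> fact (m + j) * \<bar>t\<bar> ^ j"
proof (cases "t > 0")
  case True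
  have "(1 / t) ^ (m + j) / fact (m + j) \<le> exp (1 / t)"
  proof -
    have s: "summable (\<lambda>n. (1 / t) ^ n /\<^sub>R fact n)" by (rule summable_exp_generic)
    have "(\<Sum>n\<in>{m + j}. (1 / t) ^ n /\<^sub>R fact n) \<le> (\<Sum>n. (1 / t) ^ n /\<^sub>R fact n)"
      using True by (intro sum_le_suminf[OF s]) auto
    then show ?thesis by (simp add: exp_def divide_inverse mult.commute)
  qed
  then have "exp (- 1 / t) * (1 / t ^ (m + j)) \<le> fact (m + j)"
    using True by (simp add: exp_minus field_simps)
  then have "exp (- 1 / t) / t ^ m \<le> fact (m + j) * t ^ j"
    using True by (simp add: field_simps power_add)
  then show ?thesis using True by (simp add: flat_def)
qed (simp add: flat_def)

lemma flat_le_fact: "flat m t \<le> fact m"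
  using flat_bound[of m t 0] by simp

lemma flat_has_derivative: "(flat m has_real_derivative flat (m + 2) t - real m * flat (m + 1) t) (at t)"
proof -
  consider "t > 0" | "t < 0" | "t = 0" by linarith
  then show ?thesis
  proof cases
    case 1
    have "((\<lambda>t. exp (- 1 / t) / t ^ m) has_real_derivative flat (m + 2) t - real m * flat (m + 1) t) (at t)"
      using 1 by (auto intro!: derivative_eq_intros simp: flat_def field_simps power2_eq_square)
        (cases m; simp)
    then show ?thesis
      by (rule has_field_derivative_transform_within_open[where S="{0<..}"]) (use 1 in \<open>auto simp: flat_def\<close>)
  next
    case 2
    have "((\<lambda>t. 0) has_real_derivative flat (m + 2) t - real m * flat (m + 1) t) (at t)"
      using 2 by (auto intro!: derivative_eq_intros simp: flat_def)
    then show ?thesis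
      by (rule has_field_derivative_transform_within_open[where S="{..<0}"]) (use 2 in \<open>auto simp: flat_def\<close>)
  next
    case 3
    \<comment> \<open>The difference quotient at the origin is at most a multiple of
      \<open>|h|\<close>, so the derivative is 0, in agreement with the formula.\<close>
    have "((\<lambda>h. (flat m (0 + h) - flat m 0) / h) \<longlongrightarrow> 0) (at 0)"
    proof (rule Lim_null_comparison)
      show "\<forall>\<^sub>F h in at 0. norm ((flat m (0 + h) - flat m 0) / h) \<le> fact (m + 2) * \<bar>h\<bar>"
      proof (rule eventually_mono[OF eventually_neq_at_within[of 0 0]])
        fix h :: real assume h: "h \<noteq> 0"
        have "norm ((flat m (0 + h) - flat m 0) / h) = flat m h / \<bar>h\<bar>"
          by (simp add: flat_def)
        also have "\<dots> \<le> (fact (m + 2) * \<bar>h\<bar>\<^sup>2) / \<bar>h\<bar>"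
          by (intro divide_right_mono flat_bound) auto
        also have "\<dots> = fact (m + 2) * \<bar>h\<bar>" using h by (simp add: power2_eq_square abs_if)
        finally show "norm ((flat m (0 + h) - flat m 0) / h) \<le> fact (m + 2) * \<bar>h\<bar>" .
      qed
      show "((\<lambda>h. fact (m + 2) * \<bar>h\<bar>) \<longlongrightarrow> 0) (at (0::real))"
        by (auto intro!: tendsto_eq_intros)
    qed
    then show ?thesis using 3 by (simp add: DERIV_def flat_def)
  qed
qed

lemma C_k_line_flat: "C_k_line k UNIV (flat m)"
proof (induction k arbitrary: m)
  case 0
  show ?case using flat_has_derivative by (auto intro!: continuous_at_imp_continuous_on intro: DERIV_isCont)
next
  case (Suc k)
  have "C_k_line k UNIV (\<lambda>t. flat (m + 2) t + (- real m) * flat (m + 1) t)"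
    by (intro C_k_line_add C_k_line_cmult Suc)
  moreover have "\<forall>t\<in>UNIV. (flat m has_real_derivative flat (m + 2) t + (- real m) * flat (m + 1) t) (at t)"
    using flat_has_derivative by simp
  ultimately show ?case by (intro C_k_line_SucI) auto
qed

lemma C_k_line_inverse_power: "C_k_line k {0<..} (\<lambda>t. 1 / t ^ m)"
proof (induction k arbitrary: m)
  case 0
  show ?case by (auto intro!: continuous_intros)
next
  case (Suc k)
  have "C_k_line k {0<..} (\<lambda>t. (- real m) * (1 / t ^ (m + 1)))"
    by (intro C_k_line_cmult Suc)
  moreover have "\<forall>t\<in>{0<..}. ((\<lambda>t. 1 / t ^ m) has_real_derivative (- real m) * (1 / t ^ (m + 1))) (at t)"
  proof
    fix t :: real assume "t \<in> {0<..}"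
    then show "((\<lambda>t. 1 / t ^ m) has_real_derivative (- real m) * (1 / t ^ (m + 1))) (at t)"
      by (auto intro!: derivative_eq_intros simp: field_simps) (cases m; simp)
  qed
  ultimately show ?case by (intro C_k_line_SucI) auto
qed

lemma C_k_line_ln: "C_k_line k {0<..} ln"
proof (cases k)
  case 0
  then show ?thesis by (auto intro!: continuous_intros)
next
  case (Suc j)
  have "\<forall>t\<in>{0<..}. (ln has_real_derivative 1 / t ^ 1) (at t)"
    by (auto intro!: derivative_eq_intros)
  then show ?thesis unfolding Suc by (intro C_k_line_SucI[OF _ C_k_line_inverse_power[of j 1]]) auto
qed

section \<open>Gradient, Laplacian and the logarithmic potential\<close>

definition grad :: "(real^2 \<Rightarrow> real) \<Rightarrow> real^2 \<Rightarrow> real^2" where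
  "grad f z = (\<chi> i. pderiv_vec i f z)"

definition lap :: "(real^2 \<Rightarrow> real) \<Rightarrow> real^2 \<Rightarrow> real" where
  "lap f z = (\<Sum>i\<in>UNIV. pderiv_vec i (pderiv_vec i f) z)"

lemma grad_component [simp]: "grad f z $ i = pderiv_vec i f z"
  by (simp add: grad_def)

lemma norm_vec2: "(norm (z::real^2))\<^sup>2 = (\<Sum>i\<in>UNIV. (z $ i)\<^sup>2)"
  by (simp add: norm_vec_def L2_set_def sum_nonneg)

lemma C_k_on_differentiable: "C_k_on (Suc k) S f \<Longrightarrow> z \<in> S \<Longrightarrow> f differentiable (at z)"
  by simp

lemma C_k_on_pderiv_vec: "C_k_on (Suc k) S f \<Longrightarrow> C_k_on k S (pderiv_vec i f)"
  by simp

lemma pderiv_vec_const [simp]: "pderiv_vec i (\<lambda>z. c) z = 0"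
  using pderiv_vec_eqI[OF has_derivative_const] by simp

lemma pderiv_vec_add:
  "f differentiable (at z) \<Longrightarrow> g differentiable (at z) \<Longrightarrow>
     pderiv_vec i (\<lambda>z. f z + g z) z = pderiv_vec i f z + pderiv_vec i g z"
  unfolding differentiable_def using pderiv_vec_eqI[OF has_derivative_add] pderiv_vec_eqI by fastforce

lemma pderiv_vec_diff:
  "f differentiable (at z) \<Longrightarrow> g differentiable (at z) \<Longrightarrow>
     pderiv_vec i (\<lambda>z. f z - g z) z = pderiv_vec i f z - pderiv_vec i g z"
  unfolding differentiable_def using pderiv_vec_eqI[OF has_derivative_diff] pderiv_vec_eqI by fastforce

lemma pderiv_vec_mult:
  "f differentiable (at z) \<Longrightarrow> g differentiable (at z) \<Longrightarrow>
     pderiv_vec i (\<lambda>z. f z * g z) z = f z * pderiv_vec i g z + pderiv_vec i f z * g z"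
  unfolding differentiable_def using pderiv_vec_eqI[OF has_derivative_mult] pderiv_vec_eqI by fastforce

lemma pderiv_vec_compose:
  assumes "f differentiable (at z)" "(h has_real_derivative h') (at (f z))"
  shows "pderiv_vec i (\<lambda>z. h (f z)) z = h' * pderiv_vec i f z"
proof -
  obtain D where D: "(f has_derivative D) (at z)" using assms(1) by (auto simp: differentiable_def)
  have "((\<lambda>z. h (f z)) has_derivative (\<lambda>d. h' * D d)) (at z)"
    using has_derivative_compose[OF D assms(2)[unfolded has_field_derivative_def]] .
  from pderiv_vec_eqI[OF this] pderiv_vec_eqI[OF D] show ?thesis by simp
qed

lemma lap_mult:
  assumes S: "open S" "z \<in> S" and f: "C_k_on 2 S f" and g: "C_k_on 2 S g"
  shows "lap (\<lambda>z. f z * g z) z = f z * lap g z + 2 * (grad f z \<bullet> grad g z) + lap f z * g z"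
proof -
  have f1: "\<And>z. z \<in> S \<Longrightarrow> f differentiable (at z)" "\<And>z i. z \<in> S \<Longrightarrow> pderiv_vec i f differentiable (at z)"
    and g1: "\<And>z. z \<in> S \<Longrightarrow> g differentiable (at z)" "\<And>z i. z \<in> S \<Longrightarrow> pderiv_vec i g differentiable (at z)"
    using f g by (auto simp: numeral_2_eq_2)
  have "pderiv_vec i (pderiv_vec i (\<lambda>z. f z * g z)) z =
     f z * pderiv_vec i (pderiv_vec i g) z + 2 * (pderiv_vec i f z * pderiv_vec i g z)
       + pderiv_vec i (pderiv_vec i f) z * g z" for i
  proof -
    have "pderiv_vec i (pderiv_vec i (\<lambda>z. f z * g z)) z
       = pderiv_vec i (\<lambda>z. f z * pderiv_vec i g z + pderiv_vec i f z * g z) z"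
      by (rule pderiv_vec_cong[OF S]) (simp add: pderiv_vec_mult f1 g1)
    also have "\<dots> = pderiv_vec i (\<lambda>z. f z * pderiv_vec i g z) z + pderiv_vec i (\<lambda>z. pderiv_vec i f z * g z) z"
      using f1 g1 S by (intro pderiv_vec_add) (auto intro!: differentiable_mult)
    finally show ?thesis using f1 g1 S by (simp add: pderiv_vec_mult)
  qed
  then show ?thesis
    by (simp add: lap_def inner_vec_def sum.distrib sum_distrib_left sum_distrib_right)
qed

lemma lap_diff:
  assumes S: "open S" "z \<in> S" and f: "C_k_on 2 S f" and g: "C_k_on 2 S g"
  shows "lap (\<lambda>z. f z - g z) z = lap f z - lap g z"
proof -
  have f1: "\<And>z. z \<in> S \<Longrightarrow> f differentiable (at z)" "\<And>z i. z \<in> S \<Longrightarrow> pderiv_vec i f differentiable (at z)"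
    and g1: "\<And>z. z \<in> S \<Longrightarrow> g differentiable (at z)" "\<And>z i. z \<in> S \<Longrightarrow> pderiv_vec i g differentiable (at z)"
    using f g by (auto simp: numeral_2_eq_2)
  have "pderiv_vec i (pderiv_vec i (\<lambda>z. f z - g z)) z = pderiv_vec i (pderiv_vec i f) z - pderiv_vec i (pderiv_vec i g) z" for i
  proof -
    have "pderiv_vec i (pderiv_vec i (\<lambda>z. f z - g z)) z = pderiv_vec i (\<lambda>z. pderiv_vec i f z - pderiv_vec i g z) z"
      by (rule pderiv_vec_cong[OF S]) (simp add: pderiv_vec_diff f1 g1)
    then show ?thesis using f1 g1 S by (simp add: pderiv_vec_diff)
  qed
  then show ?thesis by (simp add: lap_def sum_subtractf)
qed

lemma grad_mult:
  "f differentiable (at z) \<Longrightarrow> g differentiable (at z) \<Longrightarrow>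
     grad (\<lambda>z. f z * g z) z = f z *\<^sub>R grad g z + g z *\<^sub>R grad f z"
  by (simp add: vec_eq_iff pderiv_vec_mult)

lemma lap_compose:
  assumes S: "open S" "z \<in> S" and f: "C_k_on 2 S f"
    and h: "\<And>t. t \<in> f ` S \<Longrightarrow> (h has_real_derivative h1 t) (at t)"
      "\<And>t. t \<in> f ` S \<Longrightarrow> (h1 has_real_derivative h2 t) (at t)"
  shows "lap (\<lambda>z. h (f z)) z = h2 (f z) * (norm (grad f z))\<^sup>2 + h1 (f z) * lap f z"
proof -
  have f1: "\<And>z. z \<in> S \<Longrightarrow> f differentiable (at z)" "\<And>z i. z \<in> S \<Longrightarrow> pderiv_vec i f differentiable (at z)"
    using f by (auto simp: numeral_2_eq_2)
  have h1d: "(\<lambda>z. h1 (f z)) differentiable (at z)"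
  proof -
    obtain D where D: "(f has_derivative D) (at z)" using f1(1)[OF S(2)] by (auto simp: differentiable_def)
    have "(h1 has_derivative (*) (h2 (f z))) (at (f z))"
      using h(2)[of "f z"] S by (simp add: has_field_derivative_def)
    from has_derivative_compose[OF D this] show ?thesis by (auto simp: differentiable_def)
  qed
  have "pderiv_vec i (pderiv_vec i (\<lambda>z. h (f z))) z = h2 (f z) * (pderiv_vec i f z)\<^sup>2 + h1 (f z) * pderiv_vec i (pderiv_vec i f) z" for i
  proof -
    have "pderiv_vec i (pderiv_vec i (\<lambda>z. h (f z))) z = pderiv_vec i (\<lambda>z. h1 (f z) * pderiv_vec i f z) z"
      by (rule pderiv_vec_cong[OF S]) (auto intro!: pderiv_vec_compose f1 h)
    also have "\<dots> = h1 (f z) * pderiv_vec i (pderiv_vec i f) z + pderiv_vec i (\<lambda>z. h1 (f z)) z * pderiv_vec i f z"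
      using f1 S h1d by (intro pderiv_vec_mult)
    also have "pderiv_vec i (\<lambda>z. h1 (f z)) z = h2 (f z) * pderiv_vec i f z"
      using f1 S h by (intro pderiv_vec_compose) auto
    finally show ?thesis by (simp add: power2_eq_square)
  qed
  then show ?thesis
    by (simp add: lap_def norm_vec2 sum.distrib sum_distrib_left)
qed

text \<open>Radial functions are written in the squared distance, which unlike the norm is smooth at
  the centre.\<close>

definition sqd :: "real^2 \<Rightarrow> real^2 \<Rightarrow> real" where
  "sqd a z = (norm (z - a))\<^sup>2"

lemma C_k_on_sqd: "open S \<Longrightarrow> C_k_on k S (sqd a)"
proof -
  assume S: "open S"
  have "sqd a = (\<lambda>z. \<Sum>i\<in>UNIV. (z $ i - a $ i) * (z $ i - a $ i))"
    by (rule ext) (simp add: sqd_def norm_vec2, simp add: power2_eq_square)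
  then show ?thesis using S
    by (simp only:) (intro C_k_on_sum C_k_on_mult C_k_on_diff C_k_on_coord C_k_on_const)
qed

lemma has_derivative_sqd: "(sqd a has_derivative (\<lambda>d. 2 * ((z - a) \<bullet> d))) (at z)"
  unfolding sqd_def power2_norm_eq_inner
  by (auto intro!: derivative_eq_intros simp: inner_commute)

lemma pderiv_vec_sqd: "pderiv_vec i (sqd a) z = 2 * (z $ i - a $ i)"
  using pderiv_vec_eqI[OF has_derivative_sqd] by (simp add: inner_axis)

lemma grad_sqd: "grad (sqd a) z = 2 *\<^sub>R (z - a)"
  by (simp add: vec_eq_iff pderiv_vec_sqd)

lemma lap_sqd: "lap (sqd a) z = 4"
proof -
  have "pderiv_vec i (pderiv_vec i (sqd a)) z = 2" for i
  proof -
    have "((\<lambda>z. 2 * (z $ i - a $ i)) has_derivative (\<lambda>d. 2 * d $ i)) (at z)"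
      by (auto intro!: derivative_eq_intros bounded_linear_imp_has_derivative bounded_linear_vec_nth)
    from pderiv_vec_eqI[OF this, of i] show ?thesis
      by (simp add: pderiv_vec_sqd[abs_def] axis_def)
  qed
  then show ?thesis by (simp add: lap_def)
qed

text \<open>For \<open>e = 0\<close> this is the logarithmic potential of the point \<open>a\<close>, up to the factor \<open>1/(2\<pi>)\<close>.\<close>

definition logpot :: "real \<Rightarrow> real^2 \<Rightarrow> real^2 \<Rightarrow> real" where
  "logpot e a z = ln (sqd a z + e\<^sup>2) / 2"

text \<open>The domain of smoothness of \<open>logpot e a\<close>, so that the mollified and the
  singular potential share one calculation.\<close>

definition logdom :: "real \<Rightarrow> real^2 \<Rightarrow> (real^2) set" where
  "logdom e a = (if e = 0 then - {a} else UNIV)"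

lemma open_logdom [simp]: "open (logdom e a)" by (simp add: logdom_def open_Compl)

lemma logdom_pos: "z \<in> logdom e a \<Longrightarrow> sqd a z + e\<^sup>2 > 0"
  by (cases "e = 0") (auto simp: logdom_def sqd_def intro: add_nonneg_pos)

lemma C_k_on_logpot: "C_k_on k (logdom e a) (logpot e a)"
proof -
  have "C_k_on k (logdom e a) (\<lambda>z. (1/2) * ln (sqd a z + e\<^sup>2))"
    using logdom_pos
    by (intro C_k_on_cmult C_k_on_compose[where h=ln, OF _ C_k_line_ln] C_k_on_add C_k_on_sqd C_k_on_const) auto
  then show ?thesis by (simp add: logpot_def[abs_def])
qed

lemma DERIV_half_ln:
  fixes t :: real
  assumes "t + c > 0"
  shows "((\<lambda>t. ln (t + c) / 2) has_real_derivative 1 / (2 * (t + c))) (at t)"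
proof -
  have "((\<lambda>t. ln (t + c)) has_real_derivative 1 / (t + c)) (at t)"
    using assms by (auto intro!: derivative_eq_intros)
  from DERIV_cdivide[OF this, of 2] show ?thesis by (simp add: mult.commute)
qed

lemma DERIV_half_inverse:
  fixes t :: real
  assumes "t + c > 0"
  shows "((\<lambda>t. 1 / (2 * (t + c))) has_real_derivative - (1 / (2 * (t + c)\<^sup>2))) (at t)"
proof -
  have "((\<lambda>t. inverse (t + c)) has_real_derivative - (inverse (t + c) * 1 * inverse (t + c))) (at t)"
    using assms by (intro DERIV_inverse') (auto intro!: derivative_eq_intros)
  from DERIV_cdivide[OF this, of 2] show ?thesis
    by (simp add: inverse_eq_divide power2_eq_square mult.commute)
qed

lemma grad_logpot:
  assumes "z \<in> logdom e a"
  shows "grad (logpot e a) z = (1 / (sqd a z + e\<^sup>2)) *\<^sub>R (z - a)"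
proof -
  have p: "sqd a z + e\<^sup>2 > 0" by (rule logdom_pos[OF assms])
  have d: "sqd a differentiable (at z)" using has_derivative_sqd by (auto simp: differentiable_def)
  have "pderiv_vec i (logpot e a) z = (1 / (2 * (sqd a z + e\<^sup>2))) * pderiv_vec i (sqd a) z" for i
    unfolding logpot_def[abs_def]
    by (rule pderiv_vec_compose[OF d, where h="\<lambda>t. ln (t + e\<^sup>2) / 2"])
       (rule DERIV_half_ln[OF p])
  then show ?thesis using p
    by (simp add: vec_eq_iff pderiv_vec_sqd del: distrib_left_numeral right_diff_distrib_numeral)
qed

text \<open>With \<open>t = sqd a z + e^2\<close> the radial chain rule gives
  \<open>- 2 * (t - e^2) / t^2\<close> and \<open>2 / t\<close>, which cancel up to
  \<open>2 * e^2 / t^2\<close>; the second term comes from the value 4 of the Laplacian of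
  \<open>sqd a\<close> in the plane. For \<open>e = 0\<close> this is harmonicity off
  \<open>a\<close>.\<close>

lemma lap_logpot:
  assumes "z \<in> logdom e a"
  shows "lap (logpot e a) z = bump e (z - a)"
proof -
  have p: "sqd a z + e\<^sup>2 > 0" if "z \<in> logdom e a" for z by (rule logdom_pos[OF that])
  define t where "t = sqd a z + e\<^sup>2"
  have t: "t > 0" using p[OF assms] by (simp add: t_def)
  have "lap (logpot e a) z = (- 1 / (2 * t\<^sup>2)) * (norm (grad (sqd a) z))\<^sup>2 + (1 / (2 * t)) * lap (sqd a) z"
    unfolding logpot_def[abs_def] t_def
    by (rule lap_compose[where h="\<lambda>t. ln (t + e\<^sup>2) / 2" and ?h1.0="\<lambda>t. 1 / (2 * (t + e\<^sup>2))" and ?h2.0="\<lambda>t. - 1 / (2 * (t + e\<^sup>2)\<^sup>2)", OF open_logdom assms])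
       (use p in \<open>auto intro!: DERIV_half_ln DERIV_half_inverse C_k_on_sqd simp del: distrib_left_numeral\<close>)
  also have "(norm (grad (sqd a) z))\<^sup>2 = 4 * (t - e\<^sup>2)"
    by (simp add: grad_sqd power_mult_distrib t_def sqd_def del: scaleR_right_diff_distrib)
  also have "(- 1 / (2 * t\<^sup>2)) * (4 * (t - e\<^sup>2)) + 1 / (2 * t) * lap (sqd a) z = 2 * e\<^sup>2 / t\<^sup>2"
    unfolding lap_sqd using t by (simp add: field_simps power2_eq_square)
  also have "\<dots> = bump e (z - a)" by (simp add: bump_def t_def sqd_def)
  finally show ?thesis .
qed

section \<open>Cutoff functions\<close>

text \<open>A cutoff at the point \<open>a\<close>: it vanishes on the ball of radius \<open>1/n\<close> and tends to \<open>1\<close>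
  elsewhere. Its derivatives are not concentrated on a dyadic annulus, but they are dominated by the
  same powers of \<open>|z - a|\<close>.\<close>

definition punct_cutoff :: "nat \<Rightarrow> real^2 \<Rightarrow> real^2 \<Rightarrow> real" where
  "punct_cutoff n a z = flat 0 ((real n)\<^sup>2 * sqd a z - 1)"

lemma C_k_on_punct_cutoff: "C_k_on k UNIV (punct_cutoff n a)"
  unfolding punct_cutoff_def[abs_def]
  by (rule C_k_on_compose[where h="flat 0", OF open_UNIV C_k_line_flat])
     (auto intro!: C_k_on_diff C_k_on_cmult C_k_on_sqd C_k_on_const)

lemma punct_cutoff_bounds: "0 \<le> punct_cutoff n a z" "punct_cutoff n a z \<le> 1"
  using flat_nonneg flat_le_fact[of 0] by (auto simp: punct_cutoff_def)

lemma punct_cutoff_eq_0: "(real n)\<^sup>2 * sqd a z \<le> 1 \<Longrightarrow> punct_cutoff n a z = 0"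
  by (simp add: punct_cutoff_def flat_def)

text \<open>For \<open>u = n^2 |z - a|^2 - 1\<close> the factor \<open>u + 1\<close> is
  \<open>n^2 |z - a|^2\<close>. The powers of \<open>n\<close> produced by differentiating the
  cutoff are thus compensated by powers of \<open>|z - a|\<close>, at the cost of lowering the index
  of \<open>flat\<close>.\<close>

lemma mult_flat: "(u + 1) * flat (Suc m) u = flat m u + flat (Suc m) u"
  by (simp add: flat_def field_simps)

lemma DERIV_flat_affine:
  "((\<lambda>t. flat m (c * t - 1)) has_real_derivative
     (flat (m + 2) (c * t - 1) - real m * flat (m + 1) (c * t - 1)) * c) (at t)"
proof -
  have "((\<lambda>t. c * t - 1) has_real_derivative c) (at t)" by (auto intro!: derivative_eq_intros)
  from DERIV_chain2[OF flat_has_derivative this] show ?thesis .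
qed

lemma DERIV_flat_0_affine:
  "((\<lambda>t. flat 0 (c * t - 1)) has_real_derivative flat 2 (c * t - 1) * c) (at t)"
  using DERIV_flat_affine[of 0] by (simp add: numeral_2_eq_2)

lemma DERIV_flat_2_affine:
  "((\<lambda>t. flat 2 (c * t - 1) * c) has_real_derivative
     (flat 4 (c * t - 1) - 2 * flat 3 (c * t - 1)) * c\<^sup>2) (at t)"
  using DERIV_cmult_right[OF DERIV_flat_affine[of 2 c], of c]
  by (simp add: power2_eq_square mult.assoc)

lemma grad_punct_cutoff: "grad (punct_cutoff n a) z = (flat 2 ((real n)\<^sup>2 * sqd a z - 1) * (real n)\<^sup>2 * 2) *\<^sub>R (z - a)"
proof -
  have d: "sqd a differentiable (at z)" using has_derivative_sqd by (auto simp: differentiable_def)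
  have "pderiv_vec i (punct_cutoff n a) z = (flat 2 ((real n)\<^sup>2 * sqd a z - 1) * (real n)\<^sup>2) * pderiv_vec i (sqd a) z" for i
    unfolding punct_cutoff_def[abs_def]
    by (rule pderiv_vec_compose[OF d, where h="\<lambda>t. flat 0 ((real n)\<^sup>2 * t - 1)"])
       (rule DERIV_flat_0_affine)
  then show ?thesis by (simp add: vec_eq_iff pderiv_vec_sqd)
qed

text \<open>An identity serves two purposes: boundedness of \<open>flat\<close> gives bounds uniform
  in \<open>n\<close>, and the decay at infinity of \<open>flat\<close> with positive index gives
  the limit off \<open>a\<close>. The Laplacian is treated in the same way.\<close>

lemma norm_grad_punct_cutoff:
  defines "u \<equiv> \<lambda>n a z. (real n)\<^sup>2 * sqd a z - 1"
  shows "norm (z - a) * norm (grad (punct_cutoff n a) z) = 2 * (flat 1 (u n a z) + flat 2 (u n a z))"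
proof -
  have "norm (z - a) * norm (grad (punct_cutoff n a) z) = 2 * ((u n a z + 1) * flat 2 (u n a z))"
    unfolding grad_punct_cutoff by (simp add: u_def sqd_def abs_mult flat_nonneg power2_eq_square)
  then show ?thesis using mult_flat[of "u n a z" 1] by (simp add: numeral_2_eq_2)
qed

text \<open>Let \<open>s\<close> be the squared distance and \<open>N = n^2\<close>. For a function
  \<open>h (N s)\<close> the Laplacian times \<open>s\<close> is
  \<open>4 (N s)^2 h'' + 4 (N s) h'\<close>, and \<open>mult_flat\<close> removes the factors
  \<open>N s\<close> one by one.\<close>

lemma lap_punct_cutoff:
  defines "u \<equiv> \<lambda>n a z. (real n)\<^sup>2 * sqd a z - 1"
  shows "(norm (z - a))\<^sup>2 * lap (punct_cutoff n a) z = 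
    4 * (flat 2 (u n a z) + 2 * flat 3 (u n a z) + flat 4 (u n a z))
     - 8 * (flat 1 (u n a z) + 2 * flat 2 (u n a z) + flat 3 (u n a z))
     + 4 * (flat 1 (u n a z) + flat 2 (u n a z))"
proof -
  define s where "s = sqd a z"
  define N where "N = (real n)\<^sup>2"
  define v where "v = N * s - 1"
  have uv: "u n a z = v" by (simp add: u_def v_def N_def s_def)
  have s2: "s = (norm (z - a))\<^sup>2" by (simp add: s_def sqd_def)
  have g: "(norm (grad (sqd a) z))\<^sup>2 = 4 * s"
    by (simp add: grad_sqd power_mult_distrib s2 del: scaleR_right_diff_distrib)
  have L: "lap (punct_cutoff n a) z = ((flat 4 v - 2 * flat 3 v) * N\<^sup>2) * (norm (grad (sqd a) z))\<^sup>2 + (flat 2 v * N) * lap (sqd a) z"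
    unfolding punct_cutoff_def[abs_def] v_def N_def s_def
    by (rule lap_compose[where h="\<lambda>t. flat 0 ((real n)\<^sup>2 * t - 1)" and ?h1.0="\<lambda>t. flat 2 ((real n)\<^sup>2 * t - 1) * (real n)\<^sup>2"
          and ?h2.0="\<lambda>t. (flat 4 ((real n)\<^sup>2 * t - 1) - 2 * flat 3 ((real n)\<^sup>2 * t - 1)) * ((real n)\<^sup>2)\<^sup>2", OF open_UNIV UNIV_I C_k_on_sqd])
       (rule open_UNIV DERIV_flat_0_affine DERIV_flat_2_affine)+
  have "(norm (z - a))\<^sup>2 * lap (punct_cutoff n a) z = 4 * ((N * s) * ((N * s) * (flat 4 v - 2 * flat 3 v))) + 4 * ((N * s) * flat 2 v)"
    unfolding L lap_sqd g s2[symmetric] by (simp add: power2_eq_square algebra_simps)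
  moreover have "N * s * flat 4 v = flat 3 v + flat 4 v" "N * s * flat 3 v = flat 2 v + flat 3 v" "N * s * flat 2 v = flat 1 v + flat 2 v"
    using mult_flat[of v 3] mult_flat[of v 2] mult_flat[of v 1] by (auto simp: v_def eval_nat_numeral)
  moreover have "(N * s) * ((N * s) * (flat 4 v - 2 * flat 3 v)) = N * s * (N * s * flat 4 v) - 2 * (N * s * (N * s * flat 3 v))"
    by (simp add: algebra_simps)
  ultimately have "(norm (z - a))\<^sup>2 * lap (punct_cutoff n a) z = 4 * ((flat 2 v + flat 3 v + (flat 3 v + flat 4 v)) - 2 * (flat 1 v + flat 2 v + (flat 2 v + flat 3 v))) + 4 * (flat 1 v + flat 2 v)"
    by (simp add: distrib_left)
  then show ?thesis unfolding uv by simp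
qed

text \<open>Insert \<open>flat m \<le> m!\<close> into the identities:
  \<open>6 = 2 * (1 + 2)\<close>, and \<open>252 = 152 + 88 + 12\<close> adds the bounds of the
  three groups.\<close>

lemma punct_cutoff_derivative_bounds:
  "norm (z - a) * norm (grad (punct_cutoff n a) z) \<le> 6"
  "(norm (z - a))\<^sup>2 * \<bar>lap (punct_cutoff n a) z\<bar> \<le> 252"
proof -
  define u where "u = (real n)\<^sup>2 * sqd a z - 1"
  have f: "flat 1 u \<le> 1" "flat 2 u \<le> 2" "flat 3 u \<le> 6" "flat 4 u \<le> 24"
    using flat_le_fact[of 1 u] flat_le_fact[of 2 u] flat_le_fact[of 3 u] flat_le_fact[of 4 u]
    by (auto simp: fact_numeral)
  have p: "0 \<le> flat 1 u" "0 \<le> flat 2 u" "0 \<le> flat 3 u" "0 \<le> flat 4 u" by (rule flat_nonneg)+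
  show "norm (z - a) * norm (grad (punct_cutoff n a) z) \<le> 6"
    using f p unfolding norm_grad_punct_cutoff u_def[symmetric] by simp
  have "(norm (z - a))\<^sup>2 * \<bar>lap (punct_cutoff n a) z\<bar> = \<bar>(norm (z - a))\<^sup>2 * lap (punct_cutoff n a) z\<bar>"
    by (simp add: abs_mult)
  also have "\<dots> \<le> 252"
  proof -
    have "\<bar>4 * (b + 2 * c + d) - 8 * (a + 2 * b + c) + 4 * (a + b)\<bar> \<le> 252"
      if "0 \<le> a" "a \<le> 1" "0 \<le> b" "b \<le> 2" "0 \<le> c" "c \<le> 6" "0 \<le> d" "d \<le> 24" for a b c d :: real
      using that by (auto simp: abs_le_iff)
    with f p show ?thesis unfolding lap_punct_cutoff u_def[symmetric] by blast
  qed
  finally show "(norm (z - a))\<^sup>2 * \<bar>lap (punct_cutoff n a) z\<bar> \<le> 252" .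
qed

lemma flat_tendsto_0:
  assumes "m > 0"
  shows "(flat m \<longlongrightarrow> 0) at_top"
proof (rule tendsto_sandwich[OF _ _ tendsto_const])
  show "\<forall>\<^sub>F t in at_top. 0 \<le> flat m t" by (simp add: flat_nonneg)
  show "\<forall>\<^sub>F t in at_top. flat m t \<le> 1 / t ^ m"
    using eventually_gt_at_top[of 0] by eventually_elim (rule flat_le_inverse_power)
  show "((\<lambda>t::real. 1 / t ^ m) \<longlongrightarrow> 0) at_top"
  proof -
    have "((\<lambda>t::real. 1 / t) \<longlongrightarrow> 0) at_top" by real_asymp
    from tendsto_power[OF this, of m] show ?thesis using assms by (simp add: power_divide zero_power)
  qed
qed

lemma flat_0_tendsto_1: "(flat 0 \<longlongrightarrow> 1) at_top"
proof (rule Lim_transform_eventually)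
  show "((\<lambda>t::real. exp (- 1 / t)) \<longlongrightarrow> 1) at_top" by real_asymp
  show "\<forall>\<^sub>F t in at_top. exp (- 1 / t) = flat 0 t"
    using eventually_gt_at_top[of 0] by eventually_elim (simp add: flat_def)
qed

lemma punct_cutoff_limits:
  assumes "z \<noteq> a"
  shows "(\<lambda>n. punct_cutoff n a z) \<longlonglongrightarrow> 1" "(\<lambda>n. grad (punct_cutoff n a) z) \<longlonglongrightarrow> 0" "(\<lambda>n. lap (punct_cutoff n a) z) \<longlonglongrightarrow> 0"
proof -
  define u where "u n = (real n)\<^sup>2 * sqd a z - 1" for n
  have s: "sqd a z > 0" using assms by (simp add: sqd_def)
  then have u: "filterlim u at_top sequentially" unfolding u_def by real_asymp
  have f: "(\<lambda>n. flat m (u n)) \<longlonglongrightarrow> 0" if "m > 0" for m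
    using filterlim_compose[OF flat_tendsto_0[OF that] u] .
  show "(\<lambda>n. punct_cutoff n a z) \<longlonglongrightarrow> 1"
    using filterlim_compose[OF flat_0_tendsto_1 u] by (simp add: punct_cutoff_def u_def)
  have n0: "norm (z - a) > 0" using assms by simp
  have "(\<lambda>n. 2 * (flat 1 (u n) + flat 2 (u n)) / norm (z - a)) \<longlonglongrightarrow> 2 * (0 + 0) / norm (z - a)"
    using n0 by (intro tendsto_intros f) auto
  moreover have "2 * (flat 1 (u n) + flat 2 (u n)) / norm (z - a) = norm (grad (punct_cutoff n a) z)" for n
    using norm_grad_punct_cutoff[of z a n] n0 by (simp add: u_def field_simps)
  ultimately show "(\<lambda>n. grad (punct_cutoff n a) z) \<longlonglongrightarrow> 0"
    by (auto intro: tendsto_norm_zero_cancel[of "\<lambda>n. grad (punct_cutoff n a) z"])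
  have "(\<lambda>n. (4 * (flat 2 (u n) + 2 * flat 3 (u n) + flat 4 (u n))
     - 8 * (flat 1 (u n) + 2 * flat 2 (u n) + flat 3 (u n))
     + 4 * (flat 1 (u n) + flat 2 (u n))) / (norm (z - a))\<^sup>2) \<longlonglongrightarrow>
     (4 * (0 + 2 * 0 + 0) - 8 * (0 + 2 * 0 + 0) + 4 * (0 + 0)) / (norm (z - a))\<^sup>2"
    using n0 by (intro tendsto_intros f) auto
  moreover have "(4 * (flat 2 (u n) + 2 * flat 3 (u n) + flat 4 (u n))
     - 8 * (flat 1 (u n) + 2 * flat 2 (u n) + flat 3 (u n))
     + 4 * (flat 1 (u n) + flat 2 (u n))) / (norm (z - a))\<^sup>2 = lap (punct_cutoff n a) z" for n
    unfolding u_def using lap_punct_cutoff[of z a n] n0 by (simp add: nonzero_divide_eq_eq mult.commute)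
  ultimately show "(\<lambda>n. lap (punct_cutoff n a) z) \<longlonglongrightarrow> 0" by simp
qed

section \<open>Cutoffs with a plateau\<close>

lemma compact_continuous_bound:
  fixes h :: "'a::topological_space \<Rightarrow> 'b::real_normed_vector"
  assumes "compact K" "continuous_on K h"
  obtains B where "B \<ge> 0" "\<And>z. z \<in> K \<Longrightarrow> norm (h z) \<le> B"
proof -
  have "bounded (h ` K)" using assms by (intro compact_imp_bounded compact_continuous_image)
  then obtain B where "\<forall>x\<in>h ` K. norm x \<le> B" unfolding bounded_iff by blast
  then show thesis by (intro that[of "max B 0"]) (auto simp: le_max_iff_disj)
qed

lemma continuous_compact_support_bounded:
  fixes f :: "real^2 \<Rightarrow> 'b::real_normed_vector"
  assumes "continuous_on UNIV f" "\<And>z. z \<notin> cball a r \<Longrightarrow> f z = 0"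
  obtains B where "B \<ge> 0" "\<And>z. norm (f z) \<le> B"
proof -
  obtain B where B: "B \<ge> 0" "\<And>z. z \<in> cball a r \<Longrightarrow> norm (f z) \<le> B"
    using compact_continuous_bound[OF compact_cball continuous_on_subset[OF assms(1) subset_UNIV]] by metis
  have "norm (f z) \<le> B" for z using B assms(2)[of z] by (cases "z \<in> cball a r") auto
  with B(1) show thesis by (rule that)
qed

lemma continuous_on_grad: "C_k_on 1 S f \<Longrightarrow> continuous_on S (grad f)"
  unfolding grad_def by (intro continuous_on_vec_lambda) auto

lemma continuous_on_lap: "C_k_on 2 S f \<Longrightarrow> continuous_on S (lap f)"
  unfolding lap_def by (intro continuous_on_sum) (auto simp: numeral_2_eq_2)

lemma grad_lap_const:
  assumes "open S" "z \<in> S" "\<And>x. x \<in> S \<Longrightarrow> f x = c"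
  shows "grad f z = 0" "lap f z = 0"
proof -
  have 1: "pderiv_vec i f x = 0" if "x \<in> S" for i x
  proof -
    have "pderiv_vec i f x = pderiv_vec i (\<lambda>_. c) x"
      by (rule pderiv_vec_cong[OF assms(1) that]) (rule assms(3))
    then show ?thesis by simp
  qed
  then show "grad f z = 0" using assms by (simp add: vec_eq_iff)
  have "pderiv_vec i (pderiv_vec i f) z = 0" for i
  proof -
    have "pderiv_vec i (pderiv_vec i f) z = pderiv_vec i (\<lambda>_. 0) z"
      by (rule pderiv_vec_cong[OF assms(1,2)]) (rule 1)
    then show ?thesis by simp
  qed
  then show "lap f z = 0" by (simp add: lap_def)
qed

text \<open>The plateau has radius \<open>2 * R\<close> because the inequality is claimed for
  \<open>|x - a| < R\<close>: where the derivatives of the cutoff live, \<open>z\<close> then has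
  distance at least \<open>R\<close> from \<open>x\<close> and at least \<open>2 * |x - a|\<close>
  from \<open>a\<close>. \<open>B\<close> depends on \<open>R\<close>, but is fixed before
  \<open>N\<close> is chosen.\<close>

proposition cutoff_exists:
  assumes R: "R > 0"
  obtains \<eta> B where "\<And>k. C_k_on k UNIV \<eta>" "\<And>z. 0 \<le> \<eta> z" "\<And>z. \<eta> z \<le> 1"
    "\<And>z. norm (z - a) \<le> 2 * R \<Longrightarrow> \<eta> z = 1" "\<And>z. norm (z - a) \<ge> 3 * R \<Longrightarrow> \<eta> z = 0"
    "\<And>z. norm (z - a) < 2 * R \<or> norm (z - a) > 3 * R \<Longrightarrow> grad \<eta> z = 0 \<and> lap \<eta> z = 0"
    "B \<ge> 0" "\<And>z. norm (grad \<eta> z) \<le> B" "\<And>z. \<bar>lap \<eta> z\<bar> \<le> B"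
proof -
  \<comment> \<open>\<open>t\<close> is 0 on the circle of radius \<open>2 * R\<close> and 5 on that
    of radius \<open>3 * R\<close>. The factor \<open>exp 1\<close> in \<open>\<eta>\<close> is the
    reciprocal of \<open>flat 0 1\<close>.\<close>
  define t where "t z = (1 / R\<^sup>2) * (sqd a z - 4 * R\<^sup>2)" for z
  \<comment> \<open>\<open>flat 0\<close> vanishes on the left half-line and exceeds \<open>1/2\<close> from \<open>5\<close> on, so composing
    it with itself produces a plateau where \<open>t \<le> 0\<close> and zero where \<open>t \<ge> 5\<close>.\<close>
  define \<eta> where "\<eta> z = exp 1 * flat 0 (1 - 2 * flat 0 (t z))" for z
  have t: "C_k_on k UNIV t" for k
    unfolding t_def[abs_def] by (intro C_k_on_cmult C_k_on_diff C_k_on_sqd C_k_on_const open_UNIV)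
  have C: "C_k_on k UNIV \<eta>" for k
    unfolding \<eta>_def[abs_def]
    by (intro C_k_on_cmult C_k_on_diff C_k_on_const C_k_on_compose[where h="flat 0", OF _ C_k_line_flat] t open_UNIV) auto
  have nonneg: "0 \<le> \<eta> z" for z by (simp add: \<eta>_def flat_nonneg)
  have le1: "\<eta> z \<le> 1" for z
  proof (cases "1 - 2 * flat 0 (t z) > 0")
    case True
    define u where "u = 1 - 2 * flat 0 (t z)"
    have u: "0 < u" "u \<le> 1" using True flat_nonneg[of 0 "t z"] by (auto simp: u_def)
    have "\<eta> z = exp 1 * flat 0 u" by (simp only: \<eta>_def u_def)
    also have "\<dots> = exp 1 * exp (- 1 / u)" using u by (simp add: flat_def)
    also have "\<dots> = exp (1 - 1 / u)" by (simp add: exp_add[symmetric])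
    also have "\<dots> \<le> exp 0" using u by (subst exp_le_cancel_iff) simp
    finally show ?thesis by simp
  qed (simp add: \<eta>_def flat_def)
  have one: "\<eta> z = 1" if "norm (z - a) \<le> 2 * R" for z
  proof -
    have "sqd a z \<le> (2 * R)\<^sup>2" unfolding sqd_def using that by (intro power_mono) auto
    then have "t z \<le> 0" using R by (simp add: t_def divide_nonpos_pos power_mult_distrib)
    then show ?thesis by (simp add: \<eta>_def flat_def exp_add[symmetric])
  qed
  have zero: "\<eta> z = 0" if "norm (z - a) \<ge> 3 * R" for z
  proof -
    have "sqd a z \<ge> (3 * R)\<^sup>2" unfolding sqd_def using that R by (intro power_mono) auto
    then have t5: "t z \<ge> 5" using R by (simp add: t_def field_simps power_mult_distrib)
    have "1 - 1 / t z \<le> exp (- 1 / t z)" using exp_ge_add_one_self[of "- 1 / t z"] by simp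
    moreover have "1 / t z \<le> 1 / 5" using t5 by (intro divide_left_mono) auto
    ultimately have "exp (- 1 / t z) \<ge> 1 / 2" by linarith
    then have "flat 0 (t z) \<ge> 1 / 2" using t5 by (simp add: flat_def)
    then show ?thesis by (simp add: \<eta>_def flat_def)
  qed
  have der: "grad \<eta> z = 0 \<and> lap \<eta> z = 0" if "norm (z - a) < 2 * R \<or> norm (z - a) > 3 * R" for z
    using that
  proof
    assume "norm (z - a) < 2 * R"
    then show ?thesis
      using grad_lap_const[of "ball a (2 * R)" z \<eta> 1] one by (auto simp: dist_norm norm_minus_commute)
  next
    assume "norm (z - a) > 3 * R"
    then show ?thesis
      using grad_lap_const[of "- cball a (3 * R)" z \<eta> 0] zero
      by (auto simp: dist_norm norm_minus_commute open_Compl)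
  qed
  have grad0: "grad \<eta> z = 0" if "z \<notin> cball a (3 * R)" for z
    using der[of z] that by (simp add: dist_norm norm_minus_commute)
  obtain B1 where B1: "B1 \<ge> 0" "\<And>z. norm (grad \<eta> z) \<le> B1"
    using continuous_compact_support_bounded[OF continuous_on_grad[OF C] grad0] by blast
  have lap0: "lap \<eta> z = 0" if "z \<notin> cball a (3 * R)" for z
    using der[of z] that by (simp add: dist_norm norm_minus_commute)
  obtain B2 where B2: "B2 \<ge> 0" "\<And>z. norm (lap \<eta> z) \<le> B2"
    using continuous_compact_support_bounded[OF continuous_on_lap[OF C] lap0] by blast
  show thesis
    by (rule that[of \<eta> "max B1 B2"])
       (use C nonneg le1 one zero der B1 B2 in \<open>auto simp: le_max_iff_disj\<close>)
qed

section \<open>Taylor remainder of the logarithmic potential\<close>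

definition cpx :: "real^2 \<Rightarrow> complex" where
  "cpx d = Complex (d $ 1) (d $ 2)"

lemma norm_cpx [simp]: "cmod (cpx d) = norm d"
  by (simp add: cpx_def cmod_def norm_vec_def L2_set_def UNIV_2)

lemma cpx_diff: "cpx (a - b) = cpx a - cpx b"
  by (simp add: cpx_def complex_eq_iff)

lemma cpx_scaleR: "cpx (c *\<^sub>R a) = of_real c * cpx a"
  by (simp add: cpx_def complex_eq_iff)

lemma cpx_eq_0_iff [simp]: "cpx d = 0 \<longleftrightarrow> d = 0"
  using norm_cpx[of d] by (metis norm_eq_zero)

lemma bounded_linear_cpx: "bounded_linear cpx"
  by (rule bounded_linear_intro[where K=1]) (auto simp: cpx_def complex_eq_iff cmod_def norm_vec_def L2_set_def UNIV_2)

lemma has_derivative_Re_compose_cpx: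
  assumes "(h has_field_derivative h') (at (cpx (z - a)))"
  shows "((\<lambda>z. Re (h (cpx (z - a)))) has_derivative (\<lambda>d. Re (h' * cpx d))) (at z)"
proof -
  have "((\<lambda>z. cpx (z - a)) has_derivative (\<lambda>d. cpx (d - 0))) (at z)"
    by (intro bounded_linear.has_derivative[OF bounded_linear_cpx] derivative_intros)
  then have "((\<lambda>z. cpx (z - a)) has_derivative cpx) (at z)" by simp
  from has_derivative_compose[OF this assms[unfolded has_field_derivative_def]]
  show ?thesis by (rule bounded_linear.has_derivative[OF bounded_linear_Re])
qed

lemma pderiv_vec_Re_compose_cpx:
  assumes "(h has_field_derivative h') (at (cpx (z - a)))"
  shows "pderiv_vec 1 (\<lambda>z. Re (h (cpx (z - a)))) z = Re h'"
    and "pderiv_vec 2 (\<lambda>z. Re (h (cpx (z - a)))) z = - Im h'"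
  using pderiv_vec_eqI[OF has_derivative_Re_compose_cpx[OF assms], of 1]
    pderiv_vec_eqI[OF has_derivative_Re_compose_cpx[OF assms], of 2]
  by (simp_all add: cpx_def axis_def)

text \<open>By the Cauchy-Riemann equations the partial derivatives are \<open>Re h'\<close> and
  \<open>- Im h'\<close>. In this form gradients of logarithmic potentials become complex fractions,
  whose geometric series can be summed.\<close>

lemma cpx_grad_Re_compose_cpx:
  assumes "(h has_field_derivative h') (at (cpx (z - a)))"
  shows "cpx (grad (\<lambda>z. Re (h (cpx (z - a)))) z) = cnj h'"
  using pderiv_vec_Re_compose_cpx[OF assms] by (simp add: cpx_def complex_eq_iff)

lemma lap_Re_compose_cpx:
  assumes S: "open S" "z \<in> S"
    and h: "\<And>z. z \<in> S \<Longrightarrow> (h has_field_derivative h1 (cpx (z - a))) (at (cpx (z - a)))"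
      "(h1 has_field_derivative h2) (at (cpx (z - a)))"
  shows "lap (\<lambda>z. Re (h (cpx (z - a)))) z = 0"
proof -
  have "pderiv_vec 1 (pderiv_vec 1 (\<lambda>z. Re (h (cpx (z - a))))) z = pderiv_vec 1 (\<lambda>z. Re (h1 (cpx (z - a)))) z"
    by (rule pderiv_vec_cong[OF S]) (rule pderiv_vec_Re_compose_cpx(1)[OF h(1)])
  moreover have "pderiv_vec 2 (pderiv_vec 2 (\<lambda>z. Re (h (cpx (z - a))))) z = pderiv_vec 2 (\<lambda>z. Re (\<i> * h1 (cpx (z - a)))) z"
    by (rule pderiv_vec_cong[OF S]) (simp add: pderiv_vec_Re_compose_cpx(2)[OF h(1)])
  moreover have "((\<lambda>w. \<i> * h1 w) has_field_derivative \<i> * h2) (at (cpx (z - a)))"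
    by (rule DERIV_cmult[OF h(2)])
  ultimately show ?thesis
    using pderiv_vec_Re_compose_cpx(1)[OF h(2)] pderiv_vec_Re_compose_cpx(2)[of "\<lambda>w. \<i> * h1 w" "\<i> * h2" z a]
    by (simp add: lap_def sum_2)
qed

lemma C_k_on_inverse_sqd: "C_k_on k (- {a}) (\<lambda>z. 1 / sqd a z)"
proof -
  have "C_k_on k (- {a}) (\<lambda>z. 1 / sqd a z ^ 1)"
    by (rule C_k_on_compose[where h="\<lambda>t. 1 / t ^ 1", OF _ C_k_line_inverse_power])
       (use C_k_on_sqd[of "- {a}" k a] in \<open>auto simp: open_Compl\<close>, simp add: sqd_def)
  then show ?thesis by simp
qed

text \<open>Both parts are carried through the induction together, since complex multiplication
  mixes them. The first power is written out with denominator \<open>sqd a z\<close>.\<close>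

lemma C_k_on_power_quotient:
  "C_k_on k (- {a}) (\<lambda>z. Re ((\<xi> / cpx (z - a)) ^ m)) \<and> C_k_on k (- {a}) (\<lambda>z. Im ((\<xi> / cpx (z - a)) ^ m))"
proof (induction m)
  case 0
  show ?case by (simp add: C_k_on_const open_Compl)
next
  case (Suc m)
  have o: "open (- {a})" by (simp add: open_Compl)
  have eq: "Re (\<xi> / cpx (z - a)) = (Re \<xi> * (z $ 1 - a $ 1) + Im \<xi> * (z $ 2 - a $ 2)) * (1 / sqd a z)"
    "Im (\<xi> / cpx (z - a)) = (Im \<xi> * (z $ 1 - a $ 1) - Re \<xi> * (z $ 2 - a $ 2)) * (1 / sqd a z)" for z
    by (simp_all add: Re_divide Im_divide cpx_def sqd_def norm_vec2 sum_2)
  have r: "C_k_on k (- {a}) (\<lambda>z. Re (\<xi> / cpx (z - a)))" "C_k_on k (- {a}) (\<lambda>z. Im (\<xi> / cpx (z - a)))"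
    unfolding eq
    by (intro C_k_on_mult C_k_on_add C_k_on_diff C_k_on_const C_k_on_coord o C_k_on_inverse_sqd)+
  show ?case unfolding power_Suc times_complex.simps
    using r Suc by (intro conjI C_k_on_add C_k_on_diff C_k_on_mult o) auto
qed

text \<open>Partial sums of the series of \<open>- Ln (1 - \<xi> / \<zeta>)\<close>; the term \<open>k = 0\<close> is zero because
  of \<open>x / 0 = 0\<close>.\<close>

definition log_psum :: "nat \<Rightarrow> complex \<Rightarrow> complex \<Rightarrow> complex" where
  "log_psum N \<xi> \<zeta> = (\<Sum>k<N. (\<xi> / \<zeta>) ^ k / of_nat k)"

text \<open>The derivative of \<open>log_psum N \<xi>\<close> in \<open>\<zeta>\<close>. The guard
  matters: at \<open>k = 0\<close> the general formula would give \<open>- 1 / \<zeta>\<close>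
  instead of the derivative of a zero term.\<close>

definition log_psum' :: "nat \<Rightarrow> complex \<Rightarrow> complex \<Rightarrow> complex" where
  "log_psum' N \<xi> \<zeta> = (\<Sum>k<N. if k = 0 then 0 else - (\<xi> ^ k / \<zeta> ^ (k + 1)))"

lemma log_psum_has_derivative:
  assumes "\<zeta> \<noteq> 0"
  shows "(log_psum N \<xi> has_field_derivative log_psum' N \<xi> \<zeta>) (at \<zeta>)"
  unfolding log_psum_def[abs_def] log_psum'_def
proof (rule DERIV_sum)
  fix k
  show "((\<lambda>\<zeta>. (\<xi> / \<zeta>) ^ k / of_nat k) has_field_derivative (if k = 0 then 0 else - (\<xi> ^ k / \<zeta> ^ (k + 1)))) (at \<zeta>)"
  proof (cases k)
    case (Suc m)
    have "((\<lambda>\<zeta>. \<xi> / \<zeta>) has_field_derivative - \<xi> / \<zeta>\<^sup>2) (at \<zeta>)"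
      using assms by (auto intro!: derivative_eq_intros simp: power2_eq_square)
    from DERIV_cdivide[OF DERIV_power[OF this, of k], of "of_nat k"]
    show ?thesis using assms Suc by (simp add: power_divide power2_eq_square field_simps del: of_nat_Suc)
  qed simp
qed

lemma log_psum'_differentiable:
  assumes "\<zeta> \<noteq> 0"
  shows "\<exists>D. (log_psum' N \<xi> has_field_derivative D) (at \<zeta>)"
proof -
  have "log_psum' N \<xi> field_differentiable (at \<zeta>)"
    unfolding log_psum'_def[abs_def]
  proof (rule field_differentiable_sum)
    fix k
    show "(\<lambda>\<zeta>. if k = 0 then 0 else - (\<xi> ^ k / \<zeta> ^ (k + 1))) field_differentiable at \<zeta>"
      using assms by (cases "k = 0") (auto intro!: derivative_intros)
  qed
  then show ?thesis by (simp add: field_differentiable_def)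
qed

text \<open>The Taylor polynomial of degree \<open>< N\<close> of \<open>ln |z - x|\<close> as a function of \<open>x\<close> at
  \<open>x = a\<close>. It is harmonic in \<open>z\<close> away from \<open>a\<close>.\<close>

definition logpot_taylor :: "nat \<Rightarrow> real^2 \<Rightarrow> real^2 \<Rightarrow> real^2 \<Rightarrow> real" where
  "logpot_taylor N a x z = logpot 0 a z - Re (log_psum N (cpx (x - a)) (cpx (z - a)))"

lemma C_k_on_Re_log_psum: "C_k_on k (- {a}) (\<lambda>z. Re (log_psum N \<xi> (cpx (z - a))))"
proof -
  have "(\<lambda>z. Re (log_psum N \<xi> (cpx (z - a)))) = (\<lambda>z. \<Sum>k<N. (1 / real k) * Re ((\<xi> / cpx (z - a)) ^ k))"
    by (simp add: log_psum_def)
  moreover have "C_k_on k (- {a}) (\<lambda>z. \<Sum>k<N. (1 / real k) * Re ((\<xi> / cpx (z - a)) ^ k))"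
    using C_k_on_power_quotient by (intro C_k_on_sum C_k_on_cmult) (auto simp: open_Compl)
  ultimately show ?thesis by simp
qed

lemma C_k_on_logpot_taylor: "C_k_on k (- {a}) (logpot_taylor N a x)"
  unfolding logpot_taylor_def[abs_def]
  using C_k_on_logpot[of k 0 a]
  by (intro C_k_on_diff C_k_on_Re_log_psum) (auto simp: open_Compl logdom_def)

lemma lap_logpot_taylor:
  assumes "z \<noteq> a"
  shows "lap (logpot_taylor N a x) z = 0"
proof -
  have S: "open (- {a})" "z \<in> - {a}" using assms by (auto simp: open_Compl)
  obtain D where D: "(log_psum' N (cpx (x - a)) has_field_derivative D) (at (cpx (z - a)))"
    using log_psum'_differentiable assms by (metis cpx_eq_0_iff right_minus_eq)
  have "lap (\<lambda>z. Re (log_psum N (cpx (x - a)) (cpx (z - a)))) z = 0"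
    by (rule lap_Re_compose_cpx[OF S _ D]) (simp add: log_psum_has_derivative)
  moreover have "lap (logpot 0 a) z = 0"
    using lap_logpot[of z 0 a] assms by (simp add: logdom_def bump_def)
  moreover have "lap (logpot_taylor N a x) z = lap (logpot 0 a) z - lap (\<lambda>z. Re (log_psum N (cpx (x - a)) (cpx (z - a)))) z"
    unfolding logpot_taylor_def[abs_def]
    using C_k_on_logpot[of 2 0 a] by (intro lap_diff[OF S] C_k_on_Re_log_psum) (auto simp: logdom_def)
  ultimately show ?thesis by simp
qed

lemma cpx_grad_logpot_0:
  assumes "z \<noteq> a"
  shows "cpx (grad (logpot 0 a) z) = cnj (1 / cpx (z - a))"
proof -
  have "cpx (grad (logpot 0 a) z) = of_real (1 / (norm (z - a))\<^sup>2) * cpx (z - a)"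
    using assms by (subst grad_logpot) (auto simp: logdom_def sqd_def cpx_scaleR)
  also have "\<dots> = cpx (z - a) / (cpx (z - a) * cnj (cpx (z - a)))"
    by (simp add: complex_norm_square[symmetric])
  also have "\<dots> = cnj (1 / cpx (z - a))" using assms by simp
  finally show ?thesis .
qed

lemma grad_diff:
  "f differentiable (at z) \<Longrightarrow> g differentiable (at z) \<Longrightarrow> grad (\<lambda>z. f z - g z) z = grad f z - grad g z"
  by (simp add: vec_eq_iff pderiv_vec_diff)

text \<open>The gradient of \<open>logpot 0 a\<close> contributes the term \<open>k = 0\<close> of
  the truncated geometric series of \<open>1 / (\<zeta> - \<xi>)\<close>, the gradient of the
  partial sum all others. \<open>N > 0\<close> puts \<open>k = 0\<close> into the range.\<close>

lemma cpx_grad_logpot_taylor: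
  assumes "z \<noteq> a" "N > 0"
  shows "cpx (grad (logpot_taylor N a x) z) = cnj (\<Sum>k<N. cpx (x - a) ^ k / cpx (z - a) ^ (k + 1))"
proof -
  define \<xi> \<zeta> where "\<xi> = cpx (x - a)" and "\<zeta> = cpx (z - a)"
  have z: "\<zeta> \<noteq> 0" using assms by (simp add: \<zeta>_def)
  have d1: "logpot 0 a differentiable (at z)"
    by (rule C_k_on_differentiable[OF C_k_on_logpot[of "Suc 0"]]) (use assms in \<open>simp add: logdom_def\<close>)
  have d2: "(\<lambda>z. Re (log_psum N \<xi> (cpx (z - a)))) differentiable (at z)"
    by (rule C_k_on_differentiable[OF C_k_on_Re_log_psum[of "Suc 0"]]) (use assms in simp)
  have "cpx (grad (logpot_taylor N a x) z) = cpx (grad (logpot 0 a) z) - cpx (grad (\<lambda>z. Re (log_psum N \<xi> (cpx (z - a)))) z)"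
    unfolding logpot_taylor_def[abs_def] \<xi>_def[symmetric] grad_diff[OF d1 d2] by (rule cpx_diff)
  also have "\<dots> = cnj (1 / \<zeta>) - cnj (log_psum' N \<xi> \<zeta>)"
    unfolding cpx_grad_logpot_0[OF assms(1)]
      cpx_grad_Re_compose_cpx[OF log_psum_has_derivative[OF z[unfolded \<zeta>_def], of N \<xi>]] \<zeta>_def ..
  also have "\<dots> = cnj (1 / \<zeta> - log_psum' N \<xi> \<zeta>)" by simp
  also have "1 / \<zeta> - log_psum' N \<xi> \<zeta> = (\<Sum>k<N. \<xi> ^ k / \<zeta> ^ (k + 1))"
  proof -
    obtain M where N: "N = Suc M" using assms by (cases N) auto
    show ?thesis unfolding N log_psum'_def by (simp only: sum.lessThan_Suc_shift) (simp add: sum_negf)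
  qed
  finally show ?thesis by (simp only: \<xi>_def \<zeta>_def)
qed

text \<open>The truncated geometric series is summed in closed form. Hence there is equality, with
  constant 1 for every \<open>N\<close> and without any relation between \<open>|x - a|\<close> and
  \<open>|z - a|\<close>; letting \<open>N\<close> tend to infinity with a fixed radius rests on
  this.\<close>

lemma norm_grad_remainder:
  assumes "z \<noteq> a" "z \<noteq> x" "N > 0"
  shows "norm (grad (logpot 0 x) z - grad (logpot_taylor N a x) z) = norm (x - a) ^ N / (norm (z - a) ^ N * norm (z - x))"
proof -
  define \<xi> \<zeta> where "\<xi> = cpx (x - a)" and "\<zeta> = cpx (z - a)"
  have z: "\<zeta> \<noteq> 0" using assms by (simp add: \<zeta>_def)
  have zx: "cpx (z - x) = \<zeta> - \<xi>" by (simp add: \<zeta>_def \<xi>_def cpx_diff)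
  have nz: "\<zeta> - \<xi> \<noteq> 0" using assms by (simp flip: zx)
  have "cpx (grad (logpot 0 x) z - grad (logpot_taylor N a x) z) = cnj (1 / (\<zeta> - \<xi>) - (\<Sum>k<N. \<xi> ^ k / \<zeta> ^ (k + 1)))"
    using cpx_grad_logpot_0[OF assms(2)] cpx_grad_logpot_taylor[OF assms(1,3), of x]
    unfolding cpx_diff[of "grad (logpot 0 x) z"] zx \<xi>_def[symmetric] \<zeta>_def[symmetric] by simp
  also have "1 / (\<zeta> - \<xi>) - (\<Sum>k<N. \<xi> ^ k / \<zeta> ^ (k + 1)) = \<xi> ^ N / (\<zeta> ^ N * (\<zeta> - \<xi>))"
  proof -
    have "(\<Sum>k<N. \<xi> ^ k / \<zeta> ^ (k + 1)) = (\<Sum>k<N. (\<xi> / \<zeta>) ^ k) / \<zeta>"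
      by (simp add: sum_divide_distrib power_divide mult.commute)
    also have "(\<Sum>k<N. (\<xi> / \<zeta>) ^ k) = (1 - (\<xi> / \<zeta>) ^ N) / (1 - \<xi> / \<zeta>)"
      using nz z by (subst sum_gp_strict) auto
    finally have "(\<Sum>k<N. \<xi> ^ k / \<zeta> ^ (k + 1)) = (1 - (\<xi> / \<zeta>) ^ N) / ((1 - \<xi> / \<zeta>) * \<zeta>)" by simp
    also have "(1 - \<xi> / \<zeta>) * \<zeta> = \<zeta> - \<xi>" using z by (simp add: left_diff_distrib)
    finally show ?thesis by (simp add: power_divide diff_divide_distrib)
  qed
  finally have "cmod (cpx (grad (logpot 0 x) z - grad (logpot_taylor N a x) z)) = cmod (\<xi> ^ N / (\<zeta> ^ N * (\<zeta> - \<xi>)))"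
    by (simp only: complex_mod_cnj)
  also have "\<dots> = norm (x - a) ^ N / (norm (z - a) ^ N * norm (z - x))"
    unfolding zx[symmetric] by (simp add: norm_divide norm_mult norm_power \<xi>_def \<zeta>_def)
  finally show ?thesis by simp
qed

lemma logpot_0: "logpot 0 a z = ln (norm (z - a))"
  by (cases "z = a") (simp_all add: logpot_def sqd_def ln_realpow)

lemma divide_nat_le_self: "0 \<le> X \<Longrightarrow> X / real k \<le> X"
  by (cases "k = 0") (auto simp: divide_le_eq mult_le_cancel_left1)

text \<open>The size of the remainder itself matters only where the cutoff varies, so
  \<open>|x - a| \<le> |z - a| / 2\<close> may be assumed. There the tail of the logarithmic series
  in \<open>u = \<xi> / \<zeta>\<close> is at most \<open>|u|^N / (1 - |u|)\<close>.\<close>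

lemma remainder_bound:
  assumes "z \<noteq> a" "norm (x - a) \<le> norm (z - a) / 2" 
  shows "\<bar>logpot 0 x z - logpot_taylor N a x z\<bar> \<le> 2 * (norm (x - a) / norm (z - a)) ^ N"
proof -
  define \<xi> \<zeta> where "\<xi> = cpx (x - a)" and "\<zeta> = cpx (z - a)"
  define u where "u = \<xi> / \<zeta>"
  have z: "\<zeta> \<noteq> 0" using assms by (simp add: \<zeta>_def)
  have u: "cmod u = norm (x - a) / norm (z - a)" by (simp add: u_def \<xi>_def \<zeta>_def norm_divide)
  have u2: "cmod u \<le> 1 / 2" using assms by (simp add: u field_simps)
  have u1: "1 - u \<noteq> 0" using u2 by auto
  \<comment> \<open>The term \<open>n = 0\<close> is 0 by division by zero, so the initial segment
    of length \<open>N\<close> is \<open>- log_psum N \<xi> \<zeta>\<close>.\<close>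
  have "(\<lambda>n. - ((u ^ n) / of_nat n)) sums Ln (1 - u)"
    using Ln_series'[of "- u"] u2 by simp
  then have s: "(\<lambda>n. - (u ^ (n + N) / of_nat (n + N))) sums (Ln (1 - u) - (\<Sum>n<N. - (u ^ n / of_nat n)))"
    by (rule sums_split_initial_segment)
  have g: "(\<lambda>n. cmod u ^ N * cmod u ^ n) sums (cmod u ^ N * (1 / (1 - cmod u)))"
    using u2 by (intro sums_mult geometric_sums) auto
  have "cmod (Ln (1 - u) - (\<Sum>n<N. - (u ^ n / of_nat n))) \<le> cmod u ^ N * (1 / (1 - cmod u))"
  proof (rule norm_sums_le[OF s g])
    fix n
    have "cmod (- (u ^ (n + N) / of_nat (n + N))) = cmod u ^ (n + N) / real (n + N)"
      by (simp add: norm_divide norm_power del: of_nat_add)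
    also have "\<dots> \<le> cmod u ^ (n + N)"
      by (rule divide_nat_le_self) simp
    finally show "cmod (- (u ^ (n + N) / of_nat (n + N))) \<le> cmod u ^ N * cmod u ^ n"
      by (simp add: power_add mult.commute)
  qed
  also have "\<dots> \<le> cmod u ^ N * 2"
    using u2 by (intro mult_left_mono) (auto simp: divide_simps)
  finally have 1: "cmod (Ln (1 - u) + log_psum N \<xi> \<zeta>) \<le> 2 * cmod u ^ N"
    by (simp add: log_psum_def u_def sum_negf mult.commute)
  have "norm (z - x) = cmod (\<zeta> * (1 - u))"
    using z by (simp add: u_def right_diff_distrib \<xi>_def \<zeta>_def flip: norm_cpx cpx_diff)
  then have "logpot 0 x z - logpot 0 a z = ln (cmod (1 - u))"
    using z u1 by (simp add: logpot_0 norm_mult ln_mult \<zeta>_def)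
  then have "logpot 0 x z - logpot_taylor N a x z = Re (Ln (1 - u) + log_psum N \<xi> \<zeta>)"
    using u1 by (simp add: logpot_taylor_def \<xi>_def \<zeta>_def)
  then show ?thesis using 1 abs_Re_le_cmod[of "Ln (1 - u) + log_psum N \<xi> \<zeta>"] by (simp add: u)
qed

text \<open>\<open>C\<close> depends on \<open>x\<close> and \<open>N\<close>. These bounds only
  make the test function admissible, and for that any power of \<open>1 / |z - a|\<close> will do,
  since \<open>f\<close> vanishes to infinite order.\<close>

lemma logpot_taylor_crude_bounds:
  assumes N: "N > 0"
  obtains C where "C \<ge> 0" "\<And>z. 0 < norm (z - a) \<Longrightarrow> norm (z - a) \<le> 1 \<Longrightarrow> \<bar>logpot_taylor N a x z\<bar> \<le> C / norm (z - a) ^ N"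
    "\<And>z. 0 < norm (z - a) \<Longrightarrow> norm (z - a) \<le> 1 \<Longrightarrow> norm (grad (logpot_taylor N a x) z) \<le> C / norm (z - a) ^ N"
proof -
  define C where "C = (\<Sum>k<N. norm (x - a) ^ k)"
  have C: "C \<ge> 0" unfolding C_def by (intro sum_nonneg) auto
  have le: "1 / norm (z - a) ^ k \<le> 1 / norm (z - a) ^ N" if "0 < norm (z - a)" "norm (z - a) \<le> 1" "k \<le> N" for z k
    using that by (intro divide_left_mono power_decreasing) auto
  have "\<bar>logpot_taylor N a x z\<bar> \<le> (1 + C) / norm (z - a) ^ N" if z: "0 < norm (z - a)" "norm (z - a) \<le> 1" for z
  proof -
    \<comment> \<open>The logarithm is dominated by \<open>1 / |z - a|\<close>, hence by
      \<open>1 / |z - a|^N\<close> in the unit ball as \<open>N > 0\<close>.\<close>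
    have "ln (1 / norm (z - a)) \<le> 1 / norm (z - a) - 1" using z by (intro ln_le_minus_one) auto
    then have l: "\<bar>logpot 0 a z\<bar> \<le> 1 / norm (z - a)" using z by (simp add: logpot_0 ln_div abs_if)
    have "cmod (log_psum N (cpx (x - a)) (cpx (z - a))) \<le> (\<Sum>k<N. norm (x - a) ^ k * (1 / norm (z - a) ^ N))"
      unfolding log_psum_def
    proof (rule sum_norm_le)
      fix k assume k: "k \<in> {..<N}"
      have "cmod ((cpx (x - a) / cpx (z - a)) ^ k / of_nat k) = (norm (x - a) ^ k * (1 / norm (z - a) ^ k)) / real k"
        by (simp only: norm_divide norm_power power_divide norm_of_nat norm_cpx) simp
      also have "\<dots> \<le> norm (x - a) ^ k * (1 / norm (z - a) ^ k)"
        by (rule divide_nat_le_self) simp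
      also have "\<dots> \<le> norm (x - a) ^ k * (1 / norm (z - a) ^ N)"
        using le[OF z, of k] k by (intro mult_left_mono) auto
      finally show "cmod ((cpx (x - a) / cpx (z - a)) ^ k / of_nat k) \<le> norm (x - a) ^ k * (1 / norm (z - a) ^ N)" .
    qed
    then have h: "\<bar>Re (log_psum N (cpx (x - a)) (cpx (z - a)))\<bar> \<le> C / norm (z - a) ^ N"
      using abs_Re_le_cmod order_trans by (fastforce simp: C_def sum_divide_distrib)
    show ?thesis using l h le[OF z, of 1] N unfolding logpot_taylor_def by (simp add: add_divide_distrib)
  qed
  moreover have "norm (grad (logpot_taylor N a x) z) \<le> (1 + C) / norm (z - a) ^ N" if z: "0 < norm (z - a)" "norm (z - a) \<le> 1" for z
  proof -
    have za: "z \<noteq> a" using z by auto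
    have "norm (grad (logpot_taylor N a x) z) = cmod (\<Sum>k<N. cpx (x - a) ^ k / cpx (z - a) ^ (k + 1))"
      unfolding norm_cpx[symmetric] cpx_grad_logpot_taylor[OF za N] by (rule complex_mod_cnj)
    also have "\<dots> \<le> (\<Sum>k<N. norm (x - a) ^ k * (1 / norm (z - a) ^ N))"
    proof (rule sum_norm_le)
      fix k assume k: "k \<in> {..<N}"
      have "cmod (cpx (x - a) ^ k / cpx (z - a) ^ (k + 1)) = norm (x - a) ^ k * (1 / norm (z - a) ^ (k + 1))"
        by (simp only: norm_divide norm_power norm_cpx) simp
      also have "\<dots> \<le> norm (x - a) ^ k * (1 / norm (z - a) ^ N)"
        using le[OF z, of "k + 1"] k by (intro mult_left_mono) auto
      finally show "cmod (cpx (x - a) ^ k / cpx (z - a) ^ (k + 1)) \<le> norm (x - a) ^ k * (1 / norm (z - a) ^ N)" .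
    qed
    also have "\<dots> = C / norm (z - a) ^ N" by (simp add: C_def sum_divide_distrib)
    also have "\<dots> \<le> (1 + C) / norm (z - a) ^ N" using z by (intro divide_right_mono) auto
    finally show ?thesis .
  qed
  ultimately show thesis using that[of "1 + C"] C by auto
qed

section \<open>The real equation in very weak form\<close>

lemma integrable_mult_square:
  fixes h1 h2 :: "'a \<Rightarrow> real"
  assumes [measurable]: "h1 \<in> borel_measurable M" "h2 \<in> borel_measurable M"
    and "integrable M (\<lambda>z. (h1 z)\<^sup>2)" "integrable M (\<lambda>z. (h2 z)\<^sup>2)"
  shows "integrable M (\<lambda>z. h1 z * h2 z)"
proof (rule Bochner_Integration.integrable_bound)
  show "integrable M (\<lambda>z. (h1 z)\<^sup>2 + (h2 z)\<^sup>2)" using assms by auto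
  show "AE z in M. norm (h1 z * h2 z) \<le> norm ((h1 z)\<^sup>2 + (h2 z)\<^sup>2)"
  proof (rule AE_I2)
    fix z
    have "2 * \<bar>h1 z\<bar> * \<bar>h2 z\<bar> \<le> (h1 z)\<^sup>2 + (h2 z)\<^sup>2"
      using sum_squares_bound[of "\<bar>h1 z\<bar>" "\<bar>h2 z\<bar>"] by simp
    moreover have "0 \<le> \<bar>h1 z\<bar> * \<bar>h2 z\<bar>" by simp
    ultimately have "\<bar>h1 z\<bar> * \<bar>h2 z\<bar> \<le> (h1 z)\<^sup>2 + (h2 z)\<^sup>2" by linarith
    then show "norm (h1 z * h2 z) \<le> norm ((h1 z)\<^sup>2 + (h2 z)\<^sup>2)" by (simp add: abs_mult)
  qed
qed simp

lemma closure_subset_compact: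
  fixes K :: "(real^2) set"
  assumes "compact K" "\<And>z. z \<notin> K \<Longrightarrow> \<phi> z = (0::real)"
  shows "compact (closure {z. \<phi> z \<noteq> 0})" "closure {z. \<phi> z \<noteq> 0} \<subseteq> K"
proof -
  show s: "closure {z. \<phi> z \<noteq> 0} \<subseteq> K"
    using assms compact_imp_closed[OF assms(1)] by (intro closure_minimal) auto
  show "compact (closure {z. \<phi> z \<noteq> 0})"
    using assms(1) s by (metis closed_closure compact_Int_closed inf.absorb_iff2)
qed

text \<open>The setting for one real component. The functions are Borel, so that Tonelli applies on
  \<open>lborel\<close>; \<open>A\<close> is square integrable on the whole plane, being extended by
  zero later. In \<open>weak_eq\<close> the gradient has been moved from \<open>f\<close> to the
  test function, which explains the sign in front of \<open>A\<close>. The weak gradient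
  \<open>g\<close> enters through \<open>grad_eq\<close> and serves the Sobolev embedding.\<close>

locale weak_eq =
  fixes \<Omega> :: "(real^2) set" and f :: "real^2 \<Rightarrow> real" and A :: "real^2 \<Rightarrow> real^2"
    and g :: "2 \<Rightarrow> real^2 \<Rightarrow> real"
  assumes open_dom: "open \<Omega>"
    and f_borel [measurable]: "f \<in> borel_measurable borel"
    and A_borel [measurable]: "A \<in> borel_measurable borel"
    and g_borel [measurable]: "\<And>i. g i \<in> borel_measurable borel"
    and f_L2: "\<And>K. compact K \<Longrightarrow> K \<subseteq> \<Omega> \<Longrightarrow> integrable lborel (\<lambda>z. (indicator K z * f z)\<^sup>2)"
    and A_L2: "integrable lborel (\<lambda>z. (norm (A z))\<^sup>2)"
    and g_L2: "\<And>K i. compact K \<Longrightarrow> K \<subseteq> \<Omega> \<Longrightarrow> integrable lborel (\<lambda>z. (indicator K z * g i z)\<^sup>2)"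
    and grad_eq: "\<And>\<phi> i. \<phi> \<in> test_functions \<Omega> \<Longrightarrow>
      (\<integral>z. pderiv_vec i \<phi> z * f z \<partial>lborel) = - (\<integral>z. \<phi> z * g i z \<partial>lborel)"
    and weak_eq: "\<And>\<phi>. \<phi> \<in> test_functions \<Omega> \<Longrightarrow>
      (\<integral>z. f z * (lap \<phi> z - A z \<bullet> grad \<phi> z) \<partial>lborel) = 0"
begin

definition vanishes :: "real^2 \<Rightarrow> bool" where
  "vanishes a \<longleftrightarrow> (\<forall>m::nat. \<exists>C\<ge>0. \<exists>r>0. AE z in lborel. norm (z - a) < r \<longrightarrow> \<bar>f z\<bar> \<le> C * norm (z - a) ^ m)"

lemma test_functionsI:
  assumes "\<And>k. C_k_on k UNIV \<phi>" "compact K" "K \<subseteq> \<Omega>" "\<And>z. z \<notin> K \<Longrightarrow> \<phi> z = 0"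
  shows "\<phi> \<in> test_functions \<Omega>"
  using closure_subset_compact[of K \<phi>] assms
  unfolding test_functions_def by (auto simp: C_k_on_UNIV)

lemma integrable_indicator_square:
  fixes K :: "(real^2) set"
  assumes "compact K"
  shows "integrable lborel (\<lambda>z. (indicator K z :: real)\<^sup>2)"
proof -
  have "integrable lborel (indicator K :: real^2 \<Rightarrow> real)"
    using assms emeasure_bounded_finite[OF compact_imp_bounded[OF assms]]
    by (intro integrable_real_indicator) (auto simp: borel_compact)
  moreover have "(\<lambda>z. (indicator K z :: real)\<^sup>2) = indicator K" by (auto simp: indicator_def fun_eq_iff)
  ultimately show ?thesis by simp
qed

text \<open>Near \<open>a\<close> the quotient is bounded because \<open>f\<close> vanishes to order
  \<open>m\<close>; at distance at least \<open>r\<close> from \<open>a\<close> the weight is at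
  most \<open>1 / r^m\<close> and \<open>f\<close> is square integrable on \<open>K\<close>.\<close>

lemma integrable_f_weight:
  assumes "vanishes a" "compact K" "K \<subseteq> \<Omega>"
  shows "integrable lborel (\<lambda>z. (indicator K z * (f z / norm (z - a) ^ m))\<^sup>2)"
proof -
  have [measurable]: "K \<in> sets borel" using assms by (simp add: borel_compact)
  obtain C r where C: "C \<ge> 0" "r > 0" "AE z in lborel. norm (z - a) < r \<longrightarrow> \<bar>f z\<bar> \<le> C * norm (z - a) ^ m"
    using assms(1) unfolding vanishes_def by blast
  show ?thesis
  proof (rule Bochner_Integration.integrable_bound)
    show "integrable lborel (\<lambda>z. C\<^sup>2 * (indicator K z)\<^sup>2 + (1 / r ^ m)\<^sup>2 * (indicator K z * f z)\<^sup>2)"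
      using integrable_indicator_square[OF assms(2)] f_L2[OF assms(2,3)] by auto
    show "AE z in lborel. norm ((indicator K z * (f z / norm (z - a) ^ m))\<^sup>2)
       \<le> norm (C\<^sup>2 * (indicator K z)\<^sup>2 + (1 / r ^ m)\<^sup>2 * (indicator K z * f z)\<^sup>2)"
      using C(3)
    proof eventually_elim
      case (elim z)
      have "(f z / norm (z - a) ^ m)\<^sup>2 \<le> C\<^sup>2 + (1 / r ^ m)\<^sup>2 * (f z)\<^sup>2"
      proof (cases "norm (z - a) < r")
        case True
        have "\<bar>f z / norm (z - a) ^ m\<bar> \<le> \<bar>C\<bar>"
          using elim True C(1) by (cases "norm (z - a) ^ m = 0") (auto simp: abs_divide field_simps)
        then have "(f z / norm (z - a) ^ m)\<^sup>2 \<le> C\<^sup>2" by (simp only: abs_le_square_iff)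
        then show ?thesis by (simp add: add_increasing2)
      next
        case False
        have "norm (z - a) > 0" using False C(2) by linarith
        then have "1 / norm (z - a) ^ m \<le> 1 / r ^ m" using False C(2) by (intro divide_left_mono power_mono) auto
        then have "\<bar>f z\<bar> * (1 / norm (z - a) ^ m) \<le> \<bar>f z\<bar> * (1 / r ^ m)" by (rule mult_left_mono) simp
        then have "\<bar>f z / norm (z - a) ^ m\<bar> \<le> \<bar>f z * (1 / r ^ m)\<bar>" using C(2) by (simp add: abs_mult abs_divide)
        then have "(f z / norm (z - a) ^ m)\<^sup>2 \<le> (f z * (1 / r ^ m))\<^sup>2" by (simp only: abs_le_square_iff)
        also have "(f z * (1 / r ^ m))\<^sup>2 = (1 / r ^ m)\<^sup>2 * (f z)\<^sup>2" by (simp only: power_mult_distrib mult.commute)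
        finally show ?thesis by (simp add: add_increasing)
      qed
      then show ?case by (auto simp: indicator_def)
    qed
  qed measurable
qed

text \<open>The factor \<open>1 + |A|\<close> collects the terms with the Laplacian and with
  \<open>A\<close> of a test function; both summands are square integrable on
  \<open>K\<close>.\<close>

lemma integrable_weighted_products:
  assumes "vanishes a" "compact K" "K \<subseteq> \<Omega>"
  shows "integrable lborel (\<lambda>z. indicator K z * (\<bar>f z\<bar> / norm (z - a) ^ m) * (1 + norm (A z)))"
proof -
  have [measurable]: "K \<in> sets borel" using assms by (simp add: borel_compact)
  have f2: "integrable lborel (\<lambda>z. (indicator K z * (\<bar>f z\<bar> / norm (z - a) ^ m))\<^sup>2)"
    using integrable_f_weight[OF assms, of m] by (simp add: power_mult_distrib power_divide)
  have 1: "integrable lborel (\<lambda>z. indicator K z * (\<bar>f z\<bar> / norm (z - a) ^ m) * indicator K z)"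
    by (rule integrable_mult_square[OF _ _ f2 integrable_indicator_square[OF assms(2)]]) measurable
  have 2: "integrable lborel (\<lambda>z. indicator K z * (\<bar>f z\<bar> / norm (z - a) ^ m) * norm (A z))"
    by (rule integrable_mult_square[OF _ _ f2 A_L2]) measurable
  show ?thesis
    by (rule Bochner_Integration.integrable_cong[THEN iffD1, OF refl _ Bochner_Integration.integrable_add[OF 1 2]])
       (auto simp: indicator_def distrib_left)
qed

text \<open>Vanishing of infinite order makes test functions with a pole at \<open>a\<close> admissible.\<close>

proposition singular_test_function:
  assumes a: "a \<in> \<Omega>" and van: "vanishes a"
    and smooth: "\<And>k. C_k_on k (- {a}) \<phi>"
    and K: "compact K" "K \<subseteq> \<Omega>" "\<And>z. z \<notin> K \<Longrightarrow> \<phi> z = 0"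
    and r0: "r0 > 0" and C0: "C0 \<ge> 0"
    and b: "\<And>z. 0 < norm (z - a) \<Longrightarrow> norm (z - a) < r0 \<Longrightarrow> \<bar>\<phi> z\<bar> \<le> C0 / norm (z - a) ^ M"
     "\<And>z. 0 < norm (z - a) \<Longrightarrow> norm (z - a) < r0 \<Longrightarrow> norm (grad \<phi> z) \<le> C0 / norm (z - a) ^ M"
     "\<And>z. 0 < norm (z - a) \<Longrightarrow> norm (z - a) < r0 \<Longrightarrow> \<bar>lap \<phi> z\<bar> \<le> C0 / norm (z - a) ^ M"
  shows "integrable lborel (\<lambda>z. f z * (lap \<phi> z - A z \<bullet> grad \<phi> z))"
    and "(\<integral>z. f z * (lap \<phi> z - A z \<bullet> grad \<phi> z) \<partial>lborel) = 0"
proof -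
  have oa: "open (- {a})" by (simp add: open_Compl)
  have [measurable]: "K \<in> sets borel" using K by (simp add: borel_compact)
  have out: "grad \<phi> z = 0" "lap \<phi> z = 0" if "z \<notin> K" for z
    using grad_lap_const[of "- K" z \<phi> 0] K that by (auto simp: open_Compl compact_imp_closed)
  obtain D where D: "D \<ge> 1" "\<And>z. z \<in> K \<Longrightarrow> norm (z - a) \<le> D"
  proof -
    have "continuous_on K (\<lambda>z. z - a)" by (intro continuous_intros)
    then obtain D where "\<And>z. z \<in> K \<Longrightarrow> norm (z - a) \<le> D"
      using compact_continuous_bound[OF K(1)] by blast
    then show thesis by (intro that[of "max D 1"]) (auto simp: le_max_iff_disj)
  qed
  \<comment> \<open>The bounds of order \<open>M\<close> near \<open>a\<close> extend to the whole
    plane: on the part of \<open>K\<close> away from \<open>a\<close> continuity gives a bound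
    \<open>B\<close>, and \<open>|z - a| \<le> D\<close> converts it into one of the same
    form.\<close>
  have glob: "\<exists>C\<ge>0. \<forall>z. z \<noteq> a \<longrightarrow> norm (h z) \<le> C / norm (z - a) ^ M"
    if h1: "continuous_on (- {a}) h" and h2: "\<And>z. z \<notin> K \<Longrightarrow> h z = 0"
      and h3: "\<And>z. 0 < norm (z - a) \<Longrightarrow> norm (z - a) < r0 \<Longrightarrow> norm (h z) \<le> C0 / norm (z - a) ^ M" for h :: "real^2 \<Rightarrow> 'b::real_normed_vector"
  proof -
    have "continuous_on (K - ball a r0) h" using h1 r0 by (auto intro: continuous_on_subset)
    with compact_diff[OF K(1) open_ball] obtain B
      where B: "B \<ge> 0" "\<And>z. z \<in> K - ball a r0 \<Longrightarrow> norm (h z) \<le> B"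
      by (rule compact_continuous_bound) blast
    have "norm (h z) \<le> (C0 + B * D ^ M) / norm (z - a) ^ M" if z: "z \<noteq> a" for z
    proof -
      consider "z \<notin> K" | "z \<in> K" "norm (z - a) < r0" | "z \<in> K" "norm (z - a) \<ge> r0" by linarith
      then show ?thesis
      proof cases
        case 1
        then show ?thesis using h2[OF 1] C0 B D by simp
      next
        case 2
        have "norm (h z) \<le> C0 / norm (z - a) ^ M" using 2 z by (intro h3) auto
        also have "\<dots> \<le> (C0 + B * D ^ M) / norm (z - a) ^ M" using B D by (intro divide_right_mono) auto
        finally show ?thesis .
      next
        case 3
        have "norm (h z) \<le> B" using 3 by (intro B) (auto simp: dist_norm norm_minus_commute)
        also have "B * norm (z - a) ^ M \<le> B * D ^ M" using B D(2)[OF 3(1)] by (intro mult_left_mono power_mono) auto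
        then have "B \<le> B * D ^ M / norm (z - a) ^ M" using z by (simp add: field_simps)
        also have "\<dots> \<le> (C0 + B * D ^ M) / norm (z - a) ^ M" using C0 by (intro divide_right_mono) auto
        finally show ?thesis .
      qed
    qed
    then show ?thesis using B C0 D by (intro exI[of _ "C0 + B * D ^ M"]) auto
  qed
  obtain C1 where C1: "C1 \<ge> 0" "\<And>z. z \<noteq> a \<Longrightarrow> norm (\<phi> z) \<le> C1 / norm (z - a) ^ M"
    using glob[of \<phi>] smooth[of 0] K b by auto
  obtain C2 where C2: "C2 \<ge> 0" "\<And>z. z \<noteq> a \<Longrightarrow> norm (grad \<phi> z) \<le> C2 / norm (z - a) ^ M"
    using glob[of "grad \<phi>"] continuous_on_grad[OF smooth] out b by auto
  obtain C3 where C3: "C3 \<ge> 0" "\<And>z. z \<noteq> a \<Longrightarrow> norm (lap \<phi> z) \<le> C3 / norm (z - a) ^ M"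
    using glob[of "lap \<phi>"] continuous_on_lap[OF smooth] out b by auto
  define C where "C = C1 + C2 + C3"
  have C: "C \<ge> 0" using C1 C2 C3 by (simp add: C_def)
  have mono: "C' / norm (z - a) ^ M \<le> C / norm (z - a) ^ M" if "C' \<le> C" for C' z
    using that by (intro divide_right_mono) auto
  have Cb: "\<bar>\<phi> z\<bar> \<le> C / norm (z - a) ^ M" "norm (grad \<phi> z) \<le> C / norm (z - a) ^ M" "\<bar>lap \<phi> z\<bar> \<le> C / norm (z - a) ^ M"
    if "z \<noteq> a" for z
    using C1(2)[OF that] C2(2)[OF that] C3(2)[OF that] mono[of C1 z] mono[of C2 z] mono[of C3 z] C1(1) C2(1) C3(1)
    by (auto simp: C_def)
  \<comment> \<open>For \<open>n > 0\<close> this vanishes near \<open>a\<close>, so the pole is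
    removed and the product is an admissible test function.\<close>
  define \<phi>n where "\<phi>n n z = punct_cutoff n a z * \<phi> z" for n z
  \<comment> \<open>The dominating function. The exponent \<open>M + 2\<close> accounts for the two
    powers of \<open>|z - a|\<close> lost to the Laplacian of the cutoff, \<open>D^2\<close> absorbs
    lower powers, and 300 exceeds the sum \<open>1 + 2 * 6 + 252\<close> of the bounds in the
    product rule.\<close>
  define w where "w z = 300 * C * D\<^sup>2 * (indicator K z * (\<bar>f z\<bar> / norm (z - a) ^ (M + 2)) * (1 + norm (A z)))" for z
  have wi: "integrable lborel w"
    unfolding w_def[abs_def] by (intro Bochner_Integration.integrable_mult_right integrable_weighted_products[OF van K(1,2)])
  have test: "\<phi>n n \<in> test_functions \<Omega>" if n: "n > 0" for n
  proof (rule test_functionsI[OF _ K(1,2)])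
    fix k
    have "C_k_on k (- {a}) (\<phi>n n)"
      unfolding \<phi>n_def[abs_def] by (intro C_k_on_mult oa smooth C_k_on_subset[OF C_k_on_punct_cutoff]) auto
    moreover have "C_k_on k (ball a (1 / real n)) (\<phi>n n)"
    proof (rule C_k_on_cong[OF open_ball _ C_k_on_const[OF open_ball, of k a "1 / real n" 0]])
      fix z assume "z \<in> ball a (1 / real n)"
      then have "norm (z - a) \<le> 1 / real n" by (simp add: dist_norm norm_minus_commute)
      then have "real n * norm (z - a) \<le> 1" using n by (simp add: field_simps)
      then have "(real n * norm (z - a))\<^sup>2 \<le> 1\<^sup>2" by (intro power_mono) auto
      then show "0 = \<phi>n n z" by (simp add: \<phi>n_def punct_cutoff_eq_0 sqd_def power_mult_distrib)
    qed
    ultimately have "C_k_on k (- {a} \<union> ball a (1 / real n)) (\<phi>n n)"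
      by (intro C_k_on_Un oa) auto
    moreover have "- {a} \<union> ball a (1 / real n) = UNIV" using n by auto
    ultimately show "C_k_on k UNIV (\<phi>n n)" by simp
  qed (use K in \<open>auto simp: \<phi>n_def\<close>)
  have exp: "lap (\<phi>n n) z = punct_cutoff n a z * lap \<phi> z + 2 * (grad (punct_cutoff n a) z \<bullet> grad \<phi> z) + lap (punct_cutoff n a) z * \<phi> z"
    "grad (\<phi>n n) z = punct_cutoff n a z *\<^sub>R grad \<phi> z + \<phi> z *\<^sub>R grad (punct_cutoff n a) z" if "z \<noteq> a" for n z
  proof -
    show "lap (\<phi>n n) z = punct_cutoff n a z * lap \<phi> z + 2 * (grad (punct_cutoff n a) z \<bullet> grad \<phi> z) + lap (punct_cutoff n a) z * \<phi> z"
      unfolding \<phi>n_def[abs_def] using that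
      by (intro lap_mult[OF oa] smooth C_k_on_subset[OF C_k_on_punct_cutoff]) auto
    show "grad (\<phi>n n) z = punct_cutoff n a z *\<^sub>R grad \<phi> z + \<phi> z *\<^sub>R grad (punct_cutoff n a) z"
      unfolding \<phi>n_def[abs_def]
      using that C_k_on_differentiable[OF C_k_on_punct_cutoff[of "Suc 0"]] C_k_on_differentiable[OF smooth[of "Suc 0"]]
      by (intro grad_mult) auto
  qed
  define I where "I z = f z * (lap \<phi> z - A z \<bullet> grad \<phi> z)" for z
  define In where "In n z = f z * (lap (\<phi>n n) z - A z \<bullet> grad (\<phi>n n) z)" for n z
  have nea: "AE z in lborel. z \<noteq> a" by (rule AE_lborel_singleton)
  have bound: "\<bar>In n z\<bar> \<le> w z" if z: "z \<noteq> a" for n z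
  proof (cases "z \<in> K")
    case False
    have "\<phi> z = 0" using K(3)[OF False] .
    then show ?thesis using out[OF False] False by (simp add: In_def exp[OF z] w_def)
  next
    case True
    define \<rho> where "\<rho> = norm (z - a)"
    have \<rho>: "\<rho> > 0" "\<rho> \<le> D" using z D(2)[OF True] by (auto simp: \<rho>_def)
    define X where "X = C / \<rho> ^ (M + 2)"
    have X: "X \<ge> 0" using C \<rho> by (simp add: X_def)
    have e2: "C / \<rho> ^ M = X * \<rho>\<^sup>2" using \<rho> by (simp add: X_def power_add power2_eq_square)
    have th: "\<rho> * norm (grad (punct_cutoff n a) z) \<le> 6" "\<rho>\<^sup>2 * \<bar>lap (punct_cutoff n a) z\<bar> \<le> 252" "\<bar>punct_cutoff n a z\<bar> \<le> 1"
      using punct_cutoff_derivative_bounds[of z a n] punct_cutoff_bounds[of n a z] by (auto simp: \<rho>_def)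
    note ph = Cb[OF z, folded \<rho>_def, unfolded e2]
    have D2: "\<rho> * \<rho> \<le> D\<^sup>2" "\<rho> \<le> D\<^sup>2" "1 \<le> D\<^sup>2"
    proof -
      show "\<rho> * \<rho> \<le> D\<^sup>2" using \<rho> by (simp add: power2_eq_square mult_mono)
      have "D * 1 \<le> D * D" using D(1) by (intro mult_left_mono) auto
      then show "\<rho> \<le> D\<^sup>2" using \<rho> unfolding power2_eq_square by linarith
      show "1 \<le> D\<^sup>2" using D(1) by simp
    qed
    have XD: "X * (\<rho> * \<rho>) \<le> X * D\<^sup>2" "X * \<rho> \<le> X * D\<^sup>2" "X * 1 \<le> X * D\<^sup>2"
      using mult_left_mono[OF D2(1) X] mult_left_mono[OF D2(2) X] mult_left_mono[OF D2(3) X] by auto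
    have gn: "norm (grad (punct_cutoff n a) z) * norm (grad \<phi> z) \<le> 6 * (X * D\<^sup>2)"
    proof -
      have "norm (grad (punct_cutoff n a) z) * norm (grad \<phi> z) \<le> norm (grad (punct_cutoff n a) z) * (X * \<rho>\<^sup>2)"
        using ph(2) by (rule mult_left_mono) simp
      also have "\<dots> = (X * \<rho>) * (\<rho> * norm (grad (punct_cutoff n a) z))" by (simp add: power2_eq_square)
      also have "\<dots> \<le> (X * \<rho>) * 6" using th X \<rho> by (intro mult_left_mono) auto
      finally show ?thesis using XD by simp
    qed
    have pn: "\<bar>\<phi> z\<bar> * norm (grad (punct_cutoff n a) z) \<le> 6 * (X * D\<^sup>2)"
    proof -
      have "\<bar>\<phi> z\<bar> * norm (grad (punct_cutoff n a) z) \<le> (X * \<rho>\<^sup>2) * norm (grad (punct_cutoff n a) z)"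
        using ph(1) by (rule mult_right_mono) simp
      also have "\<dots> = (X * \<rho>) * (\<rho> * norm (grad (punct_cutoff n a) z))" by (simp add: power2_eq_square)
      also have "\<dots> \<le> (X * \<rho>) * 6" using th X \<rho> by (intro mult_left_mono) auto
      finally show ?thesis using XD by simp
    qed
    have ln: "\<bar>lap (punct_cutoff n a) z\<bar> * \<bar>\<phi> z\<bar> \<le> 252 * (X * D\<^sup>2)"
    proof -
      have "\<bar>lap (punct_cutoff n a) z\<bar> * \<bar>\<phi> z\<bar> \<le> \<bar>lap (punct_cutoff n a) z\<bar> * (X * \<rho>\<^sup>2)"
        using ph(1) by (rule mult_left_mono) simp
      also have "\<dots> = X * (\<rho>\<^sup>2 * \<bar>lap (punct_cutoff n a) z\<bar>)" by simp
      also have "\<dots> \<le> X * 252" using th X by (intro mult_left_mono) auto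
      finally show ?thesis using XD by simp
    qed
    have l1: "\<bar>punct_cutoff n a z * lap \<phi> z\<bar> \<le> X * D\<^sup>2"
    proof -
      have "\<bar>punct_cutoff n a z * lap \<phi> z\<bar> \<le> 1 * \<bar>lap \<phi> z\<bar>" unfolding abs_mult using th by (intro mult_right_mono) auto
      then show ?thesis using ph(3) XD by (simp add: power2_eq_square)
    qed
    have g1: "\<bar>punct_cutoff n a z\<bar> * norm (grad \<phi> z) \<le> X * D\<^sup>2"
    proof -
      have "\<bar>punct_cutoff n a z\<bar> * norm (grad \<phi> z) \<le> 1 * norm (grad \<phi> z)" using th by (intro mult_right_mono) auto
      then show ?thesis using ph(2) XD by (simp add: power2_eq_square)
    qed
    have L: "\<bar>lap (\<phi>n n) z\<bar> \<le> 300 * (X * D\<^sup>2)"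
    proof -
      have "\<bar>grad (punct_cutoff n a) z \<bullet> grad \<phi> z\<bar> \<le> 6 * (X * D\<^sup>2)"
        using Cauchy_Schwarz_ineq2[of "grad (punct_cutoff n a) z" "grad \<phi> z"] gn by linarith
      moreover have "\<bar>lap (punct_cutoff n a) z * \<phi> z\<bar> \<le> 252 * (X * D\<^sup>2)" using ln by (simp add: abs_mult)
      moreover have "0 \<le> X * D\<^sup>2" using X by simp
      ultimately show ?thesis using l1 unfolding exp[OF z] by linarith
    qed
    have G: "norm (grad (\<phi>n n) z) \<le> 300 * (X * D\<^sup>2)"
    proof -
      have "norm (grad (\<phi>n n) z) \<le> \<bar>punct_cutoff n a z\<bar> * norm (grad \<phi> z) + \<bar>\<phi> z\<bar> * norm (grad (punct_cutoff n a) z)"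
        unfolding exp[OF z] by (rule norm_triangle_le) simp
      moreover have "0 \<le> X * D\<^sup>2" using X by simp
      ultimately show ?thesis using g1 pn by linarith
    qed
    have "\<bar>lap (\<phi>n n) z - A z \<bullet> grad (\<phi>n n) z\<bar> \<le> 300 * (X * D\<^sup>2) + norm (A z) * (300 * (X * D\<^sup>2))"
    proof -
      have "\<bar>A z \<bullet> grad (\<phi>n n) z\<bar> \<le> norm (A z) * norm (grad (\<phi>n n) z)" by (rule Cauchy_Schwarz_ineq2)
      also have "\<dots> \<le> norm (A z) * (300 * (X * D\<^sup>2))" using G by (rule mult_left_mono) simp
      finally show ?thesis using L by linarith
    qed
    then have "\<bar>In n z\<bar> \<le> \<bar>f z\<bar> * (300 * (X * D\<^sup>2) + norm (A z) * (300 * (X * D\<^sup>2)))"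
      unfolding In_def abs_mult by (rule mult_left_mono) simp
    also have "\<dots> = w z" using True by (simp add: w_def X_def \<rho>_def algebra_simps add_divide_distrib)
    finally show ?thesis .
  qed
  have lim: "(\<lambda>n. In n z) \<longlonglongrightarrow> I z" if z: "z \<noteq> a" for z
  proof -
    note t = punct_cutoff_limits[OF z]
    have "(\<lambda>n. In n z) \<longlonglongrightarrow> f z * ((1 * lap \<phi> z + 2 * (0 \<bullet> grad \<phi> z) + 0 * \<phi> z) - A z \<bullet> (1 *\<^sub>R grad \<phi> z + \<phi> z *\<^sub>R 0))"
      unfolding In_def exp[OF z] by (intro tendsto_intros t)
    then show ?thesis by (simp add: I_def)
  qed
  have mlap: "lap \<psi> \<in> borel_measurable borel" and mgrad: "grad \<psi> \<in> borel_measurable borel"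
    if "C_k_on 2 (- {a}) \<psi>" for \<psi>
  proof -
    have "C_k_on 1 (- {a}) \<psi>" using that C_k_on_SucD[of 1] by (simp only: numeral_2_eq_2 One_nat_def)
    then have "continuous_on (- {a}) (grad \<psi>)" "continuous_on (- {a}) (lap \<psi>)"
      using that continuous_on_grad continuous_on_lap by auto
    then show "lap \<psi> \<in> borel_measurable borel" "grad \<psi> \<in> borel_measurable borel"
      by (auto intro!: borel_measurable_continuous_countable_exceptions[of "{a}"])
  qed
  have [measurable]: "I \<in> borel_measurable borel"
    using mlap[OF smooth] mgrad[OF smooth] unfolding I_def[abs_def] by measurable
  have Cn: "C_k_on 2 (- {a}) (\<phi>n n)" for n
    unfolding \<phi>n_def[abs_def] by (intro C_k_on_mult oa smooth C_k_on_subset[OF C_k_on_punct_cutoff]) auto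
  have [measurable]: "In n \<in> borel_measurable borel" for n
    using mlap[OF Cn] mgrad[OF Cn] unfolding In_def[abs_def] by measurable
  have a1: "AE z in lborel. (\<lambda>n. In n z) \<longlonglongrightarrow> I z" using nea by eventually_elim (rule lim)
  have a2: "AE z in lborel. norm (In n z) \<le> w z" for n using nea by eventually_elim (simp add: bound)
  have "integrable lborel I" by (rule integrable_dominated_convergence[OF _ _ wi a1 a2]) auto
  then show "integrable lborel (\<lambda>z. f z * (lap \<phi> z - A z \<bullet> grad \<phi> z))" by (simp add: I_def[abs_def])
  have "(\<lambda>n. \<integral>z. In n z \<partial>lborel) \<longlonglongrightarrow> (\<integral>z. I z \<partial>lborel)"
    by (rule integral_dominated_convergence[OF _ _ wi a1 a2]) auto
  moreover have "(\<lambda>n. \<integral>z. In n z \<partial>lborel) \<longlonglongrightarrow> 0"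
  proof (rule tendsto_eventually)
    show "\<forall>\<^sub>F n in sequentially. (\<integral>z. In n z \<partial>lborel) = 0"
      using eventually_gt_at_top[of 0] by eventually_elim (simp add: In_def weak_eq[OF test])
  qed
  ultimately show "(\<integral>z. f z * (lap \<phi> z - A z \<bullet> grad \<phi> z) \<partial>lborel) = 0"
    unfolding I_def by (rule LIMSEQ_unique)
qed

end

section \<open>Sobolev embedding\<close>

text \<open>Mollified bounds pass to point values along the subsequence of the approximate identity.
  The error \<open>\<delta>\<close> is chosen after \<open>x\<close>, so no uniformity in
  \<open>x\<close> is demanded.\<close>

lemma bump_bound_AE:
  fixes F :: "real^2 \<Rightarrow> real"
  assumes F: "integrable lborel F"
    and b: "AE x in lborel. P x \<longrightarrow> (\<exists>\<delta>. \<delta> \<longlonglongrightarrow> 0 \<and>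
       (\<forall>n. ennreal \<bar>\<integral>z. F z * bump (1 / real (Suc n)) (z - x) \<partial>lborel\<bar> \<le> H x + \<delta> n))"
  shows "AE x in lborel. P x \<longrightarrow> ennreal (bump_mass * \<bar>F x\<bar>) \<le> H x"
proof -
  obtain r :: "nat \<Rightarrow> nat" where r: "strict_mono r"
    "AE x in lborel. (\<lambda>n. \<integral>z. F z * bump (1 / real (Suc (r n))) (z - x) \<partial>lborel) \<longlonglongrightarrow> bump_mass * F x"
    using bump_approximate_identity[OF F, of "\<lambda>n. 1 / real (Suc n)"] LIMSEQ_Suc[OF lim_1_over_n] by auto
  show ?thesis using r(2) b
  proof eventually_elim
    case (elim x)
    show ?case
    proof
      assume "P x"
      with elim(2) obtain \<delta> where d: "\<delta> \<longlonglongrightarrow> 0"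
        "\<And>n. ennreal \<bar>\<integral>z. F z * bump (1 / real (Suc n)) (z - x) \<partial>lborel\<bar> \<le> H x + \<delta> n" by blast
      have "(\<lambda>n. ennreal \<bar>\<integral>z. F z * bump (1 / real (Suc (r n))) (z - x) \<partial>lborel\<bar>) \<longlonglongrightarrow> ennreal \<bar>bump_mass * F x\<bar>"
        using elim(1) by (intro tendsto_ennrealI tendsto_rabs)
      moreover have "(\<lambda>n. H x + \<delta> (r n)) \<longlonglongrightarrow> H x + 0"
        using LIMSEQ_subseq_LIMSEQ[OF d(1) r(1)] by (intro tendsto_add tendsto_const) (simp add: comp_def)
      ultimately have "ennreal \<bar>bump_mass * F x\<bar> \<le> H x + 0"
        by (rule LIMSEQ_le) (use d(2) in auto)
      then show "ennreal (bump_mass * \<bar>F x\<bar>) \<le> H x" using bump_mass_pos by (simp add: abs_mult)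
    qed
  qed
qed

text \<open>The denominator \<open>|z - x|^2 + e^2\<close> is at least \<open>|z - x|^2\<close>. At
  \<open>z = x\<close> both sides are 0, the right one by the convention
  \<open>1 / 0 = 0\<close>.\<close>

lemma norm_grad_logpot_le:
  assumes "z \<in> logdom e x"
  shows "norm (grad (logpot e x) z) \<le> 1 / norm (z - x)"
proof (cases "z = x")
  case False
  have "norm (z - x) * norm (z - x) \<le> sqd x z + e\<^sup>2" by (simp add: sqd_def power2_eq_square)
  then have "norm (z - x) / (sqd x z + e\<^sup>2) \<le> 1 / norm (z - x)"
    using False logdom_pos[OF assms] by (simp add: field_simps)
  then show ?thesis using logdom_pos[OF assms] by (simp add: grad_logpot[OF assms])
next
  case True
  then show ?thesis using grad_logpot[OF assms] by simp
qed

context weak_eq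
begin

lemma integrable_compact_support_mult:
  fixes K :: "(real^2) set"
  assumes K: "compact K" and h: "continuous_on UNIV h" "\<And>z. z \<notin> K \<Longrightarrow> h z = (0::real)"
    and [measurable]: "F \<in> borel_measurable borel" and F: "integrable lborel (\<lambda>z. (indicator K z * F z)\<^sup>2)"
  shows "integrable lborel (\<lambda>z. h z * F z)"
proof -
  have [measurable]: "K \<in> sets borel" using K by (simp add: borel_compact)
  have [measurable]: "h \<in> borel_measurable borel" using h by (simp add: borel_measurable_continuous_onI)
  obtain B where B: "B \<ge> 0" "\<And>z. z \<in> K \<Longrightarrow> norm (h z) \<le> B"
    using compact_continuous_bound[OF K continuous_on_subset[OF h(1) subset_UNIV]] by metis
  have i: "integrable lborel (\<lambda>z. indicator K z * (indicator K z * F z))"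
    by (rule integrable_mult_square[OF _ _ integrable_indicator_square[OF K] F]) measurable
  show ?thesis
  proof (rule Bochner_Integration.integrable_bound)
    show "integrable lborel (\<lambda>z. B * (indicator K z * (indicator K z * F z)))" using i by (rule integrable_mult_right)
    show "AE z in lborel. norm (h z * F z) \<le> norm (B * (indicator K z * (indicator K z * F z)))"
    proof (rule AE_I2)
      fix z
      show "norm (h z * F z) \<le> norm (B * (indicator K z * (indicator K z * F z)))"
        using B h(2)[of z] by (cases "z \<in> K") (auto simp: abs_mult intro!: mult_right_mono)
    qed
  qed measurable
qed

text \<open>Integrating by parts against the gradient of the mollified logarithm bounds
  \<open>\<eta> f\<close> by a constant times the potential of \<open>u\<close>, which combines the
  weak gradient with \<open>|f|\<close> where the cutoff varies. As \<open>u\<close> is in L^2 with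
  support in \<open>K\<close>, its potential is in weak L^4. The statement is qualitative:
  \<open>q\<close> only starts the absorption argument.\<close>

proposition sobolev_weak4:
  assumes R: "R > 0" and sub: "cball a (3 * R) \<subseteq> \<Omega>"
  shows "\<exists>q. weak4 (\<lambda>z. ennreal \<bar>f z\<bar> * indicator (ball a (2 * R)) z) q"
proof -
  obtain \<eta> B where \<eta>: "\<And>k. C_k_on k UNIV \<eta>" "\<And>z. 0 \<le> \<eta> z" "\<And>z. \<eta> z \<le> 1"
    "\<And>z. norm (z - a) \<le> 2 * R \<Longrightarrow> \<eta> z = 1" "\<And>z. norm (z - a) \<ge> 3 * R \<Longrightarrow> \<eta> z = 0"
    "\<And>z. norm (z - a) < 2 * R \<or> norm (z - a) > 3 * R \<Longrightarrow> grad \<eta> z = 0 \<and> lap \<eta> z = 0"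
    and B: "B \<ge> 0" "\<And>z. norm (grad \<eta> z) \<le> B" "\<And>z. \<bar>lap \<eta> z\<bar> \<le> B"
    using cutoff_exists[OF R, of a] by metis
  define K where "K = cball a (3 * R)"
  have K: "compact K" "K \<subseteq> \<Omega>" using sub by (auto simp: K_def)
  have [measurable]: "K \<in> sets borel" using K by (simp add: borel_compact)
  have outK: "\<eta> z = 0" "grad \<eta> z = 0" if "z \<notin> K" for z
    using that \<eta>(5)[of z] \<eta>(6)[of z] by (auto simp: K_def dist_norm norm_minus_commute)
  have cont\<eta>: "continuous_on UNIV \<eta>" using \<eta>(1)[of 0] by simp
  define u where "u z = indicator K z * (B * \<bar>f z\<bar> + (\<Sum>i\<in>UNIV. \<bar>g i z\<bar>))" for z
  have u_nonneg: "0 \<le> u z" for z using B by (simp add: u_def sum_nonneg)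
  have [measurable]: "u \<in> borel_measurable borel" unfolding u_def[abs_def] by measurable
  define F where "F z = \<eta> z * f z" for z
  have Fi: "integrable lborel F"
    unfolding F_def using outK by (intro integrable_compact_support_mult[OF K(1) cont\<eta>] f_L2 K) auto
  have main: "ennreal \<bar>\<integral>z. F z * bump e (z - x) \<partial>lborel\<bar> \<le> riesz (\<lambda>z. ennreal (u z)) x" if e: "e > 0" for e x
  proof -
    have dom: "logdom e x = UNIV" using e by (simp add: logdom_def)
    have \<Phi>: "C_k_on k UNIV (logpot e x)" for k using C_k_on_logpot[of k e x] by (simp add: dom)
    have \<Phi>i: "C_k_on k UNIV (pderiv_vec i (logpot e x))" for k i
      using \<Phi>[of "Suc k"] by (rule C_k_on_pderiv_vec)
    \<comment> \<open>The components of \<open>\<eta>\<close> times the gradient of the potential: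
      their divergence is \<open>\<eta>\<close> times \<open>bump\<close> plus a term containing the
      gradient of \<open>\<eta>\<close>.\<close>
    define \<phi> where "\<phi> i z = \<eta> z * pderiv_vec i (logpot e x) z" for i z
    have C\<phi>: "C_k_on k UNIV (\<phi> i)" for k i
      unfolding \<phi>_def[abs_def] by (intro C_k_on_mult open_UNIV \<eta>(1) \<Phi>i)
    have \<phi>0: "\<phi> i z = 0" if "z \<notin> K" for i z using outK[OF that] by (simp add: \<phi>_def)
    have test: "\<phi> i \<in> test_functions \<Omega>" for i
      using K \<phi>0 C\<phi> by (intro test_functionsI[of _ K]) auto
    have p: "pderiv_vec i (\<phi> i) z = \<eta> z * pderiv_vec i (pderiv_vec i (logpot e x)) z + pderiv_vec i \<eta> z * pderiv_vec i (logpot e x) z" for i z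
      unfolding \<phi>_def[abs_def]
      by (intro pderiv_vec_mult C_k_on_differentiable[OF \<eta>(1)] C_k_on_differentiable[OF \<Phi>i]) auto
    have ps: "(\<Sum>i\<in>UNIV. pderiv_vec i (\<phi> i) z) = \<eta> z * bump e (z - x) + grad \<eta> z \<bullet> grad (logpot e x) z" for z
      using lap_logpot[of z e x] dom
      by (simp add: p sum.distrib sum_distrib_left[symmetric] lap_def inner_vec_def)
    have pi: "integrable lborel (\<lambda>z. pderiv_vec i (\<phi> i) z * f z)" for i
    proof (rule integrable_compact_support_mult[OF K(1)])
      show "continuous_on UNIV (pderiv_vec i (\<phi> i))" using C_k_on_pderiv_vec[OF C\<phi>[of "Suc 0"]] by simp
      show "pderiv_vec i (\<phi> i) z = 0" if "z \<notin> K" for z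
        using outK[OF that] unfolding p by (metis grad_component mult_zero_left add_0 zero_index)
    qed (use f_L2[OF K] in auto)
    have gi: "integrable lborel (\<lambda>z. \<phi> i z * g i z)" for i
      using C\<phi>[of 0] \<phi>0 g_L2[OF K] by (intro integrable_compact_support_mult[OF K(1)]) auto
    have di: "integrable lborel (\<lambda>z. (grad \<eta> z \<bullet> grad (logpot e x) z) * f z)"
    proof (rule integrable_compact_support_mult[OF K(1)])
      show "continuous_on UNIV (\<lambda>z. grad \<eta> z \<bullet> grad (logpot e x) z)"
        by (intro continuous_on_inner continuous_on_grad \<eta> \<Phi>)
    qed (use outK f_L2[OF K] in auto)
    have bi: "integrable lborel (\<lambda>z. F z * bump e (z - x))"
    proof -
      have "integrable lborel (\<lambda>z. (\<Sum>i\<in>UNIV. pderiv_vec i (\<phi> i) z * f z) - (grad \<eta> z \<bullet> grad (logpot e x) z) * f z)"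
        using pi di by (intro Bochner_Integration.integrable_diff Bochner_Integration.integrable_sum) auto
      moreover have "(\<Sum>i\<in>UNIV. pderiv_vec i (\<phi> i) z * f z) - (grad \<eta> z \<bullet> grad (logpot e x) z) * f z
          = F z * bump e (z - x)" for z
        unfolding sum_distrib_right[symmetric] ps F_def by (simp add: distrib_right)
      ultimately show ?thesis by simp
    qed
    have "(\<integral>z. F z * bump e (z - x) \<partial>lborel) + (\<integral>z. (grad \<eta> z \<bullet> grad (logpot e x) z) * f z \<partial>lborel)
        = (\<integral>z. F z * bump e (z - x) + (grad \<eta> z \<bullet> grad (logpot e x) z) * f z \<partial>lborel)"
      using bi di by simp
    also have "\<dots> = (\<integral>z. (\<Sum>i\<in>UNIV. pderiv_vec i (\<phi> i) z * f z) \<partial>lborel)"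
      unfolding sum_distrib_right[symmetric] ps F_def
      by (intro Bochner_Integration.integral_cong refl) (simp add: distrib_right)
    also have "\<dots> = (\<Sum>i\<in>UNIV. \<integral>z. pderiv_vec i (\<phi> i) z * f z \<partial>lborel)"
      using pi by (intro Bochner_Integration.integral_sum) auto
    also have "\<dots> = - (\<Sum>i\<in>UNIV. \<integral>z. \<phi> i z * g i z \<partial>lborel)"
      by (simp add: grad_eq[OF test] sum_negf)
    also have "(\<Sum>i\<in>UNIV. \<integral>z. \<phi> i z * g i z \<partial>lborel) = (\<integral>z. (\<Sum>i\<in>UNIV. \<phi> i z * g i z) \<partial>lborel)"
      using gi by (intro Bochner_Integration.integral_sum[symmetric]) auto
    finally have "(\<integral>z. F z * bump e (z - x) \<partial>lborel)
      = - ((\<integral>z. (\<Sum>i\<in>UNIV. \<phi> i z * g i z) \<partial>lborel) + (\<integral>z. (grad \<eta> z \<bullet> grad (logpot e x) z) * f z \<partial>lborel))" by simp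
    also have "\<dots> = - (\<integral>z. (\<Sum>i\<in>UNIV. \<phi> i z * g i z) + (grad \<eta> z \<bullet> grad (logpot e x) z) * f z \<partial>lborel)"
      using gi di by (subst Bochner_Integration.integral_add) (auto intro!: Bochner_Integration.integrable_sum)
    finally have eq: "\<bar>\<integral>z. F z * bump e (z - x) \<partial>lborel\<bar>
      = norm (\<integral>z. (\<Sum>i\<in>UNIV. \<phi> i z * g i z) + (grad \<eta> z \<bullet> grad (logpot e x) z) * f z \<partial>lborel)" by simp
    have "ennreal \<bar>\<integral>z. F z * bump e (z - x) \<partial>lborel\<bar>
       \<le> (\<integral>\<^sup>+z. ennreal (norm ((\<Sum>i\<in>UNIV. \<phi> i z * g i z) + (grad \<eta> z \<bullet> grad (logpot e x) z) * f z)) \<partial>lborel)"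
      unfolding eq using gi di
      by (intro integral_norm_bound_ennreal Bochner_Integration.integrable_add Bochner_Integration.integrable_sum) auto
    also have "\<dots> \<le> (\<integral>\<^sup>+z. ennreal (u z) * ennreal (1 / norm (x - z)) \<partial>lborel)"
    proof (rule nn_integral_mono)
      fix z
      define k where "k = 1 / norm (x - z)"
      have k: "k \<ge> 0" "norm (grad (logpot e x) z) \<le> k"
        using norm_grad_logpot_le[of z e x] dom by (auto simp: k_def norm_minus_commute)
      have "norm ((\<Sum>i\<in>UNIV. \<phi> i z * g i z) + (grad \<eta> z \<bullet> grad (logpot e x) z) * f z) \<le> u z * k"
      proof (cases "z \<in> K")
        case False
        then show ?thesis using \<phi>0[OF False] outK[OF False] by (simp add: u_def)
      next
        case True
        have "\<bar>\<phi> i z * g i z\<bar> \<le> \<bar>g i z\<bar> * k" for i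
        proof -
          have "\<bar>\<phi> i z\<bar> \<le> 1 * \<bar>pderiv_vec i (logpot e x) z\<bar>"
            unfolding \<phi>_def abs_mult using \<eta>(2,3)[of z] by (intro mult_right_mono) auto
          also have "\<dots> \<le> k" using component_le_norm_cart[of "grad (logpot e x) z" i] k by simp
          finally have "\<bar>g i z\<bar> * \<bar>\<phi> i z\<bar> \<le> \<bar>g i z\<bar> * k" by (rule mult_left_mono) simp
          then show ?thesis by (simp add: abs_mult mult.commute)
        qed
        then have 1: "\<bar>\<Sum>i\<in>UNIV. \<phi> i z * g i z\<bar> \<le> (\<Sum>i\<in>UNIV. \<bar>g i z\<bar> * k)"
          by (intro order_trans[OF sum_abs] sum_mono) auto
        have "\<bar>grad \<eta> z \<bullet> grad (logpot e x) z\<bar> \<le> B * k"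
          using B k by (intro order_trans[OF Cauchy_Schwarz_ineq2] mult_mono) auto
        then have "\<bar>(grad \<eta> z \<bullet> grad (logpot e x) z) * f z\<bar> \<le> B * k * \<bar>f z\<bar>"
          unfolding abs_mult by (rule mult_right_mono) simp
        with 1[folded sum_distrib_right] have "norm ((\<Sum>i\<in>UNIV. \<phi> i z * g i z) + (grad \<eta> z \<bullet> grad (logpot e x) z) * f z)
            \<le> (\<Sum>i\<in>UNIV. \<bar>g i z\<bar>) * k + B * k * \<bar>f z\<bar>" by simp
        then show ?thesis using True by (simp add: u_def algebra_simps)
      qed
      then show "ennreal (norm ((\<Sum>i\<in>UNIV. \<phi> i z * g i z) + (grad \<eta> z \<bullet> grad (logpot e x) z) * f z))
        \<le> ennreal (u z) * ennreal (1 / norm (x - z))"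
        using u_nonneg[of z] k by (fold k_def) (simp add: ennreal_mult'[symmetric] ennreal_leI)
    qed
    finally show ?thesis by (simp add: riesz_def)
  qed
  have "AE x in lborel. True \<longrightarrow> ennreal (bump_mass * \<bar>F x\<bar>) \<le> riesz (\<lambda>z. ennreal (u z)) x"
  proof (rule bump_bound_AE[OF Fi], rule AE_I2, intro impI exI[of _ "\<lambda>n. 0"] conjI allI)
    fix x and n :: nat
    show "ennreal \<bar>\<integral>z. F z * bump (1 / real (Suc n)) (z - x) \<partial>lborel\<bar> \<le> riesz (\<lambda>z. ennreal (u z)) x + 0"
      using main[of "1 / real (Suc n)" x] by simp
  qed simp
  then have AE: "AE x in lborel. ennreal (bump_mass * \<bar>F x\<bar>) \<le> riesz (\<lambda>z. ennreal (u z)) x" by simp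
  have u2: "integrable lborel (\<lambda>z. (u z)\<^sup>2)"
  proof (rule Bochner_Integration.integrable_bound)
    show "integrable lborel (\<lambda>z. 3 * (B\<^sup>2 * (indicator K z * f z)\<^sup>2 + (indicator K z * g 1 z)\<^sup>2 + (indicator K z * g 2 z)\<^sup>2))"
      using f_L2[OF K] g_L2[OF K] by (intro Bochner_Integration.integrable_add integrable_mult_right)
    show "AE z in lborel. norm ((u z)\<^sup>2) \<le> norm (3 * (B\<^sup>2 * (indicator K z * f z)\<^sup>2 + (indicator K z * g 1 z)\<^sup>2 + (indicator K z * g 2 z)\<^sup>2))"
    proof (rule AE_I2)
      fix z
      have sq: "(p + q + r)\<^sup>2 \<le> 3 * (p\<^sup>2 + q\<^sup>2 + r\<^sup>2)" for p q r :: real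
      proof -
        have "0 \<le> (p - q)\<^sup>2 + (q - r)\<^sup>2 + (p - r)\<^sup>2" by simp
        then show ?thesis by (simp add: power2_eq_square algebra_simps)
      qed
      have "(u z)\<^sup>2 \<le> 3 * (B\<^sup>2 * (indicator K z * f z)\<^sup>2 + (indicator K z * g 1 z)\<^sup>2 + (indicator K z * g 2 z)\<^sup>2)"
        using sq[of "B * \<bar>f z\<bar>" "\<bar>g 1 z\<bar>" "\<bar>g 2 z\<bar>"]
        by (auto simp: u_def indicator_def sum_2 power_mult_distrib add.assoc)
      then show "norm ((u z)\<^sup>2) \<le> norm (3 * (B\<^sup>2 * (indicator K z * f z)\<^sup>2 + (indicator K z * g 1 z)\<^sup>2 + (indicator K z * g 2 z)\<^sup>2))"
        by simp
    qed
  qed measurable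
  define Q where "Q = (\<integral>z. (u z)\<^sup>2 \<partial>lborel)"
  have "(\<integral>\<^sup>+z. (ennreal (u z))\<^sup>2 \<partial>lborel) = ennreal Q"
    unfolding Q_def using u2 u_nonneg by (subst nn_integral_eq_integral[symmetric]) (auto simp: ennreal_power)
  moreover have "Q \<ge> 0" unfolding Q_def by (intro integral_nonneg_AE) auto
  moreover obtain k where k: "emeasure lborel K = ennreal k" "k \<ge> 0"
    using emeasure_bounded_finite[OF compact_imp_bounded[OF K(1)]] by (cases "emeasure lborel K") auto
  \<comment> \<open>Here the square integrable factor is \<open>u\<close>, and the weak L^4 factor
    is just the indicator of its support.\<close>
  ultimately have "weak4 (riesz (\<lambda>x. ennreal (u x) * indicator K x)) (16 * riesz_const^4 * Q\<^sup>2 * k)"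
    by (intro weak4_riesz_mult weak4_indicator) auto
  moreover have "(\<lambda>x. ennreal (u x) * indicator K x) = (\<lambda>z. ennreal (u z))"
    by (auto simp: u_def indicator_def fun_eq_iff)
  ultimately have "weak4 (riesz (\<lambda>z. ennreal (u z))) (16 * riesz_const^4 * Q\<^sup>2 * k)" by simp
  then have weak: "weak4 (\<lambda>x. ennreal (1 / bump_mass) * riesz (\<lambda>z. ennreal (u z)) x) ((1 / bump_mass)^4 * (16 * riesz_const^4 * Q\<^sup>2 * k))"
    using bump_mass_pos by (intro weak4_cmult) auto
  have [measurable]: "ball a (2 * R) \<in> sets borel" by simp
  have "weak4 (\<lambda>z. ennreal \<bar>f z\<bar> * indicator (ball a (2 * R)) z) ((1 / bump_mass)^4 * (16 * riesz_const^4 * Q\<^sup>2 * k))"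
  proof (rule weak4_mono[OF weak])
    show "(\<lambda>z. ennreal \<bar>f z\<bar> * indicator (ball a (2 * R)) z) \<in> borel_measurable borel" by measurable
    show "AE x in lborel. ennreal \<bar>f x\<bar> * indicator (ball a (2 * R)) x \<le> ennreal (1 / bump_mass) * riesz (\<lambda>z. ennreal (u z)) x"
      using AE
    proof eventually_elim
      case (elim x)
      show ?case
      proof (cases "x \<in> ball a (2 * R)")
        case True
        then have "F x = f x" using \<eta>(4)[of x] by (simp add: F_def dist_norm norm_minus_commute)
        then have "ennreal (1 / bump_mass) * ennreal (bump_mass * \<bar>f x\<bar>) \<le> ennreal (1 / bump_mass) * riesz (\<lambda>z. ennreal (u z)) x"
          using elim by (intro mult_left_mono) auto
        then show ?thesis using True bump_mass_pos by (simp add: ennreal_mult[symmetric])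
      qed simp
    qed
  qed auto
  then show ?thesis by blast
qed

end

section \<open>A Carleman inequality\<close>

text \<open>By symmetry the integral over \<open>E\<close> of the potential is the integral of
  \<open>u\<close> against the bounded potential of \<open>1_E\<close>. It supplies the majorant for
  removing the mollification at almost every \<open>x\<close>.\<close>

lemma riesz_finite_AE:
  assumes [measurable]: "u \<in> borel_measurable borel" and u: "(\<integral>\<^sup>+x. u x \<partial>lborel) < \<infinity>"
    and E [measurable]: "E \<in> sets borel" and e: "emeasure lborel E = ennreal e" "e > 0"
  shows "AE x in lborel. x \<in> E \<longrightarrow> riesz u x < \<infinity>"
proof -
  have "(\<integral>\<^sup>+x. indicator E x * riesz u x \<partial>lborel) = (\<integral>\<^sup>+x. u x * riesz (indicator E) x \<partial>lborel)"
    by (rule riesz_symmetric) auto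
  also have "\<dots> \<le> (\<integral>\<^sup>+x. u x * ennreal (riesz_const * sqrt e) \<partial>lborel)"
    using riesz_indicator_le[OF E e] by (intro nn_integral_mono mult_left_mono) auto
  also have "\<dots> < \<infinity>" using u by (simp add: nn_integral_multc ennreal_mult_less_top)
  finally have "AE x in lborel. indicator E x * riesz u x \<noteq> \<infinity>"
    by (intro nn_integral_PInf_AE) auto
  then show ?thesis by eventually_elim (auto simp: less_top)
qed

lemma norm_grad_logpot_diff:
  assumes "z \<noteq> x" "e > 0"
  shows "norm (grad (logpot e x) z - grad (logpot 0 x) z) = e\<^sup>2 / ((sqd x z + e\<^sup>2) * norm (z - x))"
proof -
  define t where "t = norm (z - x)"
  have t: "t > 0" using assms by (simp add: t_def)
  have te: "t\<^sup>2 + e\<^sup>2 > 0" using t by (simp add: add_pos_nonneg)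
  have "grad (logpot e x) z - grad (logpot 0 x) z = (1 / (t\<^sup>2 + e\<^sup>2) - 1 / t\<^sup>2) *\<^sub>R (z - x)"
    using assms by (simp add: grad_logpot logdom_def sqd_def t_def scaleR_diff_left)
  also have "1 / (t\<^sup>2 + e\<^sup>2) - 1 / t\<^sup>2 = - (e\<^sup>2 / ((t\<^sup>2 + e\<^sup>2) * t\<^sup>2))"
    using t te by (simp add: field_simps)
  finally have "norm (grad (logpot e x) z - grad (logpot 0 x) z) = e\<^sup>2 / ((t\<^sup>2 + e\<^sup>2) * t\<^sup>2) * t"
    using te by (simp add: t_def)
  also have "\<dots> = e\<^sup>2 / ((t\<^sup>2 + e\<^sup>2) * t)" using t by (simp add: power2_eq_square)
  finally show ?thesis by (simp add: sqd_def t_def)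
qed

lemma logpot_diff_le:
  assumes "z \<noteq> x" "e > 0"
  shows "\<bar>logpot e x z - logpot 0 x z\<bar> \<le> e\<^sup>2 / (2 * (norm (z - x))\<^sup>2)"
proof -
  define s where "s = sqd x z"
  have s: "s > 0" using assms by (simp add: s_def sqd_def)
  have "ln (s + e\<^sup>2) - ln s = ln (1 + e\<^sup>2 / s)"
  proof -
    have "ln ((s + e\<^sup>2) / s) = ln (s + e\<^sup>2) - ln s" 
      using s add_pos_nonneg[OF s zero_le_power2[of e]] by (simp add: ln_div)
    moreover have "(s + e\<^sup>2) / s = 1 + e\<^sup>2 / s" using s by (simp add: field_simps)
    ultimately show ?thesis by simp
  qed
  moreover have "0 \<le> ln (1 + e\<^sup>2 / s)" using s by simp
  moreover have "ln (1 + e\<^sup>2 / s) \<le> e\<^sup>2 / s" using s by (intro ln_add_one_self_le_self) auto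
  ultimately have "\<bar>logpot e x z - logpot 0 x z\<bar> \<le> (e\<^sup>2 / s) / 2"
    by (simp add: logpot_def s_def[symmetric] diff_divide_distrib[symmetric])
  then show ?thesis by (simp add: s_def sqd_def mult.commute)
qed

context weak_eq
begin

text \<open>Test with the cutoff times the difference of the mollified logarithm at \<open>x\<close>
  and its Taylor polynomial. Its Laplacian evaluates \<open>f\<close> near \<open>x\<close>, the
  term with \<open>A\<close> gives the weighted potential, and the terms with derivatives of the
  cutoff live where \<open>|z - a| \<ge> 2 * R\<close> and gain \<open>R^(-N)\<close>. Every term
  carries the factor \<open>|x - a|^N\<close>, apart from errors that vanish with \<open>e\<close>.
  \<open>M0\<close> is chosen before \<open>N\<close>: it consists of the cutoff constants and an
  unweighted integral of \<open>f\<close>.\<close>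

proposition carleman_inequality:
  assumes van: "vanishes a" and R: "R > 0" and sub: "cball a (3 * R) \<subseteq> \<Omega>"
  shows "\<exists>M0\<ge>0. \<forall>N>0. AE x in lborel. norm (x - a) < R \<longrightarrow>
     ennreal (bump_mass * \<bar>f x\<bar>) \<le> ennreal (norm (x - a) ^ N) *
       (riesz (\<lambda>z. ennreal (norm (A z)) * (ennreal (\<bar>f z\<bar> / norm (z - a) ^ N) * indicator (cball a (3 * R)) z)) x
         + ennreal (M0 / R ^ N))"
proof -
  obtain \<eta> B where \<eta>: "\<And>k. C_k_on k UNIV \<eta>" "\<And>z. 0 \<le> \<eta> z" "\<And>z. \<eta> z \<le> 1"
    "\<And>z. norm (z - a) \<le> 2 * R \<Longrightarrow> \<eta> z = 1" "\<And>z. norm (z - a) \<ge> 3 * R \<Longrightarrow> \<eta> z = 0"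
    "\<And>z. norm (z - a) < 2 * R \<or> norm (z - a) > 3 * R \<Longrightarrow> grad \<eta> z = 0 \<and> lap \<eta> z = 0"
    and B: "B \<ge> 0" "\<And>z. norm (grad \<eta> z) \<le> B" "\<And>z. \<bar>lap \<eta> z\<bar> \<le> B"
    using cutoff_exists[OF R, of a] by metis
  define K where "K = cball a (3 * R)"
  have K: "compact K" "K \<subseteq> \<Omega>" using sub by (auto simp: K_def)
  have [measurable]: "K \<in> sets borel" using K by (simp add: borel_compact)
  have aO: "a \<in> \<Omega>" using sub R by auto
  have oa: "open (- {a})" by (simp add: open_Compl)
  have outK: "\<eta> z = 0" "grad \<eta> z = 0" "lap \<eta> z = 0" if "z \<notin> K" for z
    using that \<eta>(5)[of z] \<eta>(6)[of z] by (auto simp: K_def dist_norm norm_minus_commute)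
  define F where "F z = \<eta> z * f z" for z
  have Fi: "integrable lborel F"
    unfolding F_def using outK \<eta>(1)[of 0] by (intro integrable_compact_support_mult[OF K(1)] f_L2 K) auto
  define fA where "fA z = indicator K z * \<bar>f z\<bar> * (1 + norm (A z))" for z
  have fAi: "integrable lborel fA"
    unfolding fA_def[abs_def] using integrable_weighted_products[OF van K, of 0] by simp
  have [measurable]: "fA \<in> borel_measurable borel" unfolding fA_def[abs_def] by measurable
  have fA_nonneg: "0 \<le> fA z" for z by (simp add: fA_def)
  define J where "J = (\<integral>z. fA z \<partial>lborel)"
  have J: "J \<ge> 0" unfolding J_def using fA_nonneg by (intro integral_nonneg_AE) auto
  have Jn: "(\<integral>\<^sup>+z. ennreal (fA z) \<partial>lborel) = ennreal J"
    unfolding J_def using fAi fA_nonneg by (intro nn_integral_eq_integral) auto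
  \<comment> \<open>Taken from the annulus, where \<open>Q / R + e^2 / R^3\<close> bounds the
    gradient of \<open>\<kappa>\<close> and \<open>2 * Q + e^2 / (2 * R^2)\<close> bounds
    \<open>\<kappa>\<close>: \<open>M1\<close> collects the coefficients of
    \<open>Q = |x - a|^N / R^N\<close>, \<open>E1\<close> those of \<open>e^2\<close>.\<close>
  define M1 where "M1 = B * (2 / R + 2)"
  define E1 where "E1 = B * (2 / R^3 + 1 / (2 * R\<^sup>2))"
  have M1: "M1 \<ge> 0" and E1: "E1 \<ge> 0" using B R by (auto simp: M1_def E1_def)
  \<comment> \<open>The size of the gradient error caused by mollifying. It stays below the kernel
    \<open>1 / |z - x|\<close> and tends to 0 with \<open>e\<close> off \<open>x\<close>, ready for
    dominated convergence.\<close>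
  define d where "d e x z = e\<^sup>2 / ((sqd x z + e\<^sup>2) * norm (z - x))" for e :: real and x z :: "real^2"
  have [measurable]: "(\<lambda>z. d e x z) \<in> borel_measurable borel" for e x unfolding d_def sqd_def by measurable
  have d_nonneg: "0 \<le> d e x z" for e x z by (simp add: d_def sqd_def)
  have d_le: "d e x z \<le> 1 / norm (z - x)" for e x z
  proof (cases "z = x")
    case False
    then have "sqd x z + e\<^sup>2 > 0" by (simp add: sqd_def add_pos_nonneg)
    then show ?thesis using False by (simp add: d_def sqd_def divide_simps)
  qed (simp add: d_def)
  define U where "U N z = ennreal (norm (A z)) * (ennreal (\<bar>f z\<bar> / norm (z - a) ^ N) * indicator K z)" for N z
  have [measurable]: "U N \<in> borel_measurable borel" for N unfolding U_def[abs_def] by measurable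
  \<comment> \<open>The inequality for fixed \<open>e\<close>; the last bracket is the mollification
    error, which vanishes in the limit.\<close>
  have main: "ennreal \<bar>\<integral>z. F z * bump e (z - x) \<partial>lborel\<bar> \<le>
      ennreal (norm (x - a) ^ N) * (riesz (U N) x + ennreal (M1 * J / R ^ N))
      + ((\<integral>\<^sup>+z. ennreal (fA z * d e x z) \<partial>lborel) + ennreal (e\<^sup>2 * (E1 * J)))"
    if e: "e > 0" and xa: "x \<noteq> a" "norm (x - a) < R" and N: "N > 0" for e x N
  proof -
    have dom: "logdom e x = UNIV" using e by (simp add: logdom_def)
    have \<Phi>: "C_k_on k UNIV (logpot e x)" for k using C_k_on_logpot[of k e x] by (simp add: dom)
    define \<kappa> where "\<kappa> z = logpot e x z - logpot_taylor N a x z" for z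
    define \<phi> where "\<phi> z = \<eta> z * \<kappa> z" for z
    have \<Phi>a: "C_k_on k (- {a}) (logpot e x)" for k using C_k_on_subset[OF \<Phi>] by auto
    have \<eta>a: "C_k_on k (- {a}) \<eta>" for k using C_k_on_subset[OF \<eta>(1)] by auto
    have C\<kappa>: "C_k_on k (- {a}) \<kappa>" for k
      unfolding \<kappa>_def[abs_def] by (intro C_k_on_diff oa \<Phi>a C_k_on_logpot_taylor)
    have C\<phi>: "C_k_on k (- {a}) \<phi>" for k
      unfolding \<phi>_def[abs_def] by (intro C_k_on_mult oa \<eta>a C\<kappa>)
    have grad\<kappa>: "grad \<kappa> z = grad (logpot e x) z - grad (logpot_taylor N a x) z" if "z \<noteq> a" for z
      unfolding \<kappa>_def[abs_def] using that
      by (intro grad_diff C_k_on_differentiable[OF \<Phi>[of "Suc 0"]] C_k_on_differentiable[OF C_k_on_logpot_taylor[of "Suc 0"]]) auto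
    have lap\<kappa>: "lap \<kappa> z = bump e (z - x)" if "z \<noteq> a" for z
      unfolding \<kappa>_def[abs_def] using that lap_logpot[of z e x] dom
      by (subst lap_diff[OF oa _ \<Phi>a C_k_on_logpot_taylor]) (auto simp: lap_logpot_taylor)
    have grad\<phi>: "grad \<phi> z = \<eta> z *\<^sub>R grad \<kappa> z + \<kappa> z *\<^sub>R grad \<eta> z" if "z \<noteq> a" for z
      unfolding \<phi>_def[abs_def] using that
      by (intro grad_mult C_k_on_differentiable[OF \<eta>(1)[of "Suc 0"]] C_k_on_differentiable[OF C\<kappa>[of "Suc 0"]]) auto
    have lap\<phi>: "lap \<phi> z = \<eta> z * bump e (z - x) + 2 * (grad \<eta> z \<bullet> grad \<kappa> z) + lap \<eta> z * \<kappa> z" if "z \<noteq> a" for z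
      unfolding \<phi>_def[abs_def] using that by (subst lap_mult[OF oa _ \<eta>a C\<kappa>]) (auto simp: lap\<kappa>)
    note cb = compact_continuous_bound[OF compact_cball continuous_on_subset[OF _ subset_UNIV], of _ a 1]
    have "continuous_on UNIV (logpot e x)" using \<Phi>[of 0] by simp
    then obtain c1 where c1: "c1 \<ge> 0" "\<And>z. z \<in> cball a 1 \<Longrightarrow> norm (logpot e x z) \<le> c1"
      by (rule cb) blast
    obtain c2 where c2: "c2 \<ge> 0" "\<And>z. z \<in> cball a 1 \<Longrightarrow> norm (grad (logpot e x) z) \<le> c2"
      by (rule cb[OF continuous_on_grad[OF \<Phi>]]) blast
    obtain c3 where c3: "c3 \<ge> 0" "\<And>z. z \<in> cball a 1 \<Longrightarrow> norm (lap (logpot e x) z) \<le> c3"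
      by (rule cb[OF continuous_on_lap[OF \<Phi>]]) blast
    obtain c4 where c4: "c4 \<ge> 0" "\<And>z. 0 < norm (z - a) \<Longrightarrow> norm (z - a) \<le> 1 \<Longrightarrow> \<bar>logpot_taylor N a x z\<bar> \<le> c4 / norm (z - a) ^ N"
      "\<And>z. 0 < norm (z - a) \<Longrightarrow> norm (z - a) \<le> 1 \<Longrightarrow> norm (grad (logpot_taylor N a x) z) \<le> c4 / norm (z - a) ^ N"
      using logpot_taylor_crude_bounds[OF N, of a x] by metis
    define c where "c = c1 + c2 + c3 + c4"
    have c: "c \<ge> 0" using c1 c2 c3 c4 by (simp add: c_def)
    define r0 where "r0 = min 1 R"
    have near: "\<bar>\<phi> z\<bar> \<le> c / norm (z - a) ^ N" "norm (grad \<phi> z) \<le> c / norm (z - a) ^ N" "\<bar>lap \<phi> z\<bar> \<le> c / norm (z - a) ^ N"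
      if z: "0 < norm (z - a)" "norm (z - a) < r0" for z
    proof -
      have za: "z \<noteq> a" and z1: "norm (z - a) \<le> 1" "z \<in> cball a 1" and z2: "norm (z - a) < 2 * R"
        using z R by (auto simp: r0_def dist_norm norm_minus_commute)
      have e1: "\<eta> z = 1" "grad \<eta> z = 0" "lap \<eta> z = 0" using \<eta>(4)[of z] \<eta>(6)[of z] z2 by auto
      have "1 \<le> 1 / norm (z - a) ^ N" using z z1 by (simp add: divide_simps power_le_one)
      then have up: "C \<le> C / norm (z - a) ^ N" if "C \<ge> 0" for C
        using mult_left_mono[of 1 "1 / norm (z - a) ^ N" C] that by simp
      have "\<bar>\<phi> z\<bar> \<le> c1 / norm (z - a) ^ N + c4 / norm (z - a) ^ N"
        using c1(2)[OF z1(2)] c4(2)[OF z(1) z1(1)] up[OF c1(1)] by (simp add: \<phi>_def \<kappa>_def e1)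
      also have "\<dots> \<le> c / norm (z - a) ^ N"
        unfolding add_divide_distrib[symmetric] using c2 c3 by (intro divide_right_mono) (auto simp: c_def)
      finally show "\<bar>\<phi> z\<bar> \<le> c / norm (z - a) ^ N" .
      have "norm (grad \<phi> z) \<le> norm (grad (logpot e x) z) + norm (grad (logpot_taylor N a x) z)"
        using norm_triangle_ineq4[of "grad (logpot e x) z" "grad (logpot_taylor N a x) z"] by (simp add: grad\<phi>[OF za] e1 grad\<kappa>[OF za])
      also have "\<dots> \<le> c2 / norm (z - a) ^ N + c4 / norm (z - a) ^ N"
        using c2(2)[OF z1(2)] c4(3)[OF z(1) z1(1)] up[OF c2(1)] by linarith
      also have "\<dots> \<le> c / norm (z - a) ^ N"
        unfolding add_divide_distrib[symmetric] using c1 c3 by (intro divide_right_mono) (auto simp: c_def)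
      finally show "norm (grad \<phi> z) \<le> c / norm (z - a) ^ N" .
      have "\<bar>lap \<phi> z\<bar> \<le> c3 / norm (z - a) ^ N"
        using c3(2)[OF z1(2)] up[OF c3(1)] lap_logpot[of z e x] dom by (simp add: lap\<phi>[OF za] e1)
      also have "\<dots> \<le> c / norm (z - a) ^ N"
        using c1 c2 c4 by (intro divide_right_mono) (auto simp: c_def)
      finally show "\<bar>lap \<phi> z\<bar> \<le> c / norm (z - a) ^ N" .
    qed
    have \<phi>0: "\<phi> z = 0" if "z \<notin> K" for z using outK[OF that] by (simp add: \<phi>_def)
    have r0: "r0 > 0" using R by (simp add: r0_def)
    \<comment> \<open>The pole at \<open>a\<close> has order at most \<open>N\<close>, since the
      mollified logarithm is bounded near \<open>a\<close> and only the Taylor polynomial is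
      singular there.\<close>
    note T = singular_test_function[OF aO van C\<phi> K \<phi>0 r0 c near]
    have bi: "integrable lborel (\<lambda>z. F z * bump e (z - x))"
    proof -
      have "integrable lborel (\<lambda>z. (\<eta> z * lap (logpot e x) z) * f z)"
        using \<eta>(1)[of 0] outK f_L2[OF K]
        by (intro integrable_compact_support_mult[OF K(1)] continuous_on_mult continuous_on_lap[OF \<Phi>]) auto
      then show ?thesis using lap_logpot[of _ e x] dom by (simp add: F_def mult_ac)
    qed
    \<comment> \<open>Since \<open>\<phi>\<close> annihilates the equation, integrating
      \<open>F\<close> against \<open>bump\<close> is the same as integrating \<open>G\<close>. In
      \<open>G\<close> the terms with \<open>bump\<close> cancel, leaving \<open>\<kappa>\<close>,
      its gradient and derivatives of the cutoff.\<close>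
    define G where "G z = F z * bump e (z - x) - f z * (lap \<phi> z - A z \<bullet> grad \<phi> z)" for z
    have Gi: "integrable lborel G" unfolding G_def by (intro Bochner_Integration.integrable_diff bi T(1))
    have "(\<integral>z. F z * bump e (z - x) \<partial>lborel) = (\<integral>z. G z \<partial>lborel)"
      unfolding G_def using T bi by (subst Bochner_Integration.integral_diff) auto
    then have "ennreal \<bar>\<integral>z. F z * bump e (z - x) \<partial>lborel\<bar> = ennreal (norm (\<integral>z. G z \<partial>lborel))" by simp
    also have "\<dots> \<le> (\<integral>\<^sup>+z. ennreal (norm (G z)) \<partial>lborel)"
      by (rule integral_norm_bound_ennreal[OF Gi])
    also have "\<dots> \<le> (\<integral>\<^sup>+z. ennreal (norm (x - a) ^ N) * (U N z * ennreal (1 / norm (x - z)))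
        + (ennreal (fA z * d e x z) + ennreal (M1 * (norm (x - a) ^ N / R ^ N) + e\<^sup>2 * E1) * ennreal (fA z)) \<partial>lborel)"
    proof (rule nn_integral_mono_AE)
      have "AE z in lborel. z \<noteq> a" "AE z in lborel. z \<noteq> x" by (rule AE_lborel_singleton)+
      then show "AE z in lborel. ennreal (norm (G z)) \<le> ennreal (norm (x - a) ^ N) * (U N z * ennreal (1 / norm (x - z)))
        + (ennreal (fA z * d e x z) + ennreal (M1 * (norm (x - a) ^ N / R ^ N) + e\<^sup>2 * E1) * ennreal (fA z))"
      proof eventually_elim
        case (elim z)
        define P where "P = norm (x - a) ^ N / norm (z - a) ^ N"
        define Q where "Q = norm (x - a) ^ N / R ^ N"
        define kb where "kb = d e x z + P / norm (z - x)"
        have P: "P \<ge> 0" and Q: "Q \<ge> 0" using R by (auto simp: P_def Q_def)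
        \<comment> \<open>Split through the unmollified logarithm: one difference is the error
          \<open>d\<close>, the other is the exact Taylor remainder.\<close>
        have kb: "norm (grad \<kappa> z) \<le> kb"
        proof -
          have "grad \<kappa> z = (grad (logpot e x) z - grad (logpot 0 x) z) + (grad (logpot 0 x) z - grad (logpot_taylor N a x) z)"
            by (simp add: grad\<kappa>[OF elim(1)])
          also have "norm \<dots> \<le> norm (grad (logpot e x) z - grad (logpot 0 x) z) + norm (grad (logpot 0 x) z - grad (logpot_taylor N a x) z)"
            by (rule norm_triangle_ineq)
          also have "\<dots> = kb"
            unfolding norm_grad_logpot_diff[OF elim(2) e] norm_grad_remainder[OF elim N]
            by (simp add: kb_def d_def P_def)
          finally show ?thesis .
        qed
        have G: "G z = f z * (\<eta> z * (A z \<bullet> grad \<kappa> z) + (\<kappa> z * (A z \<bullet> grad \<eta> z) - 2 * (grad \<eta> z \<bullet> grad \<kappa> z) - lap \<eta> z * \<kappa> z))"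
          unfolding G_def F_def grad\<phi>[OF elim(1)] lap\<phi>[OF elim(1)]
          by (simp add: inner_add_right algebra_simps)
        have bound: "\<bar>G z\<bar> \<le> indicator K z * \<bar>f z\<bar> * (norm (A z) * kb + (1 + norm (A z)) * (M1 * Q + e\<^sup>2 * E1))"
        proof (cases "z \<in> K")
          case False
          then show ?thesis using outK[OF False] by (simp add: G)
        next
          case True
          have 1: "\<bar>\<eta> z * (A z \<bullet> grad \<kappa> z)\<bar> \<le> norm (A z) * kb"
          proof -
            have "\<bar>\<eta> z * (A z \<bullet> grad \<kappa> z)\<bar> \<le> 1 * (norm (A z) * norm (grad \<kappa> z))"
              unfolding abs_mult using \<eta>(2,3)[of z] by (intro mult_mono Cauchy_Schwarz_ineq2) auto
            also have "\<dots> \<le> norm (A z) * kb" using kb by (simp add: mult_left_mono)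
            finally show ?thesis .
          qed
          have 2: "\<bar>\<kappa> z * (A z \<bullet> grad \<eta> z) - 2 * (grad \<eta> z \<bullet> grad \<kappa> z) - lap \<eta> z * \<kappa> z\<bar> \<le> (1 + norm (A z)) * (M1 * Q + e\<^sup>2 * E1)"
          proof (cases "norm (z - a) < 2 * R")
            case True
            then show ?thesis using \<eta>(6)[of z] M1 E1 Q by simp
          next
            case far: False
            \<comment> \<open>Beyond the plateau \<open>|z - a| \<ge> 2 * R\<close> while
              \<open>|x - a| < R\<close>. So \<open>z\<close> keeps distance \<open>R\<close> from
              \<open>x\<close>, and the weight \<open>P\<close> may be replaced by the constant
              \<open>Q\<close>, which produces the decay in \<open>R\<close>.\<close>
            have zx: "norm (z - x) \<ge> R"
              using norm_triangle_ineq2[of "z - a" "x - a"] far xa by simp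
            have za0: "norm (z - a) > 0" using far R by linarith
            have PQ: "P \<le> Q" unfolding P_def Q_def
              using far R za0 by (intro divide_left_mono power_mono mult_pos_pos) auto
            have kbQ: "kb \<le> Q / R + e\<^sup>2 / R^3"
            proof -
              have "R\<^sup>2 \<le> sqd x z + e\<^sup>2" unfolding sqd_def using zx R by (intro add_increasing2 power_mono) auto
              then have "R\<^sup>2 * R \<le> (sqd x z + e\<^sup>2) * norm (z - x)" using zx R by (intro mult_mono) (auto simp: sqd_def)
              then have "d e x z \<le> e\<^sup>2 / R^3"
                unfolding d_def using R zx by (intro divide_left_mono) (auto simp: power2_eq_square power3_eq_cube intro!: mult_pos_pos add_nonneg_pos simp: sqd_def e)
              moreover have "P / norm (z - x) \<le> Q / R" using PQ P zx R by (intro frac_le) auto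
              ultimately show ?thesis by (simp add: kb_def)
            qed
            have \<kappa>b: "\<bar>\<kappa> z\<bar> \<le> 2 * Q + e\<^sup>2 / (2 * R\<^sup>2)"
            proof -
              have "\<bar>logpot e x z - logpot 0 x z\<bar> \<le> e\<^sup>2 / (2 * (norm (z - x))\<^sup>2)" by (rule logpot_diff_le[OF elim(2) e])
              also have "\<dots> \<le> e\<^sup>2 / (2 * R\<^sup>2)"
                using zx R elim by (intro divide_left_mono mult_left_mono power_mono mult_pos_pos) auto
              finally have i: "\<bar>logpot e x z - logpot 0 x z\<bar> \<le> e\<^sup>2 / (2 * R\<^sup>2)" .
              have "\<bar>logpot 0 x z - logpot_taylor N a x z\<bar> \<le> 2 * (norm (x - a) / norm (z - a)) ^ N"
                using far xa by (intro remainder_bound[OF elim(1)]) auto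
              then have "\<bar>logpot 0 x z - logpot_taylor N a x z\<bar> \<le> 2 * Q" using PQ by (simp add: power_divide P_def)
              with i show ?thesis unfolding \<kappa>_def by linarith
            qed
            define k1 where "k1 = Q / R + e\<^sup>2 / R^3"
            define k2 where "k2 = 2 * Q + e\<^sup>2 / (2 * R\<^sup>2)"
            have k1: "k1 \<ge> 0" and k2: "k2 \<ge> 0" using Q R by (auto simp: k1_def k2_def)
            have a1: "\<bar>\<kappa> z * (A z \<bullet> grad \<eta> z)\<bar> \<le> k2 * (norm (A z) * B)"
              unfolding abs_mult k2_def
              using B k2[unfolded k2_def] by (intro mult_mono \<kappa>b order_trans[OF Cauchy_Schwarz_ineq2] mult_left_mono) auto
            have a2: "\<bar>grad \<eta> z \<bullet> grad \<kappa> z\<bar> \<le> B * k1"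
              using B kb kbQ k1 by (intro order_trans[OF Cauchy_Schwarz_ineq2] mult_mono) (auto simp: k1_def)
            have a3: "\<bar>lap \<eta> z * \<kappa> z\<bar> \<le> B * k2"
              unfolding abs_mult k2_def using B k2[unfolded k2_def] by (intro mult_mono \<kappa>b) auto
            have M: "M1 * Q + e\<^sup>2 * E1 = 2 * (B * k1) + B * k2"
              by (simp add: M1_def E1_def k1_def k2_def algebra_simps)
            have "\<bar>\<kappa> z * (A z \<bullet> grad \<eta> z) - 2 * (grad \<eta> z \<bullet> grad \<kappa> z) - lap \<eta> z * \<kappa> z\<bar>
              \<le> norm (A z) * (B * k2) + (2 * (B * k1) + B * k2)"
              using a1 a2 a3 by (simp add: mult_ac)
            also have "norm (A z) * (B * k2) \<le> norm (A z) * (2 * (B * k1) + B * k2)"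
              using B k1 by (intro mult_left_mono) auto
            finally show ?thesis unfolding M by (simp add: distrib_right)
          qed
          have "\<bar>G z\<bar> \<le> \<bar>f z\<bar> * (norm (A z) * kb + (1 + norm (A z)) * (M1 * Q + e\<^sup>2 * E1))"
            unfolding G abs_mult using 1 2 by (intro mult_left_mono) auto
          then show ?thesis using True by simp
        qed
        define Y1 where "Y1 = indicator K z * (norm (A z) * (\<bar>f z\<bar> / norm (z - a) ^ N)) * (1 / norm (x - z))"
        have Y1: "Y1 \<ge> 0" by (simp add: Y1_def)
        have "indicator K z * \<bar>f z\<bar> * (norm (A z) * kb + (1 + norm (A z)) * (M1 * Q + e\<^sup>2 * E1))
          = norm (x - a) ^ N * Y1 + (indicator K z * \<bar>f z\<bar> * norm (A z) * d e x z + (M1 * Q + e\<^sup>2 * E1) * fA z)"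
          by (simp add: kb_def P_def Y1_def fA_def norm_minus_commute algebra_simps)
        also have "\<dots> \<le> norm (x - a) ^ N * Y1 + (fA z * d e x z + (M1 * Q + e\<^sup>2 * E1) * fA z)"
          unfolding fA_def using d_nonneg[of e x z]
          by (intro add_left_mono add_right_mono mult_right_mono) (auto simp: distrib_left indicator_def)
        finally have "norm (G z) \<le> norm (x - a) ^ N * Y1 + (fA z * d e x z + (M1 * Q + e\<^sup>2 * E1) * fA z)"
          using bound by simp
        then have "ennreal (norm (G z)) \<le> ennreal (norm (x - a) ^ N * Y1 + (fA z * d e x z + (M1 * Q + e\<^sup>2 * E1) * fA z))"
          by (rule ennreal_leI)
        also have "\<dots> = ennreal (norm (x - a) ^ N) * ennreal Y1 + (ennreal (fA z * d e x z) + ennreal (M1 * Q + e\<^sup>2 * E1) * ennreal (fA z))"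
          using Y1 M1 E1 Q fA_nonneg[of z] d_nonneg[of e x z] by (simp add: ennreal_plus ennreal_mult)
        also have "ennreal Y1 = U N z * ennreal (1 / norm (x - z))"
          by (simp add: Y1_def U_def indicator_def ennreal_mult[symmetric])
        finally show ?case by (simp add: Q_def)
      qed
    qed
    also have "\<dots> = ennreal (norm (x - a) ^ N) * riesz (U N) x
        + ((\<integral>\<^sup>+z. ennreal (fA z * d e x z) \<partial>lborel) + ennreal (M1 * (norm (x - a) ^ N / R ^ N) + e\<^sup>2 * E1) * ennreal J)"
      by (simp add: nn_integral_add nn_integral_cmult riesz_def Jn)
    also have "ennreal (M1 * (norm (x - a) ^ N / R ^ N) + e\<^sup>2 * E1) * ennreal J
       = ennreal (norm (x - a) ^ N) * ennreal (M1 * J / R ^ N) + ennreal (e\<^sup>2 * (E1 * J))"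
      using M1 E1 J R
      by (subst (1 2) ennreal_mult[symmetric]) (auto simp: algebra_simps simp flip: ennreal_plus)
    finally show ?thesis by (simp add: distrib_left add_ac)
  qed
  define M0 where "M0 = M1 * J"
  have M0: "M0 \<ge> 0" using M1 J by (simp add: M0_def)
  have "AE x in lborel. norm (x - a) < R \<longrightarrow>
     ennreal (bump_mass * \<bar>f x\<bar>) \<le> ennreal (norm (x - a) ^ N) * (riesz (U N) x + ennreal (M0 / R ^ N))" if N: "N > 0" for N
  proof -
    have eb: "emeasure lborel (ball a R) = ennreal (pi * R\<^sup>2)" using R by (simp add: emeasure_plane_ball)
    have "AE x in lborel. x \<in> ball a R \<longrightarrow> riesz (\<lambda>z. ennreal (fA z)) x < \<infinity>"
      by (rule riesz_finite_AE[OF _ _ _ eb]) (use R Jn in auto)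
    moreover have "AE x in lborel. x \<noteq> a" by (rule AE_lborel_singleton)
    ultimately have "AE x in lborel. norm (x - a) < R \<longrightarrow> (\<exists>\<delta>. \<delta> \<longlonglongrightarrow> 0 \<and>
       (\<forall>n. ennreal \<bar>\<integral>z. F z * bump (1 / real (Suc n)) (z - x) \<partial>lborel\<bar>
          \<le> ennreal (norm (x - a) ^ N) * (riesz (U N) x + ennreal (M0 / R ^ N)) + \<delta> n))"
    proof eventually_elim
      case (elim x)
      show ?case
      proof
        assume xR: "norm (x - a) < R"
        then have fin: "riesz (\<lambda>z. ennreal (fA z)) x < \<infinity>" using elim by (simp add: dist_norm norm_minus_commute)
        define e where "e n = 1 / real (Suc n)" for n
        have e0: "e \<longlonglongrightarrow> 0" unfolding e_def by (rule LIMSEQ_Suc[OF lim_1_over_n])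
        \<comment> \<open>At a fixed \<open>x\<close> with finite potential of \<open>fA\<close>,
          that potential dominates the first summand, which therefore tends to 0.\<close>
        define \<delta> where "\<delta> n = (\<integral>\<^sup>+z. ennreal (fA z * d (e n) x z) \<partial>lborel) + ennreal ((e n)\<^sup>2 * (E1 * J))" for n
        have "(\<lambda>n. \<integral>\<^sup>+z. ennreal (fA z * d (e n) x z) \<partial>lborel) \<longlonglongrightarrow> (\<integral>\<^sup>+z. 0 \<partial>(lborel :: (real^2) measure))"
        proof (rule nn_integral_dominated_convergence[where w="\<lambda>z. ennreal (fA z) * ennreal (1 / norm (x - z))"])
          show "(\<integral>\<^sup>+z. ennreal (fA z) * ennreal (1 / norm (x - z)) \<partial>lborel) < \<infinity>" using fin by (simp add: riesz_def)
          show "AE z in lborel. ennreal (fA z * d (e n) x z) \<le> ennreal (fA z) * ennreal (1 / norm (x - z))" for n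
          proof (rule AE_I2)
            fix z
            have "ennreal (fA z * d (e n) x z) \<le> ennreal (fA z * (1 / norm (x - z)))"
              using d_le[of "e n" x z] fA_nonneg[of z]
              by (intro ennreal_leI mult_left_mono) (auto simp: norm_minus_commute)
            then show "ennreal (fA z * d (e n) x z) \<le> ennreal (fA z) * ennreal (1 / norm (x - z))"
              by (simp add: ennreal_mult[symmetric] fA_nonneg)
          qed
          have "AE z in lborel. z \<noteq> x" by (rule AE_lborel_singleton)
          then show "AE z in lborel. (\<lambda>n. ennreal (fA z * d (e n) x z)) \<longlonglongrightarrow> 0"
          proof eventually_elim
            case (elim z)
            have "sqd x z > 0" using elim by (simp add: sqd_def)
            then have "(\<lambda>n. fA z * ((e n)\<^sup>2 / ((sqd x z + (e n)\<^sup>2) * norm (z - x)))) \<longlonglongrightarrow> fA z * (0\<^sup>2 / ((sqd x z + 0\<^sup>2) * norm (z - x)))"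
              using elim by (intro tendsto_intros e0) auto
            then show ?case unfolding d_def by (intro tendsto_ennrealI[where x=0, simplified]) simp
          qed
        qed auto
        moreover have "(\<lambda>n. ennreal ((e n)\<^sup>2 * (E1 * J))) \<longlonglongrightarrow> ennreal (0\<^sup>2 * (E1 * J))"
          by (intro tendsto_ennrealI tendsto_intros e0)
        ultimately have "\<delta> \<longlonglongrightarrow> 0 + 0" unfolding \<delta>_def by (intro tendsto_add) auto
        moreover have "ennreal \<bar>\<integral>z. F z * bump (1 / real (Suc n)) (z - x) \<partial>lborel\<bar>
          \<le> ennreal (norm (x - a) ^ N) * (riesz (U N) x + ennreal (M0 / R ^ N)) + \<delta> n" for n
          using main[of "e n" x N] elim(2) xR N by (simp add: e_def \<delta>_def M0_def)
        ultimately show "\<exists>\<delta>. \<delta> \<longlonglongrightarrow> 0 \<and>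
          (\<forall>n. ennreal \<bar>\<integral>z. F z * bump (1 / real (Suc n)) (z - x) \<partial>lborel\<bar>
            \<le> ennreal (norm (x - a) ^ N) * (riesz (U N) x + ennreal (M0 / R ^ N)) + \<delta> n)" by auto
      qed
    qed
    from bump_bound_AE[OF Fi this] show ?thesis
    proof eventually_elim
      case (elim x)
      then show ?case using \<eta>(4)[of x] R by (auto simp: F_def)
    qed
  qed
  then show ?thesis using M0 unfolding U_def K_def by blast
qed

end

section \<open>Unique continuation for the real equation\<close>

lemma lim_1_over_Suc: "(\<lambda>n. 1 / real (Suc n)) \<longlonglongrightarrow> 0"
  by (rule LIMSEQ_Suc[OF lim_1_over_n])

context weak_eq
begin

text \<open>The smallness condition makes the factor in front of the weak norm of \<open>f / |z - a|\<^sup>N\<close> at most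
  \<open>1/2\<close>, so that it can be absorbed.\<close>

theorem local_unique_continuation:
  assumes van: "vanishes a" and R: "R > 0" and sub: "cball a (5 * R) \<subseteq> \<Omega>"
    and small: "(\<integral>\<^sup>+z. ennreal ((norm (A z))\<^sup>2) * indicator (ball a R) z \<partial>lborel) \<le> ennreal \<kappa>"
    and \<kappa>: "\<kappa> \<ge> 0" "512 * riesz_const^4 * \<kappa>\<^sup>2 \<le> bump_mass^4"
  shows "AE z in lborel. norm (z - a) < R \<longrightarrow> f z = 0"
proof -
  have sub3: "cball a (3 * R) \<subseteq> \<Omega>" using sub R by (auto simp: subset_iff)
  define K where "K = cball a (3 * R)"
  have [measurable]: "K \<in> sets borel" "ball a R \<in> sets borel" by (auto simp: K_def)
  define b where "b z = ennreal (norm (A z))" for z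
  define bB where "bB z = b z * indicator (ball a R) z" for z
  define fK where "fK z = ennreal \<bar>f z\<bar> * indicator K z" for z
  have [measurable]: "b \<in> borel_measurable borel" "bB \<in> borel_measurable borel" "fK \<in> borel_measurable borel"
    unfolding b_def[abs_def] bB_def[abs_def] fK_def[abs_def] by measurable
  obtain qf where qf: "weak4 fK qf"
  proof -
    \<comment> \<open>The factor \<open>8 / 5\<close> fits both sides:
      \<open>3 * 8 / 5 \<le> 5\<close> keeps the cutoff inside the domain, and
      \<open>2 * 8 / 5 > 3\<close> makes the plateau cover \<open>K\<close>.\<close>
    have "cball a (3 * (8 / 5 * R)) \<subseteq> \<Omega>" using sub R by (auto simp: subset_iff)
    then obtain q where q: "weak4 (\<lambda>z. ennreal \<bar>f z\<bar> * indicator (ball a (2 * (8 / 5 * R))) z) q"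
      using sobolev_weak4[of "8 / 5 * R" a] R by auto
    have "weak4 fK q"
      by (rule weak4_mono[OF q]) (use R in \<open>auto simp: fK_def K_def indicator_def intro!: AE_I2\<close>)
    then show thesis by (rule that)
  qed
  obtain M0 where M0: "M0 \<ge> 0" and carl: "\<And>N. N > 0 \<Longrightarrow> AE x in lborel. norm (x - a) < R \<longrightarrow>
     ennreal (bump_mass * \<bar>f x\<bar>) \<le> ennreal (norm (x - a) ^ N) *
       (riesz (\<lambda>z. ennreal (norm (A z)) * (ennreal (\<bar>f z\<bar> / norm (z - a) ^ N) * indicator (cball a (3 * R)) z)) x
         + ennreal (M0 / R ^ N))"
    using carleman_inequality[OF van R sub3] by blast
  define KA where "KA = (\<integral>z. (norm (A z))\<^sup>2 \<partial>lborel)"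
  have KA0: "KA \<ge> 0" unfolding KA_def by (intro integral_nonneg_AE) auto
  have KA: "(\<integral>\<^sup>+z. (b z)\<^sup>2 \<partial>lborel) \<le> ennreal KA"
    unfolding KA_def b_def using A_L2 by (subst nn_integral_eq_integral[symmetric]) (auto simp: ennreal_power)
  have small': "(\<integral>\<^sup>+z. (bB z)\<^sup>2 \<partial>lborel) \<le> ennreal \<kappa>"
  proof -
    have "(bB z)\<^sup>2 = ennreal ((norm (A z))\<^sup>2) * indicator (ball a R) z" for z
      by (simp add: bB_def b_def indicator_def ennreal_power)
    then show ?thesis using small by simp
  qed
  \<comment> \<open>Everything that is not absorbed, up to the factor \<open>1 / R^N\<close>.
    \<open>M0 + 1\<close> instead of \<open>M0\<close> gives the positive factor required by
    \<open>weak4_cmult\<close>.\<close>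
  define Z where "Z x = riesz (\<lambda>z. b z * fK z) x + ennreal (M0 + 1) * indicator (ball a R) x" for x
  obtain \<zeta> where \<zeta>: "weak4 Z \<zeta>"
  proof -
    have "weak4 (indicator (ball a R)) (pi * R\<^sup>2)"
      using R by (intro weak4_indicator) (auto simp: emeasure_plane_ball)
    then have "weak4 (\<lambda>x. ennreal (M0 + 1) * indicator (ball a R) x) ((M0 + 1)^4 * (pi * R\<^sup>2))"
      using M0 by (intro weak4_cmult) auto
    from weak4_add[OF weak4_riesz_mult[OF qf _ KA KA0] this] show thesis
      by (intro that) (auto simp: Z_def[abs_def])
  qed
  have [measurable]: "Z \<in> borel_measurable borel" and \<zeta>0: "\<zeta> \<ge> 0" using \<zeta> by (auto simp: weak4_def)
  define w where "w N z = ennreal (\<bar>f z\<bar> / norm (z - a) ^ N) * indicator (ball a R) z" for N z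
  have [measurable]: "w N \<in> borel_measurable borel" for N unfolding w_def[abs_def] by measurable
  define d where "d N = (1 / bump_mass)^4 * (16 * ((1 / R ^ N)^4 * \<zeta>))" for N
  have d0: "d N \<ge> 0" for N using \<zeta>0 by (simp add: d_def)
  have step: "weak4 (w N) (p / 2 + d N)" if N: "N > 0" and p: "weak4 (w N) p" for N p
  proof -
    have p0: "p \<ge> 0" using p by (simp add: weak4_def)
    define U where "U z = ennreal (norm (A z)) * (ennreal (\<bar>f z\<bar> / norm (z - a) ^ N) * indicator (cball a (3 * R)) z)" for z
    \<comment> \<open>Inside the small ball the weight is kept, so that \<open>w N\<close> reappears
      next to the small \<open>bB\<close>; outside it is at most \<open>1 / R^N\<close>.\<close>
    have U: "riesz U x \<le> riesz (\<lambda>z. bB z * w N z) x + ennreal (1 / R ^ N) * riesz (\<lambda>z. b z * fK z) x" for x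
    proof -
      have "riesz U x \<le> riesz (\<lambda>z. bB z * w N z + ennreal (1 / R ^ N) * (b z * fK z)) x"
      proof (rule riesz_mono_AE, rule AE_I2)
        fix z
        show "U z \<le> bB z * w N z + ennreal (1 / R ^ N) * (b z * fK z)"
        proof (cases "norm (z - a) < R")
          case True
          then have "U z = bB z * w N z"
            using R by (simp add: U_def bB_def w_def b_def dist_norm norm_minus_commute)
          then show ?thesis by simp
        next
          case False
          have "\<bar>f z\<bar> / norm (z - a) ^ N \<le> \<bar>f z\<bar> / R ^ N"
            using False R by (intro divide_left_mono power_mono mult_pos_pos zero_less_power) auto
          then have "ennreal (\<bar>f z\<bar> / norm (z - a) ^ N) \<le> ennreal (1 / R ^ N) * ennreal \<bar>f z\<bar>"
            using R by (simp add: ennreal_mult[symmetric] ennreal_leI)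
          then have "U z \<le> b z * ((ennreal (1 / R ^ N) * ennreal \<bar>f z\<bar>) * indicator K z)"
            unfolding U_def b_def K_def by (intro mult_left_mono mult_right_mono) auto
          also have "\<dots> = ennreal (1 / R ^ N) * (b z * fK z)" by (simp add: fK_def mult_ac)
          finally show ?thesis by (simp add: add_increasing)
        qed
      qed
      also have "\<dots> = riesz (\<lambda>z. bB z * w N z) x + ennreal (1 / R ^ N) * riesz (\<lambda>z. b z * fK z) x"
        by (subst riesz_add, simp, simp, subst riesz_cmult) auto
      finally show ?thesis .
    qed
    define V where "V x = ennreal (1 / bump_mass) * (riesz (\<lambda>z. bB z * w N z) x + ennreal (1 / R ^ N) * Z x)" for x
    have "weak4 V ((1 / bump_mass)^4 * (16 * (16 * riesz_const^4 * \<kappa>\<^sup>2 * p + (1 / R ^ N)^4 * \<zeta>)))"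
      unfolding V_def[abs_def] using R bump_mass_pos
      by (intro weak4_cmult weak4_add weak4_riesz_mult[OF p _ small' \<kappa>(1)] \<zeta>) auto
    then show ?thesis
    proof (rule weak4_mono)
      \<comment> \<open>One factor 16 comes from \<open>weak4_add\<close>, the other from
        \<open>weak4_riesz_mult\<close>; demanding the value \<open>1 / 2\<close> gives the 512 in
        the smallness condition.\<close>
      have "(1 / bump_mass)^4 * (256 * riesz_const^4 * \<kappa>\<^sup>2) \<le> 1 / 2"
        using \<kappa>(2) bump_mass_pos by (simp add: power_divide divide_simps)
      from mult_right_mono[OF this p0]
      show "(1 / bump_mass)^4 * (16 * (16 * riesz_const^4 * \<kappa>\<^sup>2 * p + (1 / R ^ N)^4 * \<zeta>)) \<le> p / 2 + d N"
        by (simp add: d_def distrib_left mult_ac)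
      have "AE x in lborel. x \<noteq> a" by (rule AE_lborel_singleton)
      then show "AE x in lborel. w N x \<le> V x"
        using carl[OF N]
      proof eventually_elim
        case (elim x)
        show ?case
        proof (cases "norm (x - a) < R")
          case True
          define \<rho> where "\<rho> = norm (x - a) ^ N"
          have \<rho>: "\<rho> > 0" using elim(1) by (simp add: \<rho>_def)
          have xB: "x \<in> ball a R" using True by (simp add: dist_norm norm_minus_commute)
          have "ennreal (bump_mass * \<bar>f x\<bar>) \<le> ennreal \<rho> * (riesz U x + ennreal (M0 / R ^ N))"
            using elim(2) True by (simp add: U_def[abs_def] \<rho>_def)
          then have "ennreal (1 / (bump_mass * \<rho>)) * ennreal (bump_mass * \<bar>f x\<bar>)
            \<le> ennreal (1 / (bump_mass * \<rho>)) * (ennreal \<rho> * (riesz U x + ennreal (M0 / R ^ N)))"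
            by (rule mult_left_mono) simp
          also have "\<dots> = ennreal (1 / bump_mass) * (riesz U x + ennreal (M0 / R ^ N))"
            using \<rho> bump_mass_pos by (simp add: mult.assoc[symmetric] ennreal_mult[symmetric])
          also have "\<dots> \<le> V x"
          proof -
            have "ennreal (M0 / R ^ N) \<le> ennreal (1 / R ^ N) * (ennreal (M0 + 1) * indicator (ball a R) x)"
            proof -
              have "ennreal (M0 / R ^ N) \<le> ennreal (1 / R ^ N * (M0 + 1))"
                using R by (intro ennreal_leI) (simp add: divide_right_mono)
              also have "\<dots> = ennreal (1 / R ^ N) * ennreal (M0 + 1)"
                using R M0 by (intro ennreal_mult) auto
              finally show ?thesis using xB by simp
            qed
            then have "riesz U x + ennreal (M0 / R ^ N) \<le> (riesz (\<lambda>z. bB z * w N z) x + ennreal (1 / R ^ N) * riesz (\<lambda>z. b z * fK z) x)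
               + ennreal (1 / R ^ N) * (ennreal (M0 + 1) * indicator (ball a R) x)"
              using U by (intro add_mono) auto
            then show ?thesis unfolding V_def Z_def by (intro mult_left_mono) (auto simp: distrib_left add.assoc)
          qed
          finally have "ennreal (1 / (bump_mass * \<rho>)) * ennreal (bump_mass * \<bar>f x\<bar>) \<le> V x" .
          moreover have "ennreal (1 / (bump_mass * \<rho>)) * ennreal (bump_mass * \<bar>f x\<bar>) = w N x"
            using xB \<rho> bump_mass_pos by (simp add: w_def \<rho>_def ennreal_mult[symmetric])
          ultimately show ?thesis by simp
        next
          case False
          then show ?thesis by (simp add: w_def dist_norm norm_minus_commute)
        qed
      qed
    qed auto
  qed
  \<comment> \<open>The finite starting bound for the absorption: near \<open>a\<close> the quotient
    is bounded by infinite order vanishing, and elsewhere it is at most a multiple of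
    \<open>fK\<close>, which is in weak L^4 by the Sobolev embedding.\<close>
  have initial: "\<exists>p. weak4 (w N) p" for N
  proof -
    obtain C r where C: "C \<ge> 0" "r > 0" "AE z in lborel. norm (z - a) < r \<longrightarrow> \<bar>f z\<bar> \<le> C * norm (z - a) ^ N"
      using van unfolding vanishes_def by blast
    have i: "weak4 (indicator (ball a R)) (pi * R\<^sup>2)"
      using R by (intro weak4_indicator) (auto simp: emeasure_plane_ball)
    have "weak4 (\<lambda>z. ennreal (C + 1) * indicator (ball a R) z + ennreal (1 / r ^ N) * fK z)
      (16 * ((C + 1)^4 * (pi * R\<^sup>2) + (1 / r ^ N)^4 * qf))"
      using C by (intro weak4_add weak4_cmult i qf) auto
    then have "weak4 (w N) (16 * ((C + 1)^4 * (pi * R\<^sup>2) + (1 / r ^ N)^4 * qf))"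
    proof (rule weak4_mono)
      show "AE z in lborel. w N z \<le> ennreal (C + 1) * indicator (ball a R) z + ennreal (1 / r ^ N) * fK z"
        using C(3)
      proof eventually_elim
        case (elim z)
        show ?case
        proof (cases "z \<in> ball a R")
          case True
          then have zK: "z \<in> K" using R by (auto simp: K_def)
          show ?thesis
          proof (cases "norm (z - a) < r")
            case near: True
            have "\<bar>f z\<bar> / norm (z - a) ^ N \<le> C + 1"
              using elim near C(1) by (cases "norm (z - a) ^ N = 0") (auto simp: divide_simps distrib_right add_increasing2)
            then show ?thesis using True by (simp add: w_def ennreal_leI add_increasing2)
          next
            case False
            have "\<bar>f z\<bar> / norm (z - a) ^ N \<le> \<bar>f z\<bar> / r ^ N"
              using False C(2) by (intro divide_left_mono power_mono mult_pos_pos zero_less_power) auto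
            then have "w N z \<le> ennreal (1 / r ^ N) * fK z"
              using True zK C(2) by (simp add: w_def fK_def ennreal_mult[symmetric] ennreal_leI)
            then show ?thesis by (simp add: add_increasing)
          qed
        qed (simp add: w_def)
      qed
    qed auto
    then show ?thesis by blast
  qed
  have final: "weak4 (w N) (2 * d N)" if "N > 0" for N
    using initial[of N] weak4_absorb[OF _ step[OF that] d0] by blast
  define D where "D = (1 / bump_mass)^4 * (32 * \<zeta>)"
  \<comment> \<open>In a smaller ball of radius \<open>s\<close> the condition
    \<open>t < |f z|\<close> forces \<open>w N z > t / s^N\<close>. The bound \<open>2 * d N\<close>
    is of order \<open>R^(- 4 N)\<close>, so the measure is of order \<open>(s / R)^(4 N)\<close>
    and vanishes in the limit.\<close>
  have null: "AE z in lborel. norm (z - a) < s \<longrightarrow> \<not> t < \<bar>f z\<bar>" if s: "0 < s" "s < R" and t: "t > 0" for s t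
  proof -
    define S where "S = {z. norm (z - a) < s \<and> z \<noteq> a \<and> t < \<bar>f z\<bar>}"
    have [measurable]: "S \<in> sets borel" unfolding S_def by measurable
    have le: "emeasure lborel S \<le> ennreal (D / t^4 * ((s / R)^4) ^ N)" if N: "N > 0" for N
    proof -
      have "S \<subseteq> {z. ennreal (t / s ^ N) < w N z}"
      proof
        fix z assume "z \<in> S"
        then have z: "norm (z - a) < s" "0 < norm (z - a)" "t < \<bar>f z\<bar>" by (auto simp: S_def)
        have "t / s ^ N < \<bar>f z\<bar> / norm (z - a) ^ N"
          using z t s by (intro frac_less power_mono) auto
        moreover have "z \<in> ball a R" using z s by (simp add: dist_norm norm_minus_commute)
        ultimately show "z \<in> {z. ennreal (t / s ^ N) < w N z}"
          using t s by (simp add: w_def ennreal_less_iff)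
      qed
      then have "emeasure lborel S \<le> emeasure lborel {z. ennreal (t / s ^ N) < w N z}"
        by (intro emeasure_mono) auto
      also have "\<dots> \<le> ennreal (2 * d N / (t / s ^ N)^4)"
        using final[OF N] t s by (auto simp: weak4_def)
      also have "2 * d N / (t / s ^ N)^4 = D / t^4 * ((s / R)^4) ^ N"
        using t s R by (simp add: d_def D_def power_divide power_mult[symmetric] mult.commute[of N])
      finally show ?thesis .
    qed
    have "(\<lambda>N. ennreal (D / t^4 * ((s / R)^4) ^ N)) \<longlonglongrightarrow> ennreal (D / t^4 * 0)"
      using s R by (intro tendsto_ennrealI tendsto_intros LIMSEQ_realpow_zero) (auto simp: power_less_one_iff)
    then have "emeasure lborel S \<le> ennreal (D / t^4 * 0)"
      by (rule LIMSEQ_le_const) (use le in \<open>auto intro!: exI[of _ 1]\<close>)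
    then have "S \<in> null_sets lborel" by (auto simp: null_sets_def)
    then have "AE z in lborel. z \<notin> S" by (rule AE_not_in)
    moreover have "AE z in lborel. z \<noteq> a" by (rule AE_lborel_singleton)
    ultimately show ?thesis by eventually_elim (auto simp: S_def)
  qed
  \<comment> \<open>Radii increasing to \<open>R\<close> paired with levels decreasing to 0:
    countably many null sets cover all points of the ball where \<open>f\<close> is not
    zero.\<close>
  have "AE z in lborel. \<forall>n::nat. norm (z - a) < R * (real (Suc n) / real (Suc (Suc n))) \<longrightarrow> \<not> 1 / real (Suc n) < \<bar>f z\<bar>"
    unfolding AE_all_countable using R by (intro allI null) (auto simp: divide_simps)
  then show ?thesis
  proof eventually_elim
    case (elim z)
    show ?case
    proof (intro impI, rule ccontr)
      assume z: "norm (z - a) < R" "f z \<noteq> 0"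
      have "(\<lambda>n. R * (real (Suc n) / real (Suc (Suc n)))) \<longlonglongrightarrow> R * 1"
        by (intro tendsto_mult tendsto_const) real_asymp
      then have "eventually (\<lambda>n. norm (z - a) < R * (real (Suc n) / real (Suc (Suc n)))) sequentially"
        using z by (intro order_tendstoD(1)) auto
      moreover have "eventually (\<lambda>n. 1 / real (Suc n) < \<bar>f z\<bar>) sequentially"
        using lim_1_over_Suc z by (intro order_tendstoD(2)[of _ 0]) auto
      ultimately have "eventually (\<lambda>n. False) sequentially" by eventually_elim (use elim in auto)
      then show False by simp
    qed
  qed
qed

section \<open>Propagation through the connected domain\<close>

lemma vanishes_if_zero_near:
  assumes "r > 0" "AE z in lborel. norm (z - a) < r \<longrightarrow> f z = 0"
  shows "vanishes a"
  unfolding vanishes_def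
proof
  fix m :: nat
  show "\<exists>C\<ge>0. \<exists>r>0. AE z in lborel. norm (z - a) < r \<longrightarrow> \<bar>f z\<bar> \<le> C * norm (z - a) ^ m"
    using assms by (intro exI[of _ 0] exI[of _ r] conjI) (auto elim!: eventually_mono)
qed

text \<open>Absolute continuity of the integral: the balls shrink to a null set and
  \<open>|A|^2\<close> dominates.\<close>

lemma small_radius:
  assumes "\<kappa> > 0"
  shows "\<exists>r>0. (\<integral>\<^sup>+z. ennreal ((norm (A z))\<^sup>2) * indicator (ball a r) z \<partial>lborel) \<le> ennreal \<kappa>"
proof -
  have "(\<lambda>n. \<integral>\<^sup>+z. ennreal ((norm (A z))\<^sup>2) * indicator (ball a (1 / real (Suc n))) z \<partial>lborel) \<longlonglongrightarrow> (\<integral>\<^sup>+z. 0 \<partial>(lborel :: (real^2) measure))"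
  proof (rule nn_integral_dominated_convergence[where w="\<lambda>z. ennreal ((norm (A z))\<^sup>2)"])
    have [measurable]: "ball a (1 / real (Suc n)) \<in> sets borel" for n by simp
    show "(\<lambda>z. ennreal ((norm (A z))\<^sup>2) * indicator (ball a (1 / real (Suc n))) z) \<in> borel_measurable lborel" for n
      by measurable
    show "(\<integral>\<^sup>+z. ennreal ((norm (A z))\<^sup>2) \<partial>lborel) < \<infinity>"
      using A_L2 by (simp add: integrable_iff_bounded)
    show "AE z in lborel. ennreal ((norm (A z))\<^sup>2) * indicator (ball a (1 / real (Suc n))) z \<le> ennreal ((norm (A z))\<^sup>2)" for n
      by (intro AE_I2) (auto simp: indicator_def)
    have "AE z in lborel. z \<noteq> a" by (rule AE_lborel_singleton)
    then show "AE z in lborel. (\<lambda>n. ennreal ((norm (A z))\<^sup>2) * indicator (ball a (1 / real (Suc n))) z) \<longlonglongrightarrow> 0"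
    proof eventually_elim
      case (elim z)
      have "eventually (\<lambda>n. 1 / real (Suc n) < dist a z) sequentially"
        using lim_1_over_Suc elim by (intro order_tendstoD(2)[of _ 0]) auto
      then have "eventually (\<lambda>n. ennreal ((norm (A z))\<^sup>2) * indicator (ball a (1 / real (Suc n))) z = 0) sequentially"
        by eventually_elim auto
      then show ?case by (rule tendsto_eventually)
    qed
  qed auto
  then have "eventually (\<lambda>n. (\<integral>\<^sup>+z. ennreal ((norm (A z))\<^sup>2) * indicator (ball a (1 / real (Suc n))) z \<partial>lborel) < ennreal \<kappa>) sequentially"
    using assms by (intro order_tendstoD(2)) auto
  then obtain n where "(\<integral>\<^sup>+z. ennreal ((norm (A z))\<^sup>2) * indicator (ball a (1 / real (Suc n))) z \<partial>lborel) < ennreal \<kappa>"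
    by (auto simp: eventually_sequentially)
  then show ?thesis by (intro exI[of _ "1 / real (Suc n)"]) auto
qed

text \<open>The points of infinite order vanishing form a relatively clopen set. That its complement
  is open uses a radius which serves all centres near a given point, regardless of
  \<open>f\<close>.\<close>

theorem unique_continuation:
  assumes conn: "connected \<Omega>" and z0: "z0 \<in> \<Omega>" "vanishes z0"
  shows "AE z in lborel. z \<in> \<Omega> \<longrightarrow> f z = 0"
proof -
  \<comment> \<open>Chosen so that the smallness condition holds with equality.\<close>
  define \<kappa> where "\<kappa> = sqrt (bump_mass^4 / (512 * riesz_const^4))"
  have \<kappa>: "\<kappa> > 0" "512 * riesz_const^4 * \<kappa>\<^sup>2 \<le> bump_mass^4" using bump_mass_pos riesz_const_pos by (auto simp: \<kappa>_def)
  \<comment> \<open>With \<open>R\<close> at most a sixth of \<open>r1\<close> and half of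
    \<open>r2\<close>, a centre \<open>c\<close> within \<open>R\<close> of \<open>a\<close> has its
    ball of radius \<open>5 * R\<close> in the domain and its ball of radius \<open>R\<close> in the
    ball where \<open>A\<close> is small.\<close>
  have uniform: "\<exists>R>0. \<forall>c\<in>ball a R. vanishes c \<longrightarrow> (AE z in lborel. norm (z - c) < R \<longrightarrow> f z = 0)" if a: "a \<in> \<Omega>" for a
  proof -
    obtain r1 where r1: "r1 > 0" "cball a r1 \<subseteq> \<Omega>" using open_dom a open_contains_cball by blast
    obtain r2 where r2: "r2 > 0" "(\<integral>\<^sup>+z. ennreal ((norm (A z))\<^sup>2) * indicator (ball a r2) z \<partial>lborel) \<le> ennreal \<kappa>"
      using small_radius[OF \<kappa>(1)] by blast
    define R where "R = min (r1 / 6) (r2 / 2)"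
    have R: "R > 0" "6 * R \<le> r1" "2 * R \<le> r2" using r1 r2 by (auto simp: R_def)
    have "AE z in lborel. norm (z - c) < R \<longrightarrow> f z = 0" if c: "c \<in> ball a R" "vanishes c" for c
    proof (rule local_unique_continuation[OF c(2) R(1) _ _ _ \<kappa>(2)])
      show "cball c (5 * R) \<subseteq> \<Omega>"
      proof
        fix z assume "z \<in> cball c (5 * R)"
        then have "dist a z \<le> r1" using c R dist_triangle[of a z c] by auto
        then show "z \<in> \<Omega>" using r1 by auto
      qed
      have sub: "ball c R \<subseteq> ball a r2"
      proof
        fix z assume "z \<in> ball c R"
        then show "z \<in> ball a r2" using c R dist_triangle[of a z c] by auto
      qed
      have "(\<integral>\<^sup>+z. ennreal ((norm (A z))\<^sup>2) * indicator (ball c R) z \<partial>lborel)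
        \<le> (\<integral>\<^sup>+z. ennreal ((norm (A z))\<^sup>2) * indicator (ball a r2) z \<partial>lborel)"
        using sub by (intro nn_integral_mono mult_left_mono) (auto simp: indicator_def)
      then show "(\<integral>\<^sup>+z. ennreal ((norm (A z))\<^sup>2) * indicator (ball c R) z \<partial>lborel) \<le> ennreal \<kappa>"
        using r2(2) by (rule order_trans)
    qed (use \<kappa> in auto)
    with R show ?thesis by blast
  qed
  define Z where "Z = {a \<in> \<Omega>. vanishes a}"
  have opens: "open Z"
    unfolding open_contains_ball
  proof
    fix a assume a: "a \<in> Z"
    then obtain R where R: "R > 0" "\<forall>c\<in>ball a R. vanishes c \<longrightarrow> (AE z in lborel. norm (z - c) < R \<longrightarrow> f z = 0)"
      using uniform[of a] by (auto simp: Z_def)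
    then have ae: "AE z in lborel. norm (z - a) < R \<longrightarrow> f z = 0" using a by (auto simp: Z_def)
    obtain r where r: "r > 0" "ball a r \<subseteq> \<Omega>" using a open_dom unfolding Z_def open_contains_ball by blast
    have "c \<in> Z" if c: "c \<in> ball a (min r R)" for c
    proof -
      have "AE z in lborel. norm (z - c) < R - dist a c \<longrightarrow> f z = 0"
        using ae
      proof eventually_elim
        case (elim z)
        show ?case
          using elim norm_triangle_ineq[of "z - c" "c - a"] by (auto simp: dist_norm norm_minus_commute)
      qed
      then have "vanishes c" using c by (intro vanishes_if_zero_near[of "R - dist a c"]) auto
      then show ?thesis using c r by (auto simp: Z_def)
    qed
    then show "\<exists>e>0. ball a e \<subseteq> Z" using r R by (intro exI[of _ "min r R"]) auto
  qed
  \<comment> \<open>If some \<open>c\<close> within \<open>R\<close> of \<open>a\<close> were a zero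
    of infinite order, \<open>f\<close> would vanish on the ball of radius \<open>R\<close> around
    \<open>c\<close>. This ball is a neighbourhood of \<open>a\<close>, so \<open>a\<close> itself
    would belong to \<open>Z\<close>.\<close>
  have openc: "open (\<Omega> - Z)"
    unfolding open_contains_ball
  proof
    fix a assume a: "a \<in> \<Omega> - Z"
    then obtain R where R: "R > 0" "\<forall>c\<in>ball a R. vanishes c \<longrightarrow> (AE z in lborel. norm (z - c) < R \<longrightarrow> f z = 0)"
      using uniform[of a] by auto
    obtain r where r: "r > 0" "ball a r \<subseteq> \<Omega>" using a open_dom open_contains_ball by blast
    have "\<not> vanishes c" if c: "c \<in> ball a R" for c
    proof
      assume "vanishes c"
      then have ae: "AE z in lborel. norm (z - c) < R \<longrightarrow> f z = 0" using R c by auto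
      have "AE z in lborel. norm (z - a) < R - dist a c \<longrightarrow> f z = 0"
        using ae
      proof eventually_elim
        case (elim z)
        show ?case
          using elim norm_triangle_ineq[of "z - a" "a - c"] by (auto simp: dist_norm norm_minus_commute)
      qed
      then have "vanishes a" using c by (intro vanishes_if_zero_near[of "R - dist a c"]) auto
      then show False using a by (auto simp: Z_def)
    qed
    then have "ball a (min r R) \<subseteq> \<Omega> - Z" using r by (auto simp: Z_def)
    then show "\<exists>e>0. ball a e \<subseteq> \<Omega> - Z" using r R by (intro exI[of _ "min r R"]) auto
  qed
  have "Z = \<Omega>"
  proof -
    have "Z \<inter> (\<Omega> - Z) \<inter> \<Omega> = {}" "\<Omega> \<subseteq> Z \<union> (\<Omega> - Z)" by auto
    then have "Z \<inter> \<Omega> = {} \<or> (\<Omega> - Z) \<inter> \<Omega> = {}"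
      using conn opens openc unfolding connected_def by blast
    then show ?thesis using z0 by (auto simp: Z_def)
  qed
  have "\<exists>R>0. AE z in lborel. norm (z - a) < R \<longrightarrow> f z = 0" if a: "a \<in> \<Omega>" for a
  proof -
    obtain R where R: "R > 0" "\<forall>c\<in>ball a R. vanishes c \<longrightarrow> (AE z in lborel. norm (z - c) < R \<longrightarrow> f z = 0)"
      using uniform[OF a] by blast
    have "vanishes a" using a \<open>Z = \<Omega>\<close> by (auto simp: Z_def)
    then show ?thesis using R(1) bspec[OF R(2), of a] by auto
  qed
  then have "\<forall>a\<in>\<Omega>. \<exists>R. R > 0 \<and> (AE z in lborel. norm (z - a) < R \<longrightarrow> f z = 0)" by blast
  from bchoice[OF this] obtain r where
    r: "\<forall>a\<in>\<Omega>. r a > 0 \<and> (AE z in lborel. norm (z - a) < r a \<longrightarrow> f z = 0)" by blast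
  \<comment> \<open>The zero sets come with one null set per centre; a countable subcover keeps
    their union null.\<close>
  obtain F' where F': "F' \<subseteq> (\<lambda>a. ball a (r a)) ` \<Omega>" "countable F'" "\<Union>F' = \<Union>((\<lambda>a. ball a (r a)) ` \<Omega>)"
  proof (rule Lindelof)
    fix S assume "S \<in> (\<lambda>a. ball a (r a)) ` \<Omega>"
    then show "open S" by auto
  qed
  have "AE z in lborel. \<forall>X\<in>F'. z \<in> X \<longrightarrow> f z = 0"
  proof (rule AE_ball_countable[THEN iffD2, OF F'(2)], rule ballI)
    fix X assume "X \<in> F'"
    then obtain a where a: "a \<in> \<Omega>" "X = ball a (r a)" using F' by auto
    show "AE z in lborel. z \<in> X \<longrightarrow> f z = 0"
      using bspec[OF r a(1), THEN conjunct2] by eventually_elim (auto simp: a(2) dist_norm norm_minus_commute)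
  qed
  then show ?thesis
  proof eventually_elim
    case (elim z)
    show ?case
    proof
      assume "z \<in> \<Omega>"
      then have "z \<in> \<Union>((\<lambda>a. ball a (r a)) ` \<Omega>)" using r by force
      then show "f z = 0" using elim F'(3) by blast
    qed
  qed
qed

end

section \<open>Reduction to the real equation\<close>

text \<open>Local integrability gives measurability on compact subsets only. The extension by zero
  is the pointwise limit of restrictions to an increasing compact exhaustion.\<close>

lemma lebesgue_measurable_extend:
  fixes h :: "real^2 \<Rightarrow> 'b::euclidean_space"
  assumes "open \<Omega>" "\<And>K. compact K \<Longrightarrow> K \<subseteq> \<Omega> \<Longrightarrow> h \<in> borel_measurable (lebesgue_on K)"
  shows "(\<lambda>z. if z \<in> \<Omega> then h z else 0) \<in> borel_measurable lebesgue"
proof -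
  obtain C where C: "\<And>n::nat. compact (C n)" "\<And>n. C n \<subseteq> \<Omega>" "\<And>n. C n \<subseteq> interior (C (Suc n))" "\<Union>(range C) = \<Omega>"
    using open_Union_compact_subsets[OF assms(1)] by metis
  have inc: "C m \<subseteq> C n" if "m \<le> n" for m n
    using that by (induction n rule: dec_induct) (use C(3) interior_subset in blast)+
  show ?thesis
  proof (rule borel_measurable_LIMSEQ_metric)
    fix n
    have "C n \<in> sets lebesgue" using C(1) by (simp add: lmeasurable_compact fmeasurableD)
    then have "(\<lambda>z. indicator (C n) z *\<^sub>R h z) \<in> borel_measurable lebesgue"
      using assms(2)[OF C(1)[of n] C(2)[of n]] by (subst (asm) borel_measurable_restrict_space_iff) auto
    then show "(\<lambda>z. indicator (C n) z *\<^sub>R h z) \<in> borel_measurable lebesgue" .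
  next
    fix z :: "real^2"
    show "(\<lambda>n. indicator (C n) z *\<^sub>R h z) \<longlonglongrightarrow> (if z \<in> \<Omega> then h z else 0)"
    proof (cases "z \<in> \<Omega>")
      case True
      then obtain m where "z \<in> C m" using C(4) by auto
      then have "eventually (\<lambda>n. indicator (C n) z *\<^sub>R h z = h z) sequentially"
        unfolding eventually_sequentially using inc by (intro exI[of _ m]) (auto simp: indicator_def)
      then show ?thesis using True by (simp add: tendsto_eventually)
    next
      case False
      then have "indicator (C n) z *\<^sub>R h z = 0" for n using C(2)[of n] by (auto simp: indicator_def)
      then show ?thesis using False by (simp only: if_False tendsto_const)
    qed
  qed
qed

text \<open>Links functions known up to null sets and only inside the domain to the Borel functions
  on the plane on which the real argument works.\<close>

definition borel_rep :: "(real^2) set \<Rightarrow> (real^2 \<Rightarrow> real) \<Rightarrow> (real^2 \<Rightarrow> real) \<Rightarrow> bool" where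
  "borel_rep \<Omega> h hb \<longleftrightarrow> hb \<in> borel_measurable borel \<and> (AE z in lebesgue. hb z = (if z \<in> \<Omega> then h z else 0))"

lemma borel_rep_exists:
  fixes h :: "real^2 \<Rightarrow> real"
  assumes "open \<Omega>" "\<And>K. compact K \<Longrightarrow> K \<subseteq> \<Omega> \<Longrightarrow> h \<in> borel_measurable (lebesgue_on K)"
  shows "\<exists>hb. borel_rep \<Omega> h hb"
proof -
  obtain hb where "hb \<in> borel_measurable lborel" "AE z in lborel. (if z \<in> \<Omega> then h z else 0) = hb z"
    using completion_ex_borel_measurable_real[OF lebesgue_measurable_extend[OF assms]] by blast
  then show ?thesis
    unfolding borel_rep_def AE_completion_iff by (intro exI[of _ hb]) (auto elim!: eventually_mono)
qed

lemma bounded_linear_measurable_on: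
  assumes "bounded_linear T" "h \<in> borel_measurable M"
  shows "(\<lambda>z. T (h z)) \<in> borel_measurable M"
  using measurable_compose[OF assms(2) borel_measurable_continuous_onI[OF linear_continuous_on[OF assms(1)]]] .

text \<open>The dictionary between complex integrals over the domain and real integrals over the
  plane. Compact support of \<open>\<psi>\<close> makes local integrability sufficient, and a
  bounded linear \<open>T\<close> commutes with the integral.\<close>

lemma weak_pairing:
  fixes h :: "real^2 \<Rightarrow> complex"
  assumes \<Omega>: "open \<Omega>" and h: "L1_loc \<Omega> h" and T: "bounded_linear T"
    and rep: "borel_rep \<Omega> (\<lambda>z. T (h z)) hb"
    and \<psi>: "continuous_on UNIV \<psi>" and K: "compact K" "K \<subseteq> \<Omega>" "\<And>z. z \<notin> K \<Longrightarrow> \<psi> z = 0"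
  shows "integrable (lebesgue_on \<Omega>) (\<lambda>z. \<psi> z *\<^sub>R h z)"
    and "T (\<integral>z. \<psi> z *\<^sub>R h z \<partial>lebesgue_on \<Omega>) = (\<integral>z. \<psi> z * hb z \<partial>lborel)"
    and "integrable lborel (\<lambda>z. \<psi> z * hb z)"
proof -
  have \<Omega>s: "\<Omega> \<inter> space lebesgue \<in> sets lebesgue" using \<Omega> by auto
  have Ks: "K \<inter> space lebesgue \<in> sets lebesgue" using K by (simp add: lmeasurable_compact fmeasurableD)
  have "integrable (lebesgue_on K) h" using h K by (auto simp: L1_loc_def)
  then have hK: "integrable lebesgue (\<lambda>z. indicator K z *\<^sub>R h z)" by (simp only: integrable_restrict_space[OF Ks])
  have hb [measurable]: "hb \<in> borel_measurable borel" and ae: "AE z in lebesgue. hb z = (if z \<in> \<Omega> then T (h z) else 0)"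
    using rep by (auto simp: borel_rep_def)
  have \<psi>b: "\<psi> \<in> borel_measurable borel" using \<psi> by (rule borel_measurable_continuous_onI)
  then have \<psi>l: "\<psi> \<in> borel_measurable lebesgue" by (intro measurable_completion) simp
  obtain B where B: "B \<ge> 0" "\<And>z. z \<in> K \<Longrightarrow> norm (\<psi> z) \<le> B"
    using compact_continuous_bound[OF K(1) continuous_on_subset[OF \<psi> subset_UNIV]] by metis
  have "integrable lebesgue (\<lambda>z. \<psi> z *\<^sub>R (indicator K z *\<^sub>R h z))"
  proof (rule Bochner_Integration.integrable_bound)
    show "integrable lebesgue (\<lambda>z. B *\<^sub>R (indicator K z *\<^sub>R h z))" using hK by (rule integrable_scaleR_right)
    show "(\<lambda>z. \<psi> z *\<^sub>R (indicator K z *\<^sub>R h z)) \<in> borel_measurable lebesgue"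
      by (rule borel_measurable_scaleR[OF \<psi>l borel_measurable_integrable[OF hK]])
    show "AE z in lebesgue. norm (\<psi> z *\<^sub>R (indicator K z *\<^sub>R h z)) \<le> norm (B *\<^sub>R (indicator K z *\<^sub>R h z))"
    proof (rule AE_I2)
      fix z
      show "norm (\<psi> z *\<^sub>R (indicator K z *\<^sub>R h z)) \<le> norm (B *\<^sub>R (indicator K z *\<^sub>R h z))"
        using B by (cases "z \<in> K") (auto intro!: mult_right_mono)
    qed
  qed
  moreover have eqK: "\<psi> z *\<^sub>R (indicator K z *\<^sub>R h z) = indicator \<Omega> z *\<^sub>R (\<psi> z *\<^sub>R h z)" for z
    using K(2) K(3)[of z] by (auto simp: indicator_def)
  ultimately have i\<Omega>: "integrable lebesgue (\<lambda>z. indicator \<Omega> z *\<^sub>R (\<psi> z *\<^sub>R h z))"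
    by (simp only:)
  then show i: "integrable (lebesgue_on \<Omega>) (\<lambda>z. \<psi> z *\<^sub>R h z)" by (simp only: integrable_restrict_space[OF \<Omega>s])
  have T0: "T 0 = 0" and Ts: "T (c *\<^sub>R x) = c * T x" for c x
    using linear_0[OF bounded_linear.linear[OF T]] linear_scale[OF bounded_linear.linear[OF T]] by auto
  have ae': "AE z in lebesgue. T (indicator \<Omega> z *\<^sub>R (\<psi> z *\<^sub>R h z)) = \<psi> z * hb z"
    using ae by eventually_elim (auto simp: Ts T0)
  have m: "(\<lambda>z. \<psi> z * hb z) \<in> borel_measurable borel" using \<psi>b by measurable
  then have ml: "(\<lambda>z. \<psi> z * hb z) \<in> borel_measurable lebesgue" by (intro measurable_completion) simp
  have iT: "integrable lebesgue (\<lambda>z. T (indicator \<Omega> z *\<^sub>R (\<psi> z *\<^sub>R h z)))"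
    by (rule integrable_bounded_linear[OF T i\<Omega>])
  then have "integrable lebesgue (\<lambda>z. \<psi> z * hb z)"
    using integrable_cong_AE[OF borel_measurable_integrable[OF iT] ml ae'] by simp
  then show "integrable lborel (\<lambda>z. \<psi> z * hb z)"
    using m by (subst (asm) integrable_completion) auto
  have "T (\<integral>z. \<psi> z *\<^sub>R h z \<partial>lebesgue_on \<Omega>) = T (\<integral>z. indicator \<Omega> z *\<^sub>R (\<psi> z *\<^sub>R h z) \<partial>lebesgue)"
    by (simp only: integral_restrict_space[OF \<Omega>s])
  also have "\<dots> = (\<integral>z. T (indicator \<Omega> z *\<^sub>R (\<psi> z *\<^sub>R h z)) \<partial>lebesgue)"
    by (rule integral_bounded_linear[OF T i\<Omega>, symmetric])
  also have "\<dots> = (\<integral>z. \<psi> z * hb z \<partial>lebesgue)"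
    by (rule integral_cong_AE[OF borel_measurable_integrable[OF iT] ml ae'])
  also have "\<dots> = (\<integral>z. \<psi> z * hb z \<partial>lborel)" using m by (intro integral_completion) simp
  finally show "T (\<integral>z. \<psi> z *\<^sub>R h z \<partial>lebesgue_on \<Omega>) = (\<integral>z. \<psi> z * hb z \<partial>lborel)" .
qed

lemma L2_borel_rep:
  fixes h :: "real^2 \<Rightarrow> 'b::euclidean_space"
  assumes rep: "borel_rep \<Omega> h' hb" and le: "\<And>z. \<bar>h' z\<bar> \<le> norm (h z)"
    and K: "compact K" "K \<subseteq> \<Omega>" and h: "L2_on K h"
  shows "integrable lborel (\<lambda>z. (indicator K z * hb z)\<^sup>2)"
proof -
  have Ks: "K \<inter> space lebesgue \<in> sets lebesgue" using K by (simp add: lmeasurable_compact fmeasurableD)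
  have [measurable]: "K \<in> sets borel" using K by (simp add: borel_compact)
  have [measurable]: "hb \<in> borel_measurable borel" and ae: "AE z in lebesgue. hb z = (if z \<in> \<Omega> then h' z else 0)"
    using rep by (auto simp: borel_rep_def)
  have "integrable (lebesgue_on K) (\<lambda>z. (norm (h z))\<^sup>2)" using h by (simp add: L2_on_def)
  then have i: "integrable lebesgue (\<lambda>z. indicator K z *\<^sub>R (norm (h z))\<^sup>2)"
    by (simp only: integrable_restrict_space[OF Ks])
  have m: "(\<lambda>z. (indicator K z * hb z)\<^sup>2) \<in> borel_measurable lborel" by measurable
  have "integrable lebesgue (\<lambda>z. (indicator K z * hb z)\<^sup>2)"
  proof (rule Bochner_Integration.integrable_bound[OF i measurable_completion[OF m]])
    show "AE z in lebesgue. norm ((indicator K z * hb z)\<^sup>2) \<le> norm (indicator K z *\<^sub>R (norm (h z))\<^sup>2)"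
      using ae
    proof eventually_elim
      case (elim z)
      have "(h' z)\<^sup>2 \<le> (norm (h z))\<^sup>2" using le[of z] by (simp add: abs_le_square_iff[symmetric])
      then show ?case using elim K(2) by (auto simp: indicator_def)
    qed
  qed
  then show ?thesis using m by (subst (asm) integrable_completion) auto
qed

lemma test_functions_support:
  assumes "\<phi> \<in> test_functions \<Omega>"
  obtains K where "compact K" "K \<subseteq> \<Omega>" "\<And>z. z \<notin> K \<Longrightarrow> \<phi> z = 0" "\<And>z i. z \<notin> K \<Longrightarrow> pderiv_vec i \<phi> z = 0"
    "\<And>z i j. z \<notin> K \<Longrightarrow> pderiv_vec i (pderiv_vec j \<phi>) z = 0"
proof -
  define K where "K = closure {x. \<phi> x \<noteq> 0}"
  have K: "compact K" "K \<subseteq> \<Omega>" using assms by (auto simp: K_def test_functions_def)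
  have 0: "\<phi> z = 0" if "z \<notin> K" for z using that closure_subset[of "{x. \<phi> x \<noteq> 0}"] by (auto simp: K_def)
  have o: "open (- K)" by (simp add: K_def open_Compl)
  have 1: "pderiv_vec i \<phi> z = 0" if "z \<notin> K" for z i
    using grad_lap_const(1)[OF o, of z \<phi> 0] that 0 by (metis ComplD ComplI grad_component zero_index)
  have 2: "pderiv_vec i (pderiv_vec j \<phi>) z = 0" if "z \<notin> K" for z i j
    using grad_lap_const(1)[OF o, of z "pderiv_vec j \<phi>" 0] that 1 by (metis ComplD ComplI grad_component zero_index)
  show thesis using that K 0 1 2 by blast
qed

lemma test_functions_C_k: "\<phi> \<in> test_functions \<Omega> \<Longrightarrow> C_k_on k UNIV \<phi>"
  by (simp add: test_functions_def C_k_on_UNIV)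

text \<open>Allows a partial derivative of a test function in the definition of the weak gradient,
  which is how the equation obtains the Laplacian of the test function.\<close>

lemma test_functions_pderiv:
  assumes "\<phi> \<in> test_functions \<Omega>"
  shows "pderiv_vec i \<phi> \<in> test_functions \<Omega>"
proof -
  obtain K where K: "compact K" "K \<subseteq> \<Omega>" "\<And>z. z \<notin> K \<Longrightarrow> pderiv_vec i \<phi> z = 0"
    using test_functions_support[OF assms] by metis
  have "C_k k (pderiv_vec i \<phi>)" for k
    using C_k_on_pderiv_vec[OF test_functions_C_k[OF assms, of "Suc k"]] by (simp add: C_k_on_UNIV)
  then show ?thesis
    using closure_subset_compact[of K "pderiv_vec i \<phi>"] K by (auto simp: test_functions_def)
qed

text \<open>\<open>T\<close> stands for the real or the imaginary part. Since \<open>A\<close> is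
  real, \<open>T\<close> commutes with multiplication by its components, so \<open>T (v z)\<close>
  solves the same equation.\<close>

lemma scalar_part_vanishes:
  fixes A :: "real^2 \<Rightarrow> real^2" and v :: "real^2 \<Rightarrow> complex" and T :: "complex \<Rightarrow> real"
  assumes \<Omega>: "open \<Omega>" "connected \<Omega>" and A: "L2_on \<Omega> A" and v: "W12_loc \<Omega> v"
    and sol: "weak_solution \<Omega> A v" and z0: "z0 \<in> \<Omega>" "vanishes_to_infinite_order \<Omega> v z0"
    and T: "bounded_linear T" and T_le: "\<And>c. \<bar>T c\<bar> \<le> norm c"
  shows "AE z in lebesgue_on \<Omega>. T (v z) = 0"
proof -
  have \<Omega>s: "\<Omega> \<inter> space lebesgue \<in> sets lebesgue" using \<Omega> by auto
  have Ts: "T (c *\<^sub>R x) = c * T x" and Tm: "T (- x) = - T x" and Tp: "T (x + y) = T x + T y" for c x y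
    using linear_scale[OF bounded_linear.linear[OF T]] linear_neg[OF bounded_linear.linear[OF T]]
      linear_add[OF bounded_linear.linear[OF T]] by auto
  obtain G1 where G1: "has_weak_gradient \<Omega> v G1"
    "\<And>\<phi>. \<phi> \<in> test_functions \<Omega> \<Longrightarrow> (\<integral>x. (\<Sum>i\<in>UNIV. pderiv_vec i \<phi> x *\<^sub>R (G1 x $ i + (A x $ i) *\<^sub>R v x)) \<partial>lebesgue_on \<Omega>) = 0"
    using sol by (auto simp: weak_solution_def)
  \<comment> \<open>Two weak gradients are at hand: \<open>G2\<close> is square integrable and
    serves the embedding, while \<open>G1\<close> occurs in the equation and is eliminated below in
    favour of \<open>v\<close>.\<close>
  obtain G2 where G2: "has_weak_gradient \<Omega> v G2" "L2_loc \<Omega> G2" using v by (auto simp: W12_loc_def)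
  have v2: "L2_loc \<Omega> v" using v by (simp add: W12_loc_def)
  have v1: "L1_loc \<Omega> v" using G1 by (simp add: has_weak_gradient_def)
  have comp: "L1_loc \<Omega> (\<lambda>z. G z $ i)" if "has_weak_gradient \<Omega> v G" for G and i :: 2
    using that integrable_bounded_linear[OF bounded_linear_vec_nth[of i]]
    by (auto simp: has_weak_gradient_def L1_loc_def)
  have L1m: "(\<lambda>z. T (h z)) \<in> borel_measurable (lebesgue_on K)" if "L1_loc \<Omega> h" "compact K" "K \<subseteq> \<Omega>" for h K
    using that by (intro bounded_linear_measurable_on[OF T]) (auto simp: L1_loc_def)
  have Am: "(\<lambda>z. A z $ i) \<in> borel_measurable (lebesgue_on K)" if "compact K" "K \<subseteq> \<Omega>" for K i
  proof -
    have "A \<in> borel_measurable (lebesgue_on K)"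
      using A that(2) unfolding L2_on_def by (auto intro: measurable_restrict_mono)
    then show ?thesis by (rule bounded_linear_measurable_on[OF bounded_linear_vec_nth])
  qed
  obtain f where f: "borel_rep \<Omega> (\<lambda>z. T (v z)) f"
    using borel_rep_exists[OF \<Omega>(1) L1m[OF v1]] by blast
  have "\<forall>i. \<exists>h. borel_rep \<Omega> (\<lambda>z. A z $ i) h" using borel_rep_exists[OF \<Omega>(1) Am] by blast
  then obtain a where a: "\<And>i. borel_rep \<Omega> (\<lambda>z. A z $ i) (a i)" by metis
  have "\<forall>i. \<exists>h. borel_rep \<Omega> (\<lambda>z. T (G2 z $ i)) h" using borel_rep_exists[OF \<Omega>(1) L1m[OF comp[OF G2(1)]]] by blast
  then obtain g where g: "\<And>i. borel_rep \<Omega> (\<lambda>z. T (G2 z $ i)) (g i)" by metis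
  have "\<forall>i. \<exists>h. borel_rep \<Omega> (\<lambda>z. T (G1 z $ i)) h" using borel_rep_exists[OF \<Omega>(1) L1m[OF comp[OF G1(1)]]] by blast
  then obtain g1 where g1: "\<And>i. borel_rep \<Omega> (\<lambda>z. T (G1 z $ i)) (g1 i)" by metis
  have mb [measurable]: "f \<in> borel_measurable borel" "a i \<in> borel_measurable borel" "g i \<in> borel_measurable borel" for i
    using f a g by (auto simp: borel_rep_def)
  have Av: "borel_rep \<Omega> (\<lambda>z. T ((A z $ i) *\<^sub>R v z)) (\<lambda>z. a i z * f z)" for i
  proof -
    have "AE z in lebesgue. a i z = (if z \<in> \<Omega> then A z $ i else 0)" "AE z in lebesgue. f z = (if z \<in> \<Omega> then T (v z) else 0)"
      using a f by (auto simp: borel_rep_def)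
    then have "AE z in lebesgue. a i z * f z = (if z \<in> \<Omega> then T ((A z $ i) *\<^sub>R v z) else 0)"
      by eventually_elim (simp add: Ts)
    then show ?thesis by (simp add: borel_rep_def)
  qed
  \<comment> \<open>Local integrability of the product lets the equation be split into a gradient
    part and a drift part.\<close>
  have AvL1: "L1_loc \<Omega> (\<lambda>z. (A z $ i) *\<^sub>R v z)" for i
    unfolding L1_loc_def
  proof (intro allI impI)
    fix K :: "(real^2) set" assume K: "compact K \<and> K \<subseteq> \<Omega>"
    have Ks: "K \<in> sets lebesgue" using K by (simp add: lmeasurable_compact fmeasurableD)
    have "integrable lebesgue (\<lambda>z. indicator \<Omega> z *\<^sub>R (norm (A z))\<^sup>2)"
      using A by (simp only: L2_on_def integrable_restrict_space[OF \<Omega>s])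
    from integrable_mult_indicator[OF Ks this]
    have "integrable lebesgue (\<lambda>z. indicator K z *\<^sub>R (indicator \<Omega> z *\<^sub>R (norm (A z))\<^sup>2))" .
    moreover have "indicator K z *\<^sub>R (indicator \<Omega> z *\<^sub>R (norm (A z))\<^sup>2) = indicator K z *\<^sub>R (norm (A z))\<^sup>2" for z
      using K by (auto simp: indicator_def)
    ultimately have "integrable lebesgue (\<lambda>z. indicator K z *\<^sub>R (norm (A z))\<^sup>2)"
      by (simp only:)
    then have AK: "integrable (lebesgue_on K) (\<lambda>z. (norm (A z))\<^sup>2)"
      using Ks by (subst integrable_restrict_space) auto
    have vK: "v \<in> borel_measurable (lebesgue_on K)" "integrable (lebesgue_on K) (\<lambda>z. (norm (v z))\<^sup>2)"
      using v2 K by (auto simp: L2_loc_def L2_on_def)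
    show "integrable (lebesgue_on K) (\<lambda>z. (A z $ i) *\<^sub>R v z)"
    proof (rule Bochner_Integration.integrable_bound)
      show "integrable (lebesgue_on K) (\<lambda>z. (norm (A z))\<^sup>2 + (norm (v z))\<^sup>2)" using AK vK by auto
      show "(\<lambda>z. (A z $ i) *\<^sub>R v z) \<in> borel_measurable (lebesgue_on K)"
        using Am K vK by (intro borel_measurable_scaleR) auto
      show "AE z in lebesgue_on K. norm ((A z $ i) *\<^sub>R v z) \<le> norm ((norm (A z))\<^sup>2 + (norm (v z))\<^sup>2)"
      proof (rule AE_I2)
        fix z
        have "norm ((A z $ i) *\<^sub>R v z) \<le> norm (A z) * norm (v z)"
          using component_le_norm_cart[of "A z" i] by (simp add: mult_right_mono)
        also have "\<dots> \<le> (norm (A z))\<^sup>2 + (norm (v z))\<^sup>2"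
          using sum_squares_bound[of "norm (A z)" "norm (v z)"] mult_nonneg_nonneg[OF norm_ge_zero norm_ge_zero, of "A z" "v z"]
          by linarith
        finally show "norm ((A z $ i) *\<^sub>R v z) \<le> norm ((norm (A z))\<^sup>2 + (norm (v z))\<^sup>2)" by simp
      qed
    qed
  qed
  interpret weak_eq \<Omega> f "\<lambda>z. \<chi> i. a i z" g
  proof
    show "(\<lambda>z. \<chi> i. a i z) \<in> borel_measurable borel"
    proof -
      have "(\<chi> i. a i z) = (\<Sum>i\<in>UNIV. a i z *\<^sub>R axis i 1)" for z
        using basis_expansion[of "\<chi> i. a i z"] by (simp add: scalar_mult_eq_scaleR)
      then show ?thesis by simp
    qed
    show "integrable lborel (\<lambda>z. (indicator K z * f z)\<^sup>2)" if "compact K" "K \<subseteq> \<Omega>" for K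
      using v2 that by (intro L2_borel_rep[OF f, of v]) (auto simp: L2_loc_def T_le)
    show "integrable lborel (\<lambda>z. (indicator K z * g i z)\<^sup>2)" if "compact K" "K \<subseteq> \<Omega>" for K i
      using G2(2) that by (intro L2_borel_rep[OF g, where h=G2]) (auto simp: L2_loc_def intro: order_trans[OF T_le Finite_Cartesian_Product.norm_nth_le])
    show "integrable lborel (\<lambda>z. (norm (\<chi> i. a i z))\<^sup>2)"
    proof -
      have "AE z in lebesgue. \<forall>i. a i z = (if z \<in> \<Omega> then A z $ i else 0)"
        using a unfolding borel_rep_def by (intro eventually_all_finite) blast
      then have ae: "AE z in lebesgue. (norm (\<chi> i. a i z))\<^sup>2 = indicator \<Omega> z *\<^sub>R (norm (A z))\<^sup>2"
        by eventually_elim (auto simp: norm_vec2 indicator_def)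
      have i: "integrable lebesgue (\<lambda>z. indicator \<Omega> z *\<^sub>R (norm (A z))\<^sup>2)"
        using A by (simp only: L2_on_def integrable_restrict_space[OF \<Omega>s])
      have m: "(\<lambda>z. (norm (\<chi> i. a i z))\<^sup>2) \<in> borel_measurable lborel"
        unfolding norm_vec2 by simp
      have "integrable lebesgue (\<lambda>z. (norm (\<chi> i. a i z))\<^sup>2)"
        using integrable_cong_AE[OF measurable_completion[OF m] borel_measurable_integrable[OF i] ae] i by simp
      then show ?thesis using m by (subst (asm) integrable_completion) auto
    qed
    fix \<phi> assume \<phi>: "\<phi> \<in> test_functions \<Omega>"
    obtain K where K: "compact K" "K \<subseteq> \<Omega>" "\<And>z. z \<notin> K \<Longrightarrow> \<phi> z = 0" "\<And>z i. z \<notin> K \<Longrightarrow> pderiv_vec i \<phi> z = 0"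
      "\<And>z i j. z \<notin> K \<Longrightarrow> pderiv_vec i (pderiv_vec j \<phi>) z = 0"
      using test_functions_support[OF \<phi>] by blast
    have c0: "continuous_on UNIV \<phi>" and c1: "continuous_on UNIV (pderiv_vec i \<phi>)"
      and c2: "continuous_on UNIV (pderiv_vec i (pderiv_vec j \<phi>))" for i j
      using test_functions_C_k[OF \<phi>, of 0] test_functions_C_k[OF \<phi>, of "Suc 0"] test_functions_C_k[OF \<phi>, of "Suc (Suc 0)"]
      by auto
    have p0: "T (\<integral>z. \<phi> z *\<^sub>R (G2 z $ i) \<partial>lebesgue_on \<Omega>) = (\<integral>z. \<phi> z * g i z \<partial>lborel)" for i
      using K by (intro weak_pairing(2)[OF \<Omega>(1) comp[OF G2(1)] T g c0 K(1,2)])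
    have p1: "T (\<integral>z. pderiv_vec i \<phi> z *\<^sub>R v z \<partial>lebesgue_on \<Omega>) = (\<integral>z. pderiv_vec i \<phi> z * f z \<partial>lborel)" for i
      using K by (intro weak_pairing(2)[OF \<Omega>(1) v1 T f c1 K(1,2)])
    have p2: "T (\<integral>z. pderiv_vec i (pderiv_vec i \<phi>) z *\<^sub>R v z \<partial>lebesgue_on \<Omega>)
        = (\<integral>z. pderiv_vec i (pderiv_vec i \<phi>) z * f z \<partial>lborel)" for i
      using K by (intro weak_pairing(2)[OF \<Omega>(1) v1 T f c2 K(1,2)])
    have p2': "integrable lborel (\<lambda>z. pderiv_vec i (pderiv_vec i \<phi>) z * f z)" for i
      using K by (intro weak_pairing(3)[OF \<Omega>(1) v1 T f c2 K(1,2)])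
    have p3: "integrable (lebesgue_on \<Omega>) (\<lambda>z. pderiv_vec i \<phi> z *\<^sub>R ((A z $ i) *\<^sub>R v z))" for i
      using K by (intro weak_pairing(1)[OF \<Omega>(1) AvL1 T Av c1 K(1,2)])
    have p3': "T (\<integral>z. pderiv_vec i \<phi> z *\<^sub>R ((A z $ i) *\<^sub>R v z) \<partial>lebesgue_on \<Omega>)
        = (\<integral>z. pderiv_vec i \<phi> z * (a i z * f z) \<partial>lborel)" for i
      using K by (intro weak_pairing(2)[OF \<Omega>(1) AvL1 T Av c1 K(1,2)])
    have p3'': "integrable lborel (\<lambda>z. pderiv_vec i \<phi> z * (a i z * f z))" for i
      using K by (intro weak_pairing(3)[OF \<Omega>(1) AvL1 T Av c1 K(1,2)])
    have p4: "integrable (lebesgue_on \<Omega>) (\<lambda>z. pderiv_vec i \<phi> z *\<^sub>R (G1 z $ i))" for i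
      using K by (intro weak_pairing(1)[OF \<Omega>(1) comp[OF G1(1)] T g1 c1 K(1,2)])
    show "(\<integral>z. pderiv_vec i \<phi> z * f z \<partial>lborel) = - (\<integral>z. \<phi> z * g i z \<partial>lborel)" for i
    proof -
      have "(\<integral>x. pderiv_vec i \<phi> x *\<^sub>R v x \<partial>lebesgue_on \<Omega>) = - (\<integral>x. \<phi> x *\<^sub>R (G2 x $ i) \<partial>lebesgue_on \<Omega>)"
        using G2(1) \<phi> by (auto simp: has_weak_gradient_def)
      from arg_cong[OF this, of T] show ?thesis by (simp add: Tm p0 p1)
    qed
    have "(\<Sum>i\<in>UNIV. (\<integral>x. pderiv_vec i \<phi> x *\<^sub>R (G1 x $ i) \<partial>lebesgue_on \<Omega>)
        + (\<integral>x. pderiv_vec i \<phi> x *\<^sub>R ((A x $ i) *\<^sub>R v x) \<partial>lebesgue_on \<Omega>))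
      = (\<integral>x. (\<Sum>i\<in>UNIV. pderiv_vec i \<phi> x *\<^sub>R (G1 x $ i) + pderiv_vec i \<phi> x *\<^sub>R ((A x $ i) *\<^sub>R v x)) \<partial>lebesgue_on \<Omega>)"
      using p3 p4
      by (simp only: Bochner_Integration.integral_sum Bochner_Integration.integral_add Bochner_Integration.integrable_add)
    also have "\<dots> = 0" using G1(2)[OF \<phi>] by (simp only: scaleR_add_right)
    finally have "T (\<Sum>i\<in>UNIV. (\<integral>x. pderiv_vec i \<phi> x *\<^sub>R (G1 x $ i) \<partial>lebesgue_on \<Omega>)
        + (\<integral>x. pderiv_vec i \<phi> x *\<^sub>R ((A x $ i) *\<^sub>R v x) \<partial>lebesgue_on \<Omega>)) = 0"
      using linear_0[OF bounded_linear.linear[OF T]] by simp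
    then have sum0: "(\<Sum>i\<in>UNIV. T (\<integral>x. pderiv_vec i \<phi> x *\<^sub>R (G1 x $ i) \<partial>lebesgue_on \<Omega>)
        + (\<integral>z. pderiv_vec i \<phi> z * (a i z * f z) \<partial>lborel)) = 0"
      by (simp only: linear_sum[OF bounded_linear.linear[OF T]] Tp p3')
    \<comment> \<open>Apply the definition of the weak gradient to the test function
      \<open>pderiv_vec i \<phi>\<close>; this moves the remaining derivative off
      \<open>v\<close>.\<close>
    have g1T: "T (\<integral>x. pderiv_vec i \<phi> x *\<^sub>R (G1 x $ i) \<partial>lebesgue_on \<Omega>) = - (\<integral>z. pderiv_vec i (pderiv_vec i \<phi>) z * f z \<partial>lborel)" for i
    proof -
      have "(\<integral>x. pderiv_vec i (pderiv_vec i \<phi>) x *\<^sub>R v x \<partial>lebesgue_on \<Omega>) = - (\<integral>x. pderiv_vec i \<phi> x *\<^sub>R (G1 x $ i) \<partial>lebesgue_on \<Omega>)"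
        using G1(1) test_functions_pderiv[OF \<phi>] by (auto simp: has_weak_gradient_def)
      from arg_cong[OF this, of T] show ?thesis by (simp add: Tm p2)
    qed
    have "(\<integral>z. f z * (lap \<phi> z - (\<chi> i. a i z) \<bullet> grad \<phi> z) \<partial>lborel)
      = (\<integral>z. (\<Sum>i\<in>UNIV. pderiv_vec i (pderiv_vec i \<phi>) z * f z - pderiv_vec i \<phi> z * (a i z * f z)) \<partial>lborel)"
      by (intro Bochner_Integration.integral_cong refl)
         (simp add: lap_def inner_vec_def sum_subtractf[symmetric] sum_distrib_left algebra_simps)
    also have "\<dots> = (\<Sum>i\<in>UNIV. (\<integral>z. pderiv_vec i (pderiv_vec i \<phi>) z * f z \<partial>lborel) - (\<integral>z. pderiv_vec i \<phi> z * (a i z * f z) \<partial>lborel))"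
      using p2' p3''
      by (simp only: Bochner_Integration.integral_sum Bochner_Integration.integral_diff Bochner_Integration.integrable_diff)
    also have "\<dots> = - (\<Sum>i\<in>UNIV. T (\<integral>x. pderiv_vec i \<phi> x *\<^sub>R (G1 x $ i) \<partial>lebesgue_on \<Omega>)
        + (\<integral>z. pderiv_vec i \<phi> z * (a i z * f z) \<partial>lborel))"
      unfolding g1T by (simp add: sum_negf[symmetric])
    finally show "(\<integral>z. f z * (lap \<phi> z - (\<chi> i. a i z) \<bullet> grad \<phi> z) \<partial>lborel) = 0" unfolding sum0 by simp
  qed (use \<Omega> in simp_all)
  have frep: "AE z in lebesgue. f z = (if z \<in> \<Omega> then T (v z) else 0)" using f by (simp add: borel_rep_def)
  have "vanishes z0"
    unfolding vanishes_def
  proof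
    fix m :: nat
    \<comment> \<open>The exponent \<open>Suc m\<close> is positive also for \<open>m = 0\<close>,
      as the hypothesis requires. The surplus power is harmless once the radius is at most
      1.\<close>
    obtain C r where C: "C > 0" "r > 0"
      "AE z in lebesgue_on \<Omega>. norm (z - z0) < r \<longrightarrow> norm (v z) \<le> C * norm (z - z0) powr real (Suc m)"
      using z0(2)[unfolded vanishes_to_infinite_order_def, THEN spec[of _ "real (Suc m)"], THEN mp, OF of_nat_0_less_iff[THEN iffD2, OF zero_less_Suc]]
      by blast
    have "AE z in lebesgue. z \<in> \<Omega> \<longrightarrow> norm (z - z0) < r \<longrightarrow> norm (v z) \<le> C * norm (z - z0) powr real (Suc m)"
      using C(3) by (simp only: AE_restrict_space_iff[OF \<Omega>s])
    then have "AE z in lebesgue. norm (z - z0) < min r 1 \<longrightarrow> \<bar>f z\<bar> \<le> C * norm (z - z0) ^ m"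
      using frep
    proof eventually_elim
      case (elim z)
      show ?case
      proof
        assume z: "norm (z - z0) < min r 1"
        show "\<bar>f z\<bar> \<le> C * norm (z - z0) ^ m"
        proof (cases "z \<in> \<Omega>")
          case True
          have "\<bar>f z\<bar> \<le> norm (v z)" using elim(2) True T_le by simp
          also have "\<dots> \<le> C * norm (z - z0) powr real (Suc m)" using elim(1) True z by simp
          also have "norm (z - z0) powr real (Suc m) \<le> norm (z - z0) ^ m"
          proof (cases "z = z0")
            case False
            then have "norm (z - z0) powr real (Suc m) = norm (z - z0) ^ Suc m" by (intro powr_realpow) simp
            also have "\<dots> \<le> norm (z - z0) ^ m" using z by (simp add: mult_left_le_one_le)
            finally show ?thesis .
          qed simp
          finally show ?thesis using C(1) by simp
        qed (use elim(2) C(1) in simp)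
      qed
    qed
    then show "\<exists>C\<ge>0. \<exists>r>0. AE z in lborel. norm (z - z0) < r \<longrightarrow> \<bar>f z\<bar> \<le> C * norm (z - z0) ^ m"
      unfolding AE_completion_iff using C by (intro exI[of _ C] exI[of _ "min r 1"] conjI) auto
  qed
  then have "AE z in lebesgue. z \<in> \<Omega> \<longrightarrow> f z = 0"
    unfolding AE_completion_iff by (rule unique_continuation[OF \<Omega>(2) z0(1)])
  then have "AE z in lebesgue. z \<in> \<Omega> \<longrightarrow> T (v z) = 0"
    using frep by eventually_elim auto
  then show ?thesis by (simp only: AE_restrict_space_iff[OF \<Omega>s])
qed

theorem theorem4p1:
  fixes \<Omega> :: "(real^2) set"
    and A :: "real^2 \<Rightarrow> real^2"
    and v :: "real^2 \<Rightarrow> complex"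
    and C0 :: real
    and z0 :: "real^2"
  assumes "open \<Omega>" and "connected \<Omega>"
    and "L2_on \<Omega> A" and "L2_norm_on \<Omega> A \<le> C0"
    and "W12_loc \<Omega> v"
    and "weak_solution \<Omega> A v"
    and "z0 \<in> \<Omega>"
    and "vanishes_to_infinite_order \<Omega> v z0"
  shows "AE z in lebesgue_on \<Omega>. v z = 0"
proof -
  note part = scalar_part_vanishes[OF assms(1-3,5-8)]
  have "AE z in lebesgue_on \<Omega>. Re (v z) = 0"
    by (rule part[OF bounded_linear_Re]) (rule abs_Re_le_cmod)
  moreover have "AE z in lebesgue_on \<Omega>. Im (v z) = 0"
    by (rule part[OF bounded_linear_Im]) (rule abs_Im_le_cmod)
  ultimately show ?thesis
    by eventually_elim (simp add: complex_eq_iff)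
qed

end
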